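(* Let $\sigma$ be a lattice cone in $\mathbb{R}^2$ whose dual cone is $\check\sigma=\check\sigma(u_1,u_2)$ with $u_1,u_2\in\mathbb{Z}^2$ primitive, and for $h=(h_1,h_2)\in\mathbb{R}^2$ let $\sigma(h)=\{x\in\mathbb{R}^2:\langle x,u_i\rangle\ge-h_i,\ i=1,2\}$. Let $f$ be a smooth function, integrable on $\sigma(h)$ for some $h\in(\mathbb{R}_{>0})^2$ and rapidly decaying toward infinity in $\sigma$. Then as $t\to0^+$ one has the asymptotic expansion $$\sum_{x\in\sigma\cap\mathbb{Z}^2}wt_\sigma(x)f(tx)\ \sim\ \Big(\operatorname{Todd}_{\check\sigma}^{\mathrm{even}}(\partial_{h_1},\partial_{h_2})-\frac q2\partial_{h_1}\partial_{h_2}\Big)\circ\int_{\sigma(h)}f(tx)\,dx\,\Big|_{h=0},$$ with $q=|\Gamma_{\check\sigma}|$, the right side being understood as the formal series in powers of $t$ obtained by applying the homogeneous components of the operator term by term.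
   Context: A lattice cone $\sigma=\sigma(v_1,v_2)$ is given by an ordered pair of linearly independent primitive $v_1,v_2\in\mathbb{Z}^2$; as a set $\{x_1v_1+x_2v_2:x_i\ge0\}$. The dual cone $\check\sigma=\{y\neq0:\langle y,x\rangle\ge0\ \forall x\in\sigma\}$ is generated by the primitive inward normals $u_1,u_2$. Weight: $wt_\sigma(x)=1$ on the interior of $\sigma$, $\tfrac12$ on the boundary minus the origin, $0$ otherwise. $\Gamma_{\check\sigma}=\mathbb{Z}^2/(\mathbb{Z}u_1+\mathbb{Z}u_2)$; with $\alpha_1,\alpha_2$ the dual basis of $u_1,u_2$, $\lambda_{\gamma,i}=e^{2\pi i\langle\gamma,\alpha_i\rangle}$. $\operatorname{Todd}^\lambda(S)=\frac{S}{1-\lambda e^{-S}}$, $\operatorname{Todd}_{\check\sigma}(x_1,x_2)=\sum_{\gamma\in\Gamma_{\check\sigma}}\operatorname{Todd}^{\lambda_{\gamma,1}}(x_1)\operatorname{Todd}^{\lambda_{\gamma,2}}(x_2)$, and $\operatorname{Todd}^{\mathrm{even}}_{\check\sigma}(x_1,x_2)=\tfrac12(\operatorname{Todd}_{\check\sigma}(x_1,x_2)+\operatorname{Todd}_{\check\sigma}(-x_1,-x_2))$.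
   Formalization: Integrability on σ(h) and rapid decay in σ are required of f and all its partial derivatives, not of f alone; for f alone the expansion can fail (tall thin bumps far out in σ) or the right side can be undefined (bumps accumulating at the boundary of σ from outside). *)

theory Defs
  imports "HOL-Analysis.Analysis" "HOL-Library.Landau_Symbols"
    "HOL-Computational_Algebra.Formal_Power_Series"
begin

definition rvec :: "int ^ 2 \<Rightarrow> real ^ 2" where
  "rvec v = (\<chi> i. real_of_int (v $ i))"

definition primitive :: "int ^ 2 \<Rightarrow> bool" where
  "primitive v \<longleftrightarrow> gcd (v $ 1) (v $ 2) = 1"

definition lattice_cone :: "int ^ 2 \<Rightarrow> int ^ 2 \<Rightarrow> bool" where
  "lattice_cone v1 v2 \<longleftrightarrow>
     primitive v1 \<and> primitive v2 \<and> v1 \<noteq> v2 \<and> independent {rvec v1, rvec v2}"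

definition cone_set :: "int ^ 2 \<Rightarrow> int ^ 2 \<Rightarrow> (real ^ 2) set" where
  "cone_set v1 v2 = {x1 *\<^sub>R rvec v1 + x2 *\<^sub>R rvec v2 | x1 x2. 0 \<le> x1 \<and> 0 \<le> x2}"

definition dual_cone :: "(real ^ 2) set \<Rightarrow> (real ^ 2) set" where
  "dual_cone S = {y. y \<noteq> 0 \<and> (\<forall>x\<in>S. 0 \<le> y \<bullet> x)}"

text \<open>By definition the dual cone omits the origin, whereas \<^const>\<open>cone_set\<close> contains it.\<close>

definition is_dual_cone :: "int ^ 2 \<Rightarrow> int ^ 2 \<Rightarrow> int ^ 2 \<Rightarrow> int ^ 2 \<Rightarrow> bool" where
  "is_dual_cone v1 v2 u1 u2 \<longleftrightarrow>
     lattice_cone u1 u2 \<and> dual_cone (cone_set v1 v2) = cone_set u1 u2 - {0}"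

definition wt :: "(real ^ 2) set \<Rightarrow> real ^ 2 \<Rightarrow> real" where
  "wt S x = (if x \<in> interior S then 1 else if x \<in> frontier S - {0} then 1 / 2 else 0)"

definition shifted_cone :: "int ^ 2 \<Rightarrow> int ^ 2 \<Rightarrow> real ^ 2 \<Rightarrow> (real ^ 2) set" where
  "shifted_cone u1 u2 h = {x. - (h $ 1) \<le> x \<bullet> rvec u1 \<and> - (h $ 2) \<le> x \<bullet> rvec u2}"

definition Gamma_rel :: "int ^ 2 \<Rightarrow> int ^ 2 \<Rightarrow> ((int ^ 2) \<times> (int ^ 2)) set" where
  "Gamma_rel u1 u2 = {(x, y). \<exists>m n. x - y = m *s u1 + n *s u2}"

definition Gamma :: "int ^ 2 \<Rightarrow> int ^ 2 \<Rightarrow> (int ^ 2) set set" where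
  "Gamma u1 u2 = UNIV // Gamma_rel u1 u2"

definition dual_vec1 :: "int ^ 2 \<Rightarrow> int ^ 2 \<Rightarrow> real ^ 2" where
  "dual_vec1 u1 u2 = (THE a. a \<bullet> rvec u1 = 1 \<and> a \<bullet> rvec u2 = 0)"

definition dual_vec2 :: "int ^ 2 \<Rightarrow> int ^ 2 \<Rightarrow> real ^ 2" where
  "dual_vec2 u1 u2 = (THE a. a \<bullet> rvec u1 = 0 \<and> a \<bullet> rvec u2 = 1)"

text \<open>The value of \<open>lam\<close> does not depend on the representative of the class when \<open>a\<close> pairs
  integrally with \<open>u1\<close> and \<open>u2\<close>, as the dual basis vectors do.\<close>

definition lam :: "(int ^ 2) set \<Rightarrow> real ^ 2 \<Rightarrow> complex" where
  "lam \<gamma> a = exp (2 * of_real pi * \<i> * of_real (rvec (SOME g. g \<in> \<gamma>) \<bullet> a))"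

text \<open>For \<open>l = 1\<close> numerator and denominator both have subdegree 1, and division of formal power
  series cancels the common factor.\<close>

definition Todd :: "complex \<Rightarrow> complex fps" where
  "Todd l = fps_X / (1 - fps_const l * fps_exp (- 1))"

text \<open>Formal power series in two variables are given by their coefficients: the value at \<open>a b\<close> is
  the coefficient of \<open>x1 ^ a * x2 ^ b\<close>.\<close>

type_synonym fps2 = "nat \<Rightarrow> nat \<Rightarrow> complex"

definition Todd_cone :: "int ^ 2 \<Rightarrow> int ^ 2 \<Rightarrow> fps2" where
  "Todd_cone u1 u2 a b =
     (\<Sum>\<gamma>\<in>Gamma u1 u2. fps_nth (Todd (lam \<gamma> (dual_vec1 u1 u2))) a *
                       fps_nth (Todd (lam \<gamma> (dual_vec2 u1 u2))) b)"

definition fps2_reflect :: "fps2 \<Rightarrow> fps2"  \<comment> \<open>substitutes \<open>- x1\<close>, \<open>- x2\<close>\<close> where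
  "fps2_reflect P a b = (- 1) ^ (a + b) * P a b"

definition Todd_even :: "int ^ 2 \<Rightarrow> int ^ 2 \<Rightarrow> fps2" where
  "Todd_even u1 u2 a b = 1 / 2 * (Todd_cone u1 u2 a b + fps2_reflect (Todd_cone u1 u2) a b)"

definition EM_symbol :: "int ^ 2 \<Rightarrow> int ^ 2 \<Rightarrow> fps2"
    \<comment> \<open>\<open>Todd_even(x1, x2) - q / 2 * x1 * x2\<close>\<close> where
  "EM_symbol u1 u2 a b =
     Todd_even u1 u2 a b - (if a = 1 \<and> b = 1 then of_nat (card (Gamma u1 u2)) / 2 else 0)"

definition partial :: "2 \<Rightarrow> (real ^ 2 \<Rightarrow> complex) \<Rightarrow> real ^ 2 \<Rightarrow> complex" where
  "partial i g x = vector_derivative (\<lambda>s. g (x + s *\<^sub>R axis i 1)) (at 0)"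

text \<open>\<open>foldr partial is f\<close> is the iterated partial derivative along a list \<open>is\<close> of coordinates.\<close>

definition smooth :: "(real ^ 2 \<Rightarrow> complex) \<Rightarrow> bool" where
  "smooth f \<longleftrightarrow> (\<forall>is x. foldr partial is f differentiable (at x))"

text \<open>Integrability and rapid decay of a smooth function are understood, as for Schwartz functions,
  to include all partial derivatives. For the function alone they would not suffice:
  tall narrow bumps far out in the cone destroy the asymptotics of the lattice sum, and bumps outside
  the cone accumulating at its boundary destroy the differentiability at \<open>h = 0\<close> of the integral
  over \<open>shifted_cone u1 u2 h\<close>.\<close>

definition smooth_integrable_on :: "(real ^ 2 \<Rightarrow> complex) \<Rightarrow> (real ^ 2) set \<Rightarrow> bool" where
  "smooth_integrable_on f S \<longleftrightarrow> (\<forall>is. set_integrable lborel S (foldr partial is f))"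

definition rapidly_decaying_on :: "(real ^ 2 \<Rightarrow> complex) \<Rightarrow> (real ^ 2) set \<Rightarrow> bool" where
  "rapidly_decaying_on f S \<longleftrightarrow>
     (\<forall>is n. ((\<lambda>x. norm x ^ n *\<^sub>R foldr partial is f x) \<longlongrightarrow> 0) (inf at_infinity (principal S)))"

definition homog_op :: "fps2 \<Rightarrow> nat \<Rightarrow> (real ^ 2 \<Rightarrow> complex) \<Rightarrow> real ^ 2 \<Rightarrow> complex"
    \<comment> \<open>the degree \<open>k\<close> homogeneous component of \<open>P(\<partial>\<^sub>1, \<partial>\<^sub>2)\<close>\<close> where
  "homog_op P k F h = (\<Sum>a\<le>k. P a (k - a) * (partial 1 ^^ a) ((partial 2 ^^ (k - a)) F) h)"

end

theory Submission
  imports Defs "HOL-Real_Asymp.Real_Asymp"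
begin

text \<open>In the coordinates \<open>y\<^sub>i = \<langle>x, u\<^sub>i\<rangle>\<close> the cone is the quadrant \<open>y\<^sub>1, y\<^sub>2 \<ge> 0\<close> and \<open>\<int>\<^sup>2\<close> becomes a sublattice of index
  \<open>q\<close> of \<open>\<int>\<^sup>2\<close>, whose indicator function is the average of the characters \<open>\<lambda>\<^sub>\<gamma>\<^sub>,\<^sub>1 ^ y\<^sub>1 * \<lambda>\<^sub>\<gamma>\<^sub>,\<^sub>2 ^ y\<^sub>2\<close>. The sum for
  one character is expanded by applying a twisted Euler-Maclaurin formula in each variable; with weight
  1/2 at the origin of a half-line its symbol is \<open>Todd\<^sup>\<lambda>(S) - S / 2\<close>. Since \<open>Todd\<^sup>\<lambda>(- S) + S / 2\<close> is the
  same expression for \<open>\<lambda>\<^sup>-\<^sup>1\<close>, the product of the two symbols summed over \<open>\<gamma>\<close> is even and equals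
  \<open>Todd_even - q / 4 * x\<^sub>1 * x\<^sub>2\<close>; changing the weight of the origin from 1/4 to 0 subtracts another
  \<open>q / 4 * x\<^sub>1 * x\<^sub>2\<close>.\<close>

section \<open>The Todd series\<close>

text \<open>Two kinds of control on \<open>f\<close> shape the proof. Rapid decay is assumed on the
  cone only; there it bounds each derivative by a multiple of
  \<open>1 / ((1 + y) ^ 2 * (1 + z) ^ 2)\<close>, as the lattice sums require. Differentiating in
  \<open>h\<close> at 0 involves a neighbourhood of the cone, where only integrability of the
  derivatives is given, so a majorant has to be extracted from integrals over strips. Since
  \<open>f\<close> is not a product, the formula is applied in \<open>z\<close> for fixed
  \<open>y\<close>, with an error that decays in \<open>y\<close>, and then in \<open>y\<close> to
  the boundary integrals and boundary derivatives so obtained. Truncation in each variable leaves a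
  square of exponents, which is finally cut down to total degree at most \<open>N\<close>. The
  factor \<open>1 / q\<close> arises twice, from averaging the characters and from the Jacobian of
  the coordinates; hence the symbol is a plain sum over \<open>\<Gamma>\<close>. The symbol
  \<open>Todd\<close> can be read off from \<open>exp (- s * x)\<close>: its twisted sum over all
  \<open>n \<ge> 0\<close> is \<open>1 / (1 - l * exp (- s))\<close>, and its integral over
  \<open>{- h..}\<close> is \<open>exp (s * h) / s\<close>. Halving the term at 0 removes half a
  derivative, that is \<open>S / 2\<close>.\<close>

lemma Todd_mult: "Todd l * (1 - fps_const l * fps_exp (- 1)) = fps_X"
proof -
  let ?d = "1 - fps_const l * fps_exp (- 1) :: complex fps"
  \<comment> \<open>The first two coefficients are \<open>1 - l\<close> and \<open>l\<close>, which
    cannot both vanish. So the denominator divides \<open>fps_X\<close> whether or not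
    \<open>l = 1\<close>.\<close>
  have nz: "fps_nth ?d 0 \<noteq> 0 \<or> fps_nth ?d 1 \<noteq> 0"
    by auto
  hence "?d \<noteq> 0"
    by (metis fps_zero_nth)
  moreover have "subdegree ?d \<le> 1"
    using nz by (rule disjE) (use subdegree_leI[of ?d 0] subdegree_leI[of ?d 1] in linarith)+
  ultimately have "?d dvd fps_X"
    by (simp add: fps_dvd_iff)
  thus ?thesis
    unfolding Todd_def by simp
qed

definition half_Todd :: "complex \<Rightarrow> complex fps" where
  "half_Todd l = Todd l - fps_const (1 / 2) * fps_X"

lemma half_Todd_nth: "fps_nth (half_Todd l) a = fps_nth (Todd l) a - (if a = 1 then 1 / 2 else 0)"
  by (simp add: half_Todd_def)

lemma fps_nth_compose_uminus_X: "fps_nth (F oo - fps_X) n = (- 1) ^ n * (fps_nth F n :: complex)"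
  by (simp add: fps_compose_uminus')

text \<open>Over the common denominator \<open>1 - l * exp S\<close>, the series
  \<open>Todd (inverse l)\<close> at \<open>S\<close> and \<open>Todd l\<close> at
  \<open>- S\<close> have numerators \<open>- l * S * exp S\<close> and \<open>- S\<close>. These
  differ by \<open>S\<close> times the denominator, and subtracting \<open>S / 2\<close> splits this
  difference \<open>S\<close> evenly between the two.\<close>

lemma half_Todd_inverse:
  assumes "l \<noteq> 0"
  shows "fps_nth (half_Todd (inverse l)) a = (- 1) ^ a * fps_nth (half_Todd l) a"
proof -
  let ?E = "fps_exp 1 :: complex fps" and ?E' = "fps_exp (- 1) :: complex fps"
  let ?S = "Todd (inverse l)" and ?T = "Todd l oo - fps_X"
  let ?d = "1 - fps_const l * ?E"
  have EE: "?E * ?E' = 1"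
    by (simp flip: fps_exp_add_mult)
  have S: "?S * (1 - fps_const (inverse l) * ?E') = fps_X"
    by (rule Todd_mult)
  have "(Todd l * (1 - fps_const l * ?E')) oo - fps_X = - fps_X"
    by (simp add: Todd_mult)
  moreover have "?E' oo - fps_X = ?E"
    by (rule fps_ext) (simp add: fps_nth_compose_uminus_X flip: power_mult_distrib)
  ultimately have T: "?T * ?d = - fps_X"
    by (simp add: fps_compose_mult_distrib fps_compose_sub_distrib)
  have "?S * (1 - fps_const (inverse l) * ?E') * (- fps_const l * ?E) = - fps_const l * ?E * fps_X"
    by (simp add: S)
  moreover have "(1 - fps_const (inverse l) * ?E') * (- fps_const l * ?E) = ?d"
  proof -
    have *: "(1 - m * e') * (- k * e) = 1 - k * e" if "m * k = 1" "e * e' = 1" for m k e e' :: "complex fps"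
      using that by algebra
    show ?thesis by (rule *) (use EE assms in simp_all)
  qed
  ultimately have S': "?S * ?d = - (fps_const l * ?E) * fps_X"
    by (metis mult.assoc minus_mult_left)
  have *: "(x - y - z) * (1 - w) = 0" if "y * (1 - w) = - z" "x * (1 - w) = - w * z" for x y z w :: "complex fps"
    using that by algebra
  have "(?S - ?T - fps_X) * ?d = 0"
    by (rule *[OF T S'])
  moreover have "fps_nth ?d 1 \<noteq> 0"
    using assms by simp
  hence "?d \<noteq> 0" by (metis fps_zero_nth)
  ultimately have "?S - ?T - fps_X = 0"
    by (metis mult_eq_0_iff)
  hence ST: "?S = ?T + fps_X"
    by (simp add: algebra_simps)
  have "fps_nth ?S a = (- 1) ^ a * fps_nth (Todd l) a + (if a = 1 then 1 else 0)"
    by (subst ST) (simp add: fps_nth_compose_uminus_X)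
  thus ?thesis
    by (simp add: half_Todd_nth algebra_simps)
qed

section \<open>The twisted Euler-Maclaurin formula\<close>

text \<open>The coefficients of \<open>c * exp (x X)\<close>: for \<open>c = Todd l - X\<close> a twisted analogue of the Bernoulli polynomials.\<close>

definition bern_poly :: "complex fps \<Rightarrow> nat \<Rightarrow> real \<Rightarrow> complex" where
  "bern_poly c a x = (\<Sum>j\<le>a. fps_nth c j * of_real (x ^ (a - j) / fact (a - j)))"

lemma bern_poly_0 [simp]: "bern_poly c a 0 = fps_nth c a"
proof -
  have "bern_poly c a 0 = (\<Sum>j\<le>a. if j = a then fps_nth c a else 0)"
    unfolding bern_poly_def by (rule sum.cong) (auto simp: power_0_left)
  thus ?thesis by simp
qed

lemma bern_poly_1: "bern_poly c a 1 = fps_nth (c * fps_exp 1) a"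
  unfolding bern_poly_def fps_mult_nth
  by (rule sum.cong) (auto simp: atMost_atLeast0)

lemma bern_poly_zeroth: "bern_poly c 0 x = fps_nth c 0"
  by (simp add: bern_poly_def)

lemma bern_poly_has_vector_derivative:
  "(bern_poly c (Suc a) has_vector_derivative bern_poly c a x) (at x within S)"
proof -
  have *: "((\<lambda>x. fps_nth c j * of_real (x ^ (Suc a - j) / fact (Suc a - j))) has_vector_derivative
          fps_nth c j * of_real (x ^ (a - j) / fact (a - j))) (at x within S)" if "j \<le> a" for j
  proof -
    have "((\<lambda>x. x ^ Suc (a - j) / fact (Suc (a - j))) has_real_derivative
        (real (Suc (a - j)) * x ^ (a - j) / fact (Suc (a - j)))) (at x within S)"
      by (rule derivative_eq_intros refl | simp)+
    also have "real (Suc (a - j)) * x ^ (a - j) / fact (Suc (a - j)) = x ^ (a - j) / fact (a - j)"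
      by (simp add: field_simps del: of_nat_Suc)
    finally show ?thesis
      using that by (intro has_vector_derivative_mult_right has_vector_derivative_of_real)
        (simp add: has_real_derivative_iff_has_vector_derivative Suc_diff_le)
  qed
  have "((\<lambda>x. (\<Sum>j\<le>a. fps_nth c j * of_real (x ^ (Suc a - j) / fact (Suc a - j))) + fps_nth c (Suc a))
      has_vector_derivative (\<Sum>j\<le>a. fps_nth c j * of_real (x ^ (a - j) / fact (a - j))) + 0) (at x within S)"
    by (intro has_vector_derivative_add has_vector_derivative_sum has_vector_derivative_const *) auto
  thus ?thesis
    by (simp add: bern_poly_def[abs_def])
qed

lemma continuous_on_bern_poly: "continuous_on S (bern_poly c a)"
  unfolding bern_poly_def[abs_def] by (intro continuous_intros) auto

text \<open>Multiplying \<open>Todd_mult\<close> by \<open>exp X\<close> gives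
  \<open>c * exp X = l * c + l * X\<close> for \<open>c = Todd l - X\<close>. For
  \<open>l = 1\<close> one has \<open>c = X / (exp X - 1)\<close>, and this is the classical
  relation between the Bernoulli polynomials at 1 and at 0, divided by \<open>a!\<close>.\<close>

lemma Todd_bern_poly_1:
  "bern_poly (Todd l - fps_X) a 1 = l * fps_nth (Todd l - fps_X) a + (if a = 1 then l else 0)"
proof -
  let ?E = "fps_exp 1 :: complex fps" and ?E' = "fps_exp (- 1) :: complex fps"
  have EE: "?E * ?E' = 1"
    by (simp flip: fps_exp_add_mult)
  have "Todd l * (1 - fps_const l * ?E') * ?E = fps_X * ?E"
    by (simp add: Todd_mult)
  moreover have "Todd l * (1 - fps_const l * ?E') * ?E = Todd l * ?E - fps_const l * Todd l * (?E * ?E')"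
    by (simp add: algebra_simps)
  ultimately have "(Todd l - fps_X) * ?E = fps_const l * (Todd l - fps_X) + fps_const l * fps_X"
    using EE by (simp add: algebra_simps)
  hence "fps_nth ((Todd l - fps_X) * ?E) a = fps_nth (fps_const l * (Todd l - fps_X) + fps_const l * fps_X) a"
    by simp
  thus ?thesis
    unfolding bern_poly_1 by simp
qed

text \<open>So the coefficient of the integral itself vanishes unless \<open>l = 1\<close>, and
  powers of \<open>l\<close> in front of it may be dropped.\<close>

lemma Todd_nth_0: "l * fps_nth (Todd l) 0 = fps_nth (Todd l) 0"
  using Todd_bern_poly_1[of l 0] by (simp add: bern_poly_zeroth)

text \<open>\<open>\<phi> k\<close> stands for the \<open>k\<close>-th derivative of \<open>\<phi> 0\<close>, and \<open>boundary_term \<phi> a\<close> for the \<open>a\<close>-th derivative at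
  \<open>h = 0\<close> of the integral of \<open>\<phi> 0\<close> over \<open>{- h..}\<close>.\<close>

definition boundary_term :: "(nat \<Rightarrow> real \<Rightarrow> complex) \<Rightarrow> nat \<Rightarrow> complex" where
  "boundary_term \<phi> a = (case a of 0 \<Rightarrow> set_lebesgue_integral lborel {0..} (\<phi> 0)
                               | Suc k \<Rightarrow> (- 1) ^ k * \<phi> k 0)"

definition half_weight :: "nat \<Rightarrow> complex" where
  "half_weight n = (if n = 0 then 1 / 2 else 1)"

text \<open>The twisted periodicity of the kernel, \<open>Todd_bern_poly_1\<close>, makes the boundary terms of the integrations by
  parts over successive unit intervals telescope, whether or not \<open>l = 1\<close>.\<close>

lemma Euler_Maclaurin_partial:
  fixes \<phi> :: "nat \<Rightarrow> real \<Rightarrow> complex" and l :: complex and M :: nat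
  defines "c \<equiv> Todd l - fps_X"
  assumes deriv: "\<And>k y. 0 \<le> y \<Longrightarrow> (\<phi> k has_vector_derivative \<phi> (Suc k) y) (at y)"
    and M: "0 < M"
  shows "(\<Sum>n\<le>N. half_weight n * l ^ n * \<phi> 0 (real n)) =
     fps_nth c 0 * integral {0..real N} (\<phi> 0) + 1 / 2 * \<phi> 0 0
     - (\<Sum>a<M. (- 1) ^ a * fps_nth c (Suc a) * (l ^ N * \<phi> a (real N) - \<phi> a 0))
     - (- 1) ^ M * (\<Sum>n<N. l ^ n * integral {real n..real n + 1} (\<lambda>x. bern_poly c M (x - real n) * \<phi> M x))"
proof -
  have cont: "continuous_on {real n..z} (\<phi> k)" for k n z
    by (rule continuous_at_imp_continuous_on)
       (auto intro!: has_vector_derivative_continuous deriv)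
  \<comment> \<open>Only the right end of the cell is sampled, with the factor \<open>l\<close>.
    After multiplication by \<open>l ^ n\<close> the cells supply the terms \<open>1, ..., N\<close>
    of the twisted sum; the half term at 0 is added separately.\<close>
  have cell: "fps_nth c 0 * integral {real n..real n + 1} (\<phi> 0)
       - (- 1) ^ M * integral {real n..real n + 1} (\<lambda>x. bern_poly c M (x - real n) * \<phi> M x)
     = l * \<phi> 0 (real n + 1) + (\<Sum>a<M. (- 1) ^ a * fps_nth c (Suc a) * (l * \<phi> a (real n + 1) - \<phi> a (real n)))"
    (is "?lhs = ?rhs") for n
  proof -
    define F where "F x = (\<Sum>a<M. (- 1) ^ a * (bern_poly c (Suc a) (x - real n) * \<phi> a x))" for x
    \<comment> \<open>The left side is the derivative of \<open>F\<close> by the product rule. Since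
      \<open>bern_poly c a\<close> is the derivative of \<open>bern_poly c (Suc a)\<close>,
      consecutive \<open>a\<close> contribute equal products with opposite signs, and only the two
      extreme ones survive.\<close>
    have tel: "(\<Sum>a<m. (- 1) ^ a * (bern_poly c (Suc a) (x - real n) * \<phi> (Suc a) x
                 + bern_poly c a (x - real n) * \<phi> a x))
         = fps_nth c 0 * \<phi> 0 x - (- 1) ^ m * (bern_poly c m (x - real n) * \<phi> m x)" for m x
      by (induction m) (simp_all add: bern_poly_zeroth algebra_simps)
    have F: "(F has_vector_derivative
         fps_nth c 0 * \<phi> 0 x - (- 1) ^ M * (bern_poly c M (x - real n) * \<phi> M x)) (at x within {real n..real n + 1})"
      if "x \<in> {real n..real n + 1}" for x
    proof -
      have b: "((\<lambda>x. bern_poly c (Suc a) (x - real n)) has_vector_derivative bern_poly c a (x - real n))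
          (at x within {real n..real n + 1})" for a
      proof -
        have "((\<lambda>x. x - real n) has_vector_derivative 1) (at x within {real n..real n + 1})"
          by (auto intro!: derivative_eq_intros)
        from vector_diff_chain_within[OF this bern_poly_has_vector_derivative[of c a]]
        show ?thesis by (simp add: o_def)
      qed
      have p: "(\<phi> a has_vector_derivative \<phi> (Suc a) x) (at x within {real n..real n + 1})" for a
        using that by (intro has_vector_derivative_at_within[OF deriv]) auto
      show ?thesis
        unfolding F_def[abs_def] tel[symmetric]
        by (intro has_vector_derivative_sum has_vector_derivative_mult_right has_vector_derivative_mult b p)
    qed
    have "((\<lambda>x. fps_nth c 0 * \<phi> 0 x - (- 1) ^ M * (bern_poly c M (x - real n) * \<phi> M x)) has_integral
        F (real n + 1) - F (real n)) {real n..real n + 1}"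
      by (rule fundamental_theorem_of_calculus) (use F in auto)
    moreover have "((\<lambda>x. fps_nth c 0 * \<phi> 0 x - (- 1) ^ M * (bern_poly c M (x - real n) * \<phi> M x)) has_integral ?lhs)
         {real n..real n + 1}"
      by (intro has_integral_diff has_integral_mult_right integrable_integral integrable_continuous_real
          continuous_intros cont continuous_on_compose2[OF continuous_on_bern_poly[of UNIV]]) auto
    ultimately have "?lhs = F (real n + 1) - F (real n)"
      by (rule has_integral_unique[rotated])
    \<comment> \<open>\<open>Todd_bern_poly_1\<close> is used at index \<open>Suc a\<close>, so its
      exceptional term \<open>l\<close> occurs at \<open>a = 0\<close> and becomes the sampled
      value.\<close>
    also have "\<dots> = (\<Sum>a<M. (- 1) ^ a * fps_nth c (Suc a) * (l * \<phi> a (real n + 1) - \<phi> a (real n))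
           + (if a = 0 then l * \<phi> 0 (real n + 1) else 0))"
      unfolding F_def sum_subtractf[symmetric]
      by (intro sum.cong) (auto simp: Todd_bern_poly_1 c_def algebra_simps)
    also have "\<dots> = ?rhs"
      using M by (simp add: sum.distrib)
    finally show ?thesis .
  qed
  have c0: "l ^ n * fps_nth c 0 = fps_nth c 0" for n
  proof (induction n)
    case (Suc n)
    have "l ^ Suc n * fps_nth c 0 = l ^ n * (l * fps_nth c 0)"
      by simp
    also have "l * fps_nth c 0 = fps_nth c 0"
      by (simp add: c_def Todd_nth_0)
    finally show ?case using Suc.IH by simp
  qed simp
  show ?thesis
  proof (induction N)
    case 0
    show ?case by (simp add: half_weight_def)
  next
    case (Suc N)
    let ?R = "\<lambda>n. integral {real n..real n + 1} (\<lambda>x. bern_poly c M (x - real n) * \<phi> M x)"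
    let ?I = "integral {real N..real N + 1} (\<phi> 0)"
    let ?D = "\<lambda>N. \<Sum>a<M. (- 1) ^ a * fps_nth c (Suc a) * (l ^ N * \<phi> a (real N) - \<phi> a 0)"
    have I: "integral {0..real (Suc N)} (\<phi> 0) = integral {0..real N} (\<phi> 0) + ?I"
      using Henstock_Kurzweil_Integration.integral_combine[of 0 "real N" "real N + 1" "\<phi> 0"] cont[of 0]
      by (simp add: integrable_continuous_real add.commute)
    have D: "?D (Suc N) = ?D N + l ^ N * (\<Sum>a<M. (- 1) ^ a * fps_nth c (Suc a) * (l * \<phi> a (real N + 1) - \<phi> a (real N)))"
      unfolding sum_distrib_left sum.distrib[symmetric]
      by (intro sum.cong refl) (simp add: algebra_simps)
    have C: "fps_nth c 0 * ?I - (- 1) ^ M * (l ^ N * ?R N) = l ^ Suc N * \<phi> 0 (real N + 1)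
       + l ^ N * (\<Sum>a<M. (- 1) ^ a * fps_nth c (Suc a) * (l * \<phi> a (real N + 1) - \<phi> a (real N)))"
    proof -
      have e: "l ^ N * (fps_nth c 0 * ?I) = fps_nth c 0 * ?I"
        using c0 by (metis mult.assoc)
      have "fps_nth c 0 * ?I - (- 1) ^ M * (l ^ N * ?R N) = l ^ N * (fps_nth c 0 * ?I - (- 1) ^ M * ?R N)"
        by (simp only: right_diff_distrib e) (simp only: mult.left_commute)
      also have "\<dots> = l ^ N * (l * \<phi> 0 (real N + 1)
          + (\<Sum>a<M. (- 1) ^ a * fps_nth c (Suc a) * (l * \<phi> a (real N + 1) - \<phi> a (real N))))"
        by (simp only: cell)
      finally show ?thesis
        by (simp only: distrib_left power_Suc mult_ac)
    qed
    show ?case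
      unfolding sum.atMost_Suc Suc.IH I D sum.lessThan_Suc
      using C by (simp add: half_weight_def algebra_simps)
  qed
qed

definition bern_bound :: "complex fps \<Rightarrow> nat \<Rightarrow> real" where
  "bern_bound c M = (SUP x\<in>{0..1}. norm (bern_poly c M x))"

lemma norm_bern_poly_le: "norm (bern_poly c M x) \<le> bern_bound c M" if "x \<in> {0..1}"
proof -
  have "compact ((\<lambda>x. norm (bern_poly c M x)) ` {0..1})"
    by (intro compact_continuous_image continuous_on_norm continuous_on_bern_poly) auto
  hence "bdd_above ((\<lambda>x. norm (bern_poly c M x)) ` {0..1})"
    by (intro bounded_imp_bdd_above compact_imp_bounded)
  thus ?thesis
    unfolding bern_bound_def using that by (intro cSUP_upper)
qed

lemma bern_bound_nonneg: "0 \<le> bern_bound c M"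
  using norm_bern_poly_le[of 0 c M] norm_ge_zero[of "bern_poly c M 0"] by (simp del: norm_ge_zero)

text \<open>The limit of \<open>Euler_Maclaurin_partial\<close> as \<open>N\<close> tends to
  infinity: the terms at \<open>N\<close> die out because \<open>l\<close> has modulus 1, and the
  remainder of cell \<open>n\<close> is at most the supremum of the kernel times \<open>r n\<close>.
  Bounding \<open>\<phi> M\<close> by \<open>r n\<close> on the whole of \<open>{real n..}\<close>
  suits a decreasing majorant.\<close>

lemma Euler_Maclaurin_bound:
  fixes l :: complex and M :: nat and \<phi> :: "nat \<Rightarrow> real \<Rightarrow> complex" and r :: "nat \<Rightarrow> real"
  assumes l: "norm l = 1" and M: "0 < M"
    and deriv: "\<And>k y. 0 \<le> y \<Longrightarrow> (\<phi> k has_vector_derivative \<phi> (Suc k) y) (at y)"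
    and lim: "\<And>k. (\<lambda>n. \<phi> k (real n)) \<longlonglongrightarrow> 0"
    and int: "set_integrable lborel {0..} (\<phi> 0)"
    and sum: "summable (\<lambda>n. norm (\<phi> 0 (real n)))"
    and r: "summable r"
    and bnd: "\<And>n y. real n \<le> y \<Longrightarrow> norm (\<phi> M y) \<le> r n"
  shows "norm ((\<Sum>n. half_weight n * l ^ n * \<phi> 0 (real n))
         - (\<Sum>a\<le>M. fps_nth (half_Todd l) a * boundary_term \<phi> a))
       \<le> bern_bound (Todd l - fps_X) M * suminf r"
proof -
  define c where "c = Todd l - fps_X"
  define B where "B = bern_bound c M"
  note B = norm_bern_poly_le[where c = c and M = M, folded B_def]
  have B0: "0 \<le> B"
    unfolding B_def by (rule bern_bound_nonneg)
  have cont: "continuous_on {real n..z} (\<phi> k)" for k n z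
    by (rule continuous_at_imp_continuous_on)
       (auto intro!: has_vector_derivative_continuous deriv)
  have r0: "0 \<le> r n" for n
    using bnd[of n "real n"] norm_ge_zero order_trans by blast
  define R where "R n = integral {real n..real n + 1} (\<lambda>x. bern_poly c M (x - real n) * \<phi> M x)" for n
  define X where "X N = fps_nth c 0 * integral {0..real N} (\<phi> 0) + 1 / 2 * \<phi> 0 0
     - (\<Sum>a<M. (- 1) ^ a * fps_nth c (Suc a) * (l ^ N * \<phi> a (real N) - \<phi> a 0))" for N
  define S where "S = (\<lambda>n. half_weight n * l ^ n * \<phi> 0 (real n))"
  have R: "norm (R n) \<le> B * r n" for n
  proof -
    have "norm (R n) \<le> B * r n * (real n + 1 - real n)"
      unfolding R_def
    proof (rule integral_bound)
      show "continuous_on {real n..real n + 1} (\<lambda>x. bern_poly c M (x - real n) * \<phi> M x)"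
        by (intro continuous_intros cont continuous_on_compose2[OF continuous_on_bern_poly[of UNIV]]) auto
      fix x assume "x \<in> {real n..real n + 1}"
      thus "norm (bern_poly c M (x - real n) * \<phi> M x) \<le> B * r n"
        unfolding norm_mult by (intro mult_mono B bnd) (auto simp: B0)
    qed simp
    thus ?thesis by simp
  qed
  have diff: "norm ((\<Sum>n\<le>N. S n) - X N) \<le> B * suminf r" for N
  proof -
    have "(\<Sum>n\<le>N. S n) - X N = - ((- 1) ^ M * (\<Sum>n<N. l ^ n * R n))"
      unfolding S_def X_def R_def c_def
      by (subst Euler_Maclaurin_partial[where \<phi> = \<phi> and M = M, OF deriv M]) (auto simp: algebra_simps)
    hence "norm ((\<Sum>n\<le>N. S n) - X N) = norm (\<Sum>n<N. l ^ n * R n)"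
      by (simp add: norm_mult norm_power)
    also have "\<dots> \<le> (\<Sum>n<N. B * r n)"
      by (rule sum_norm_le) (simp add: norm_mult norm_power l R)
    also have "\<dots> = B * (\<Sum>n<N. r n)"
      by (simp add: sum_distrib_left)
    also have "\<dots> \<le> B * suminf r"
      by (intro mult_left_mono sum_le_suminf r B0) (auto simp: r0)
    finally show ?thesis .
  qed
  have "summable S"
  proof (rule summable_comparison_test')
    show "norm (S n) \<le> norm (\<phi> 0 (real n))" if "0 \<le> n" for n
      by (simp add: S_def norm_mult norm_power l half_weight_def)
  qed (rule sum)
  hence S_lim: "(\<lambda>N. \<Sum>n\<le>N. S n) \<longlonglongrightarrow> suminf S"
    by (rule summable_LIMSEQ')
  have I_lim: "(\<lambda>N. integral {0..real N} (\<phi> 0)) \<longlonglongrightarrow> set_lebesgue_integral lborel {0..} (\<phi> 0)"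
  proof -
    have "((\<lambda>N. set_lebesgue_integral lborel {0..real N} (\<phi> 0)) \<longlongrightarrow>
         set_lebesgue_integral lborel {0..} (\<phi> 0)) sequentially"
      using tendsto_set_lebesgue_integral_at_top[OF _ int]
      by (rule filterlim_compose[OF _ filterlim_real_sequentially]) auto
    moreover have "set_lebesgue_integral lborel {0..real N} (\<phi> 0) = integral {0..real N} (\<phi> 0)" for N
      by (intro set_borel_integral_eq_integral set_integrable_subset[OF int]) auto
    ultimately show ?thesis by simp
  qed
  have l_lim: "(\<lambda>N. l ^ N * \<phi> a (real N)) \<longlonglongrightarrow> 0" for a
    by (rule tendsto_norm_zero_cancel) (simp add: norm_mult norm_power l tendsto_norm_zero lim)
  have "X \<longlonglongrightarrow> (fps_nth c 0 * set_lebesgue_integral lborel {0..} (\<phi> 0) + 1 / 2 * \<phi> 0 0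
     - (\<Sum>a<M. (- 1) ^ a * fps_nth c (Suc a) * (0 - \<phi> a 0)))" (is "_ \<longlonglongrightarrow> ?L")
    unfolding X_def[abs_def] by (intro tendsto_intros I_lim l_lim)
  \<comment> \<open>Here \<open>half_Todd l = c + X / 2\<close>: the extra half at index 1 accounts
    for the endpoint term \<open>1 / 2 * \<phi> 0 0\<close>.\<close>
  also have "?L = (\<Sum>a\<le>M. fps_nth (half_Todd l) a * boundary_term \<phi> a)"
  proof -
    have "(\<Sum>a\<le>M. fps_nth (half_Todd l) a * boundary_term \<phi> a)
       = fps_nth c 0 * set_lebesgue_integral lborel {0..} (\<phi> 0)
        + (\<Sum>a<M. (- 1) ^ a * fps_nth c (Suc a) * \<phi> a 0 + (if a = 0 then 1 / 2 * \<phi> 0 0 else 0))"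
      unfolding sum.atMost_shift
      by (intro arg_cong2[where f = "(+)"] sum.cong)
         (auto simp: half_Todd_nth c_def boundary_term_def algebra_simps)
    thus ?thesis
      using M by (simp add: sum.distrib sum_negf)
  qed
  finally have "(\<lambda>N. norm ((\<Sum>n\<le>N. S n) - X N)) \<longlonglongrightarrow>
      norm (suminf S - (\<Sum>a\<le>M. fps_nth (half_Todd l) a * boundary_term \<phi> a))"
    by (intro tendsto_intros S_lim)
  thus ?thesis
    unfolding S_def[symmetric] B_def[symmetric] c_def[symmetric]
    by (rule LIMSEQ_le_const2) (use diff in auto)
qed

section \<open>One-variable sums over a grid of mesh \<open>t\<close>\<close>

lemma sum_inverse_square_bound:
  fixes t :: real
  assumes t: "0 < t" "t \<le> 1"
  shows "summable (\<lambda>n. 1 / (1 + t * real n) ^ 2)" "(\<Sum>n. 1 / (1 + t * real n) ^ 2) \<le> 2 / t"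
proof -
  \<comment> \<open>The term \<open>n = 0\<close> gives 1. Each later square is replaced by the
    product of two consecutive factors \<open>1 + t * real n\<close>, whose reciprocals telescope to
    the value \<open>1 / t\<close> of the corresponding integral.\<close>
  have le: "(\<Sum>n\<le>N. 1 / (1 + t * real n) ^ 2) \<le> 1 + 1 / t - 1 / (t * (1 + t * real N))" for N
  proof (induction N)
    case 0
    show ?case using t by simp
  next
    case (Suc N)
    have p: "1 + t * real N > 0" "1 + t * real (Suc N) > 0"
      using t by (auto intro!: add_pos_nonneg)
    have "1 / (t * (1 + t * real N)) - 1 / (t * (1 + t * real (Suc N)))
        = 1 / ((1 + t * real N) * (1 + t * real (Suc N)))"
      using p t by (simp add: divide_simps) (simp add: algebra_simps)
    also have "\<dots> \<ge> 1 / (1 + t * real (Suc N)) ^ 2"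
      unfolding power2_eq_square using p t by (intro divide_left_mono mult_right_mono mult_pos_pos) auto
    finally show ?case using Suc.IH by simp
  qed
  have le2: "(\<Sum>n\<le>N. 1 / (1 + t * real n) ^ 2) \<le> 2 / t" for N
  proof -
    have "1 / (t * (1 + t * real N)) \<ge> 0" "1 \<le> 1 / t"
      using t by auto
    with le[of N] show ?thesis by linarith
  qed
  show s: "summable (\<lambda>n. 1 / (1 + t * real n) ^ 2)"
  proof (rule summableI_nonneg_bounded)
    show "(\<Sum>n<N. 1 / (1 + t * real n) ^ 2) \<le> 2 / t" for N
      by (rule order_trans[OF _ le2[of N]]) (intro sum_mono2, auto)
  qed auto
  show "(\<Sum>n. 1 / (1 + t * real n) ^ 2) \<le> 2 / t"
    by (rule LIMSEQ_le_const2[OF summable_LIMSEQ'[OF s]]) (use le2 in auto)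
qed

lemma set_integrable_inverse_square: "set_integrable lborel {0..} (\<lambda>y::real. 1 / (1 + y) ^ 2)"
proof -
  have "(\<integral>\<^sup>+x. ennreal (1 / (1 + x) ^ 2) * indicator {0::real..} x \<partial>lborel) = ennreal (0 - (- (1 / (1 + 0))))"
  proof (rule nn_integral_FTC_atLeast)
    fix x :: real assume "0 \<le> x"
    thus "((\<lambda>x. - (1 / (1 + x))) has_real_derivative 1 / (1 + x) ^ 2) (at x)"
      by (auto intro!: derivative_eq_intros simp: power2_eq_square)
  next
    show "((\<lambda>x::real. - (1 / (1 + x))) \<longlongrightarrow> 0) at_top"
      by real_asymp
  qed auto
  also have "(\<lambda>x. ennreal (1 / (1 + x) ^ 2) * indicator {0::real..} x) = (\<lambda>x. ennreal (indicator {0..} x *\<^sub>R (1 / (1 + x) ^ 2)))"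
    by (auto simp: indicator_def)
  finally have "(\<integral>\<^sup>+x. ennreal (indicator {0::real..} x *\<^sub>R (1 / (1 + x) ^ 2)) \<partial>lborel) < \<infinity>"
    by simp
  thus ?thesis
    unfolding set_integrable_def by (intro integrableI_nonneg) auto
qed

text \<open>The unscaled bound is applied to \<open>\<phi> k y = t ^ k * \<psi> k (t * y)\<close>.
  The leading factor \<open>t\<close> cancels the \<open>1 / t\<close> of the substitution in the
  integral and completes \<open>t ^ k\<close> to \<open>t ^ Suc k\<close> in the derivative terms,
  so every boundary term of index \<open>a\<close> acquires exactly \<open>t ^ a\<close>. In the
  remainder it cancels the \<open>2 / t\<close> from summing the majorant.\<close>

lemma Euler_Maclaurin_scaled:
  fixes l :: complex and M :: nat and \<psi> :: "nat \<Rightarrow> real \<Rightarrow> complex" and A :: "nat \<Rightarrow> real" and t :: real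
  assumes l: "norm l = 1" and M: "0 < M"
    and deriv: "\<And>k y. 0 \<le> y \<Longrightarrow> (\<psi> k has_vector_derivative \<psi> (Suc k) y) (at y)"
    and bnd: "\<And>k y. 0 \<le> y \<Longrightarrow> norm (\<psi> k y) \<le> A k / (1 + y) ^ 2"
    and t: "0 < t" "t \<le> 1"
  shows "norm (of_real t * (\<Sum>n. half_weight n * l ^ n * \<psi> 0 (t * real n))
         - (\<Sum>a\<le>M. fps_nth (half_Todd l) a * of_real t ^ a * boundary_term \<psi> a))
       \<le> 2 * bern_bound (Todd l - fps_X) M * A M * t ^ M"
proof -
  define B where "B = bern_bound (Todd l - fps_X) M"
  have B: "0 \<le> B"
    unfolding B_def by (rule bern_bound_nonneg)
  have A: "0 \<le> A k" for k
    using bnd[of 0 k] norm_ge_zero[of "\<psi> k 0"] by (simp del: norm_ge_zero)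
  define \<phi> where "\<phi> k y = of_real (t ^ k) * \<psi> k (t * y)" for k y
  define r where "r n = t ^ M * A M * (1 / (1 + t * real n) ^ 2)" for n
  have sq: "A k / (1 + t * y) ^ 2 \<le> A k * (1 / (1 + t * x) ^ 2)" if "0 \<le> x" "x \<le> y" for x y k
  proof -
    have "1 / (1 + t * y) ^ 2 \<le> 1 / (1 + t * x) ^ 2"
      using that t by (intro divide_left_mono power_mono mult_pos_pos zero_less_power) (auto intro!: add_pos_nonneg)
    from mult_left_mono[OF this A[of k]] show ?thesis by simp
  qed
  have bnd': "norm (\<phi> k y) \<le> t ^ k * (A k * (1 / (1 + t * x) ^ 2))" if "0 \<le> x" "x \<le> y" for k x y
  proof -
    have "norm (\<psi> k (t * y)) \<le> A k * (1 / (1 + t * x) ^ 2)"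
      using that t by (intro order_trans[OF bnd sq]) auto
    hence "t ^ k * norm (\<psi> k (t * y)) \<le> t ^ k * (A k * (1 / (1 + t * x) ^ 2))"
      using t by (intro mult_left_mono) auto
    thus ?thesis
      using t by (simp add: \<phi>_def norm_mult norm_power)
  qed
  have d: "(\<phi> k has_vector_derivative \<phi> (Suc k) y) (at y)" if "0 \<le> y" for k y
  proof -
    have "((\<lambda>y. t * y) has_vector_derivative t) (at y)"
      by (auto intro!: derivative_eq_intros)
    moreover have "(\<psi> k has_vector_derivative \<psi> (Suc k) (t * y)) (at (t * y))"
      using deriv that t by simp
    ultimately have "((\<lambda>y. \<psi> k (t * y)) has_vector_derivative t *\<^sub>R \<psi> (Suc k) (t * y)) (at y)"
      using vector_diff_chain_at[of "\<lambda>y. t * y"] by (simp add: o_def)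
    from has_vector_derivative_mult_right[OF this, of "of_real (t ^ k)"]
    show ?thesis
      unfolding \<phi>_def[abs_def] by (simp add: scaleR_conv_of_real mult_ac)
  qed
  note sum = sum_inverse_square_bound[OF t]
  have lim: "(\<lambda>n. \<phi> k (real n)) \<longlonglongrightarrow> 0" for k
  proof (rule Lim_null_comparison)
    show "\<forall>\<^sub>F n in sequentially. norm (\<phi> k (real n)) \<le> t ^ k * (A k * (1 / (1 + t * real n) ^ 2))"
      by (intro always_eventually allI bnd') auto
    show "(\<lambda>n. t ^ k * (A k * (1 / (1 + t * real n) ^ 2))) \<longlonglongrightarrow> 0"
      by (intro tendsto_mult_right_zero summable_LIMSEQ_zero sum)
  qed
  have cont: "continuous_on {0..} (\<psi> k)" for k
    by (rule continuous_at_imp_continuous_on) (auto intro!: has_vector_derivative_continuous deriv)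
  have int: "set_integrable lborel {0..} (\<psi> 0)"
  proof (rule set_integrable_bound)
    show "set_integrable lborel {0..} (\<lambda>y. A 0 * (1 / (1 + y) ^ 2))"
      by (intro set_integrable_mult_right set_integrable_inverse_square)
    show "set_borel_measurable lborel {0..} (\<psi> 0)"
      unfolding set_borel_measurable_def
      using borel_measurable_continuous_on_indicator[OF _ cont[of 0]] by simp
    show "AE x in lborel. x \<in> {0..} \<longrightarrow> norm (\<psi> 0 x) \<le> norm (A 0 * (1 / (1 + x) ^ 2))"
      using bnd A by auto
  qed
  have ind: "indicator {0..} (t * y) = (indicator {0..} y :: real)" for y
    using t by (auto simp: indicator_def zero_le_mult_iff)
  have int\<phi>: "set_integrable lborel {0..} (\<phi> 0)"
    using lborel_integrable_real_affine[of "\<lambda>y. indicator {0..} y *\<^sub>R \<psi> 0 y" t 0] int t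
    by (simp add: set_integrable_def \<phi>_def ind)
  have I: "of_real t * set_lebesgue_integral lborel {0..} (\<phi> 0) = set_lebesgue_integral lborel {0..} (\<psi> 0)"
    using lborel_integral_real_affine[of t "\<lambda>y. indicator {0..} y *\<^sub>R \<psi> 0 y" 0] t
    by (simp add: set_lebesgue_integral_def \<phi>_def ind scaleR_conv_of_real)
  have bt: "of_real t * boundary_term \<phi> a = of_real t ^ a * boundary_term \<psi> a" for a
    by (cases a) (simp_all add: boundary_term_def I, simp add: \<phi>_def)
  have E: "norm ((\<Sum>n. half_weight n * l ^ n * \<phi> 0 (real n))
       - (\<Sum>a\<le>M. fps_nth (half_Todd l) a * boundary_term \<phi> a)) \<le> B * suminf r"
    unfolding B_def
  proof (rule Euler_Maclaurin_bound[where \<phi> = \<phi>, OF l M d lim int\<phi>])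
    show "summable (\<lambda>n. norm (\<phi> 0 (real n)))"
    proof (rule summable_comparison_test')
      show "summable (\<lambda>n. t ^ 0 * (A 0 * (1 / (1 + t * real n) ^ 2)))"
        by (intro summable_mult sum)
      show "norm (norm (\<phi> 0 (real n))) \<le> t ^ 0 * (A 0 * (1 / (1 + t * real n) ^ 2))" for n
        using bnd'[of "real n" "real n" 0] by simp
    qed
    show "summable r"
      unfolding r_def by (intro summable_mult sum)
    show "norm (\<phi> M y) \<le> r n" if "real n \<le> y" for n y
      using bnd'[of "real n" y M] that by (simp add: r_def mult.assoc)
  qed
  have "of_real t * (\<Sum>n. half_weight n * l ^ n * \<psi> 0 (t * real n))
       - (\<Sum>a\<le>M. fps_nth (half_Todd l) a * of_real t ^ a * boundary_term \<psi> a)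
     = of_real t * ((\<Sum>n. half_weight n * l ^ n * \<phi> 0 (real n))
       - (\<Sum>a\<le>M. fps_nth (half_Todd l) a * boundary_term \<phi> a))"
  proof -
    have "of_real t * (\<Sum>a\<le>M. fps_nth (half_Todd l) a * boundary_term \<phi> a)
       = (\<Sum>a\<le>M. fps_nth (half_Todd l) a * (of_real t * boundary_term \<phi> a))"
      by (simp add: sum_distrib_left mult_ac)
    thus ?thesis
      by (simp add: bt right_diff_distrib mult.assoc) (simp add: \<phi>_def)
  qed
  hence "norm (of_real t * (\<Sum>n. half_weight n * l ^ n * \<psi> 0 (t * real n))
       - (\<Sum>a\<le>M. fps_nth (half_Todd l) a * of_real t ^ a * boundary_term \<psi> a))
     = t * norm ((\<Sum>n. half_weight n * l ^ n * \<phi> 0 (real n))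
       - (\<Sum>a\<le>M. fps_nth (half_Todd l) a * boundary_term \<phi> a))"
    using t by (simp add: norm_mult)
  also have "\<dots> \<le> t * (B * (t ^ M * A M * (2 / t)))"
  proof -
    have "suminf r \<le> t ^ M * A M * (2 / t)"
      unfolding r_def suminf_mult[OF sum(1)] using sum(2) t A by (intro mult_left_mono) auto
    hence "B * suminf r \<le> B * (t ^ M * A M * (2 / t))"
      using B by (intro mult_left_mono)
    thus ?thesis using E t by (intro mult_left_mono) auto
  qed
  also have "\<dots> = 2 * B * A M * t ^ M"
    using t by simp
  finally show ?thesis unfolding B_def .
qed

section \<open>The two-variable formula on the quadrant\<close>

definition boundary_fun :: "(nat \<Rightarrow> nat \<Rightarrow> real \<Rightarrow> real \<Rightarrow> complex) \<Rightarrow> nat \<Rightarrow> nat \<Rightarrow> real \<Rightarrow> complex" where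
  "boundary_fun g b a y = boundary_term (\<lambda>k. g a k y) b"

text \<open>With the first coordinate fixed at \<open>t * m\<close>, the formula in the second
  variable has an error of order \<open>t ^ M / (1 + t * m) ^ 2\<close>; the sum of this over
  \<open>m\<close> costs only \<open>1 / t\<close>, which the second factor \<open>t\<close>
  absorbs. Each \<open>boundary_fun g b\<close> is again a family of successive derivatives with
  inverse square decay, so the formula applies a second time.\<close>

lemma Euler_Maclaurin_quadrant:
  fixes l1 l2 :: complex and M :: nat and g :: "nat \<Rightarrow> nat \<Rightarrow> real \<Rightarrow> real \<Rightarrow> complex"
    and A :: "nat \<Rightarrow> nat \<Rightarrow> real"
  assumes l: "norm l1 = 1" "norm l2 = 1" and M: "0 < M"
    and deriv1: "\<And>a b y z. 0 \<le> y \<Longrightarrow> 0 \<le> z \<Longrightarrow>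
        ((\<lambda>y. g a b y z) has_vector_derivative g (Suc a) b y z) (at y)"
    and deriv2: "\<And>b y z. 0 \<le> y \<Longrightarrow> 0 \<le> z \<Longrightarrow>
        (g 0 b y has_vector_derivative g 0 (Suc b) y z) (at z)"
    and deriv_int: "\<And>a y. 0 \<le> y \<Longrightarrow>
        ((\<lambda>y. set_lebesgue_integral lborel {0..} (g a 0 y)) has_vector_derivative
          set_lebesgue_integral lborel {0..} (g (Suc a) 0 y)) (at y)"
    and int: "\<And>a y. 0 \<le> y \<Longrightarrow> set_integrable lborel {0..} (g a 0 y)"
    and bnd: "\<And>a b y z. 0 \<le> y \<Longrightarrow> 0 \<le> z \<Longrightarrow> norm (g a b y z) \<le> A a b / ((1 + y) ^ 2 * (1 + z) ^ 2)"
  shows "\<exists>C. \<forall>t. 0 < t \<longrightarrow> t \<le> 1 \<longrightarrow>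
    norm (of_real t ^ 2 * (\<Sum>m. \<Sum>n. half_weight m * half_weight n * l1 ^ m * l2 ^ n * g 0 0 (t * real m) (t * real n))
      - (\<Sum>a\<le>M. \<Sum>b\<le>M. fps_nth (half_Todd l1) a * fps_nth (half_Todd l2) b * of_real t ^ (a + b)
            * boundary_term (boundary_fun g b) a)) \<le> C * t ^ M"
proof -
  define J where "J = set_lebesgue_integral lborel {0..} (\<lambda>z::real. 1 / (1 + z) ^ 2)"
  \<comment> \<open>Decay constants for \<open>boundary_fun g b a\<close>: when \<open>b = 0\<close>
    the second variable is integrated out, at the price of \<open>J\<close>; when
    \<open>b = Suc k\<close> it is set to 0.\<close>
  define A' where "A' b a = (case b of 0 \<Rightarrow> A a 0 * J | Suc k \<Rightarrow> A a k)" for b a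
  let ?e1 = "fps_nth (half_Todd l1)" and ?e2 = "fps_nth (half_Todd l2)"
  let ?B1 = "bern_bound (Todd l1 - fps_X) M" and ?B2 = "bern_bound (Todd l2 - fps_X) M"
  have A: "0 \<le> A a b" for a b
    using bnd[of 0 0 a b] norm_ge_zero[of "g a b 0 0"] by (simp del: norm_ge_zero)
  have bf_deriv: "(boundary_fun g b a has_vector_derivative boundary_fun g b (Suc a) y) (at y)"
    if "0 \<le> y" for a b y
  proof (cases b)
    case 0
    thus ?thesis
      using deriv_int[OF that, of a] by (simp add: boundary_fun_def[abs_def] boundary_term_def)
  next
    case (Suc k)
    show ?thesis
      unfolding boundary_fun_def[abs_def] boundary_term_def Suc nat.case
      by (intro has_vector_derivative_mult_right deriv1 that order_refl)
  qed
  have bf_bnd: "norm (boundary_fun g b a y) \<le> A' b a / (1 + y) ^ 2" if y: "0 \<le> y" for a b y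
  proof (cases b)
    case 0
    have "norm (boundary_fun g b a y) \<le> (LINT z:{0..}|lborel. norm (g a 0 y z))"
      unfolding 0 boundary_fun_def boundary_term_def by (simp add: set_integral_norm_bound int y)
    also have "\<dots> \<le> (LINT z:{0..}|lborel. (A a 0 / (1 + y) ^ 2) * (1 / (1 + z) ^ 2))"
    proof (rule set_integral_mono)
      show "set_integrable lborel {0..} (\<lambda>z. norm (g a 0 y z))"
        by (intro set_integrable_norm int y)
      show "set_integrable lborel {0..} (\<lambda>z. (A a 0 / (1 + y) ^ 2) * (1 / (1 + z) ^ 2))"
        by (intro set_integrable_mult_right set_integrable_inverse_square)
      show "norm (g a 0 y z) \<le> (A a 0 / (1 + y) ^ 2) * (1 / (1 + z) ^ 2)" if "z \<in> {0..}" for z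
        using bnd[of y z a 0] y that by simp
    qed
    also have "\<dots> = A' b a / (1 + y) ^ 2"
      unfolding set_integral_mult_right by (simp add: A'_def 0 J_def)
    finally show ?thesis .
  next
    case (Suc k)
    thus ?thesis
      using bnd[OF y order_refl, of a k] by (simp add: boundary_fun_def boundary_term_def A'_def norm_mult norm_power)
  qed
  show ?thesis
  proof (intro exI allI impI)
    fix t :: real assume t: "0 < t" "t \<le> 1"
    note sum = sum_inverse_square_bound[OF t]
    let ?q = "\<lambda>m. 1 / (1 + t * real m) ^ 2"
    define s where "s m = (\<Sum>n. half_weight n * l2 ^ n * g 0 0 (t * real m) (t * real n))" for m
    define p where "p m = (\<Sum>b\<le>M. ?e2 b * of_real t ^ b * boundary_fun g b 0 (t * real m))" for m
    have w: "norm (half_weight m * l1 ^ m * z) \<le> norm z" for m z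
      by (simp add: norm_mult norm_power l half_weight_def)
    have inner: "norm (of_real t * s m - p m) \<le> 2 * ?B2 * (A 0 M * ?q m) * t ^ M" for m
      unfolding s_def p_def boundary_fun_def
    proof (rule Euler_Maclaurin_scaled[OF l(2) M _ _ t, where A = "\<lambda>k. A 0 k * ?q m"])
      show "(g 0 k (t * real m) has_vector_derivative g 0 (Suc k) (t * real m) y) (at y)" if "0 \<le> y" for k y
        using that t by (intro deriv2) auto
      show "norm (g 0 k (t * real m) y) \<le> A 0 k * ?q m / (1 + y) ^ 2" if "0 \<le> y" for k y
        using bnd[of "t * real m" y 0 k] that t by simp
    qed
    have outer: "norm (of_real t * (\<Sum>m. half_weight m * l1 ^ m * boundary_fun g b 0 (t * real m))
         - (\<Sum>a\<le>M. ?e1 a * of_real t ^ a * boundary_term (boundary_fun g b) a)) \<le> 2 * ?B1 * A' b M * t ^ M" for b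
      by (rule Euler_Maclaurin_scaled[where \<psi> = "boundary_fun g b" and A = "A' b", OF l(1) M bf_deriv bf_bnd t])
    have sum_b: "summable (\<lambda>m. half_weight m * l1 ^ m * boundary_fun g b 0 (t * real m))" for b
    proof (rule summable_comparison_test')
      show "summable (\<lambda>m. A' b 0 * ?q m)"
        by (intro summable_mult sum)
      show "norm (half_weight m * l1 ^ m * boundary_fun g b 0 (t * real m)) \<le> A' b 0 * ?q m" for m
        using bf_bnd[of "t * real m" b 0] t by (intro order_trans[OF w]) auto
    qed
    have p_eq: "(\<lambda>m. half_weight m * l1 ^ m * p m)
        = (\<lambda>m. \<Sum>b\<le>M. ?e2 b * of_real t ^ b * (half_weight m * l1 ^ m * boundary_fun g b 0 (t * real m)))"
      by (simp add: p_def sum_distrib_left mult_ac)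
    have sum_p: "summable (\<lambda>m. half_weight m * l1 ^ m * p m)"
      unfolding p_eq by (intro summable_sum summable_mult sum_b)
    have suminf_p: "(\<Sum>m. half_weight m * l1 ^ m * p m)
        = (\<Sum>b\<le>M. ?e2 b * of_real t ^ b * (\<Sum>m. half_weight m * l1 ^ m * boundary_fun g b 0 (t * real m)))"
      unfolding p_eq by (subst suminf_sum) (auto intro!: summable_mult sum_b sum.cong suminf_mult)
    have sum_d: "summable (\<lambda>m. 2 * ?B2 * A 0 M * t ^ M * ?q m)"
      by (intro summable_mult sum)
    have d_le: "norm (half_weight m * l1 ^ m * (of_real t * s m - p m)) \<le> 2 * ?B2 * A 0 M * t ^ M * ?q m" for m
      using inner[of m] by (intro order_trans[OF w]) (simp add: mult_ac)
    have sum_sp: "summable (\<lambda>m. half_weight m * l1 ^ m * (of_real t * s m - p m))"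
      by (rule summable_comparison_test'[OF sum_d d_le])
    \<comment> \<open>Summability of the inner sums is recovered from
      \<open>s m = ((t * s m - p m) + p m) / t\<close>, where error and main part are both known to
      be summable.\<close>
    have "summable (\<lambda>m. (half_weight m * l1 ^ m * (of_real t * s m - p m) + half_weight m * l1 ^ m * p m) / of_real t)"
      by (intro summable_divide summable_add sum_sp sum_p)
    hence sum_s: "summable (\<lambda>m. half_weight m * l1 ^ m * s m)"
      using t by (simp add: field_simps)
    have S: "(\<Sum>m. \<Sum>n. half_weight m * half_weight n * l1 ^ m * l2 ^ n * g 0 0 (t * real m) (t * real n))
         = (\<Sum>m. half_weight m * l1 ^ m * s m)"
    proof -
      have "(\<Sum>n. half_weight m * half_weight n * l1 ^ m * l2 ^ n * g 0 0 (t * real m) (t * real n))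
         = half_weight m * l1 ^ m * s m" for m
      proof -
        have "summable (\<lambda>n. half_weight n * l2 ^ n * g 0 0 (t * real m) (t * real n))"
        proof (rule summable_comparison_test')
          show "summable (\<lambda>n. A 0 0 * ?q m * ?q n)"
            by (intro summable_mult sum)
          show "norm (half_weight n * l2 ^ n * g 0 0 (t * real m) (t * real n)) \<le> A 0 0 * ?q m * ?q n" for n
          proof -
            have "norm (half_weight n * l2 ^ n * g 0 0 (t * real m) (t * real n)) \<le> norm (g 0 0 (t * real m) (t * real n))"
              by (simp add: norm_mult norm_power l half_weight_def)
            also have "\<dots> \<le> A 0 0 / ((1 + t * real m) ^ 2 * (1 + t * real n) ^ 2)"
              using t by (intro bnd) auto
            finally show ?thesis by simp
          qed
        qed
        from suminf_mult[OF this, of "half_weight m * l1 ^ m"]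
        have "half_weight m * l1 ^ m * s m
            = (\<Sum>n. half_weight m * l1 ^ m * (half_weight n * l2 ^ n * g 0 0 (t * real m) (t * real n)))"
          by (simp only: s_def)
        also have "\<dots> = (\<Sum>n. half_weight m * half_weight n * l1 ^ m * l2 ^ n * g 0 0 (t * real m) (t * real n))"
          by (intro suminf_cong) (simp only: mult_ac)
        finally show ?thesis by (rule sym)
      qed
      thus ?thesis by simp
    qed
    have d: "of_real t * (\<Sum>m. half_weight m * l1 ^ m * s m) - (\<Sum>m. half_weight m * l1 ^ m * p m)
        = (\<Sum>m. half_weight m * l1 ^ m * (of_real t * s m - p m))"
    proof -
      have "of_real t * (\<Sum>m. half_weight m * l1 ^ m * s m) - (\<Sum>m. half_weight m * l1 ^ m * p m)
          = (\<Sum>m. of_real t * (half_weight m * l1 ^ m * s m) - half_weight m * l1 ^ m * p m)"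
        unfolding suminf_mult[OF sum_s, symmetric]
        by (rule suminf_diff[OF summable_mult[OF sum_s] sum_p])
      also have "\<dots> = (\<Sum>m. half_weight m * l1 ^ m * (of_real t * s m - p m))"
        by (intro suminf_cong) (simp add: right_diff_distrib)
      finally show ?thesis .
    qed
    have first: "norm (of_real t ^ 2 * (\<Sum>m. half_weight m * l1 ^ m * s m)
          - of_real t * (\<Sum>m. half_weight m * l1 ^ m * p m)) \<le> 4 * ?B2 * A 0 M * t ^ M"
    proof -
      have "norm (\<Sum>m. half_weight m * l1 ^ m * (of_real t * s m - p m)) \<le> (\<Sum>m. 2 * ?B2 * A 0 M * t ^ M * ?q m)"
        by (rule norm_suminf_le[OF d_le sum_d])
      also have "\<dots> = 2 * ?B2 * A 0 M * t ^ M * (\<Sum>m. ?q m)"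
        by (rule suminf_mult[OF sum(1)])
      also have "\<dots> \<le> 2 * ?B2 * A 0 M * t ^ M * (2 / t)"
        using t by (intro mult_left_mono sum mult_nonneg_nonneg bern_bound_nonneg A) auto
      finally have le: "norm (\<Sum>m. half_weight m * l1 ^ m * (of_real t * s m - p m)) \<le> 2 * ?B2 * A 0 M * t ^ M * (2 / t)" .
      have "of_real t ^ 2 * (\<Sum>m. half_weight m * l1 ^ m * s m) - of_real t * (\<Sum>m. half_weight m * l1 ^ m * p m)
          = of_real t * (\<Sum>m. half_weight m * l1 ^ m * (of_real t * s m - p m))"
        unfolding d[symmetric] by (simp add: power2_eq_square algebra_simps)
      hence "norm (of_real t ^ 2 * (\<Sum>m. half_weight m * l1 ^ m * s m) - of_real t * (\<Sum>m. half_weight m * l1 ^ m * p m))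
          = t * norm (\<Sum>m. half_weight m * l1 ^ m * (of_real t * s m - p m))"
        using t by (simp add: norm_mult)
      also have "\<dots> \<le> t * (2 * ?B2 * A 0 M * t ^ M * (2 / t))"
        using le t by (intro mult_left_mono) auto
      also have "\<dots> = 4 * ?B2 * A 0 M * t ^ M"
        using t by simp
      finally show ?thesis .
    qed
    have second: "norm (of_real t * (\<Sum>m. half_weight m * l1 ^ m * p m)
        - (\<Sum>a\<le>M. \<Sum>b\<le>M. ?e1 a * ?e2 b * of_real t ^ (a + b) * boundary_term (boundary_fun g b) a))
       \<le> (\<Sum>b\<le>M. norm (?e2 b) * (2 * ?B1 * A' b M)) * t ^ M"
    proof -
      have eq: "of_real t * (\<Sum>m. half_weight m * l1 ^ m * p m)
          - (\<Sum>a\<le>M. \<Sum>b\<le>M. ?e1 a * ?e2 b * of_real t ^ (a + b) * boundary_term (boundary_fun g b) a)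
         = (\<Sum>b\<le>M. ?e2 b * of_real t ^ b *
            (of_real t * (\<Sum>m. half_weight m * l1 ^ m * boundary_fun g b 0 (t * real m))
             - (\<Sum>a\<le>M. ?e1 a * of_real t ^ a * boundary_term (boundary_fun g b) a)))"
      proof -
        have "(\<Sum>a\<le>M. \<Sum>b\<le>M. ?e1 a * ?e2 b * of_real t ^ (a + b) * boundary_term (boundary_fun g b) a)
           = (\<Sum>b\<le>M. \<Sum>a\<le>M. ?e1 a * ?e2 b * of_real t ^ (a + b) * boundary_term (boundary_fun g b) a)"
          by (rule sum.swap)
        also have "\<dots> = (\<Sum>b\<le>M. ?e2 b * of_real t ^ b * (\<Sum>a\<le>M. ?e1 a * of_real t ^ a * boundary_term (boundary_fun g b) a))"
          unfolding sum_distrib_left by (intro sum.cong refl) (simp only: power_add mult_ac)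
        finally have e: "(\<Sum>a\<le>M. \<Sum>b\<le>M. ?e1 a * ?e2 b * of_real t ^ (a + b) * boundary_term (boundary_fun g b) a)
           = (\<Sum>b\<le>M. ?e2 b * of_real t ^ b * (\<Sum>a\<le>M. ?e1 a * of_real t ^ a * boundary_term (boundary_fun g b) a))" .
        show ?thesis
          unfolding suminf_p e sum_distrib_left[of "of_real t"] sum_subtractf[symmetric]
          by (intro sum.cong refl) (simp only: right_diff_distrib mult_ac)
      qed
      show ?thesis
        unfolding eq sum_distrib_right
      proof (rule sum_norm_le)
        fix b
        have "t ^ b \<le> 1"
          using t by (simp add: power_le_one)
        have "norm (?e2 b * of_real t ^ b *
            (of_real t * (\<Sum>m. half_weight m * l1 ^ m * boundary_fun g b 0 (t * real m))
             - (\<Sum>a\<le>M. ?e1 a * of_real t ^ a * boundary_term (boundary_fun g b) a)))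
            \<le> norm (?e2 b) * 1 * (2 * ?B1 * A' b M * t ^ M)"
          unfolding norm_mult norm_power using outer[of b] t \<open>t ^ b \<le> 1\<close>
          by (intro mult_mono) auto
        thus "norm (?e2 b * of_real t ^ b *
            (of_real t * (\<Sum>m. half_weight m * l1 ^ m * boundary_fun g b 0 (t * real m))
             - (\<Sum>a\<le>M. ?e1 a * of_real t ^ a * boundary_term (boundary_fun g b) a)))
            \<le> norm (?e2 b) * (2 * ?B1 * A' b M) * t ^ M"
          by (simp add: mult_ac)
      qed
    qed
    show "norm (of_real t ^ 2 * (\<Sum>m. \<Sum>n. half_weight m * half_weight n * l1 ^ m * l2 ^ n * g 0 0 (t * real m) (t * real n))
      - (\<Sum>a\<le>M. \<Sum>b\<le>M. ?e1 a * ?e2 b * of_real t ^ (a + b) * boundary_term (boundary_fun g b) a))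
      \<le> (4 * ?B2 * A 0 M + (\<Sum>b\<le>M. norm (?e2 b) * (2 * ?B1 * A' b M))) * t ^ M"
      unfolding S distrib_right by (rule norm_diff_triangle_le[OF first second])
  qed
qed

section \<open>Integrals over half-planes and quadrants\<close>

lemma set_integrable_Times_iterated:
  fixes H :: "real \<Rightarrow> real \<Rightarrow> 'a::{banach, second_countable_topology}"
  assumes int: "set_integrable lborel (S \<times> T) (\<lambda>(s, x). H s x)"
  shows "set_integrable lborel T (\<lambda>x. LINT s:S|lborel. H s x)"
    and "set_integrable lborel S (\<lambda>s. LINT x:T|lborel. H s x)"
    and "(LINT x:T|lborel. LINT s:S|lborel. H s x) = (LINT z:S \<times> T|lborel. (case z of (s, x) \<Rightarrow> H s x))"
    and "(LINT s:S|lborel. LINT x:T|lborel. H s x) = (LINT z:S \<times> T|lborel. (case z of (s, x) \<Rightarrow> H s x))"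
proof -
  let ?F = "\<lambda>s x. indicator S s *\<^sub>R indicator T x *\<^sub>R H s x"
  have eq: "(\<lambda>z. indicator (S \<times> T) z *\<^sub>R (case z of (s, x) \<Rightarrow> H s x)) = (\<lambda>(s, x). ?F s x)"
    by (auto simp: indicator_def)
  have F: "integrable (lborel \<Otimes>\<^sub>M lborel) (\<lambda>(s, x). ?F s x)"
    using int unfolding set_integrable_def eq lborel_prod .
  have e1: "(LINT s:S|lborel. LINT x:T|lborel. H s x) = (\<integral>s. \<integral>x. ?F s x \<partial>lborel \<partial>lborel)"
    unfolding set_lebesgue_integral_def by (simp only: integral_scaleR_right)
  have e2: "(LINT x:T|lborel. LINT s:S|lborel. H s x) = (\<integral>x. \<integral>s. ?F s x \<partial>lborel \<partial>lborel)"
    unfolding set_lebesgue_integral_def by (simp only: integral_scaleR_right[symmetric] scaleR_left_commute)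
  show "set_integrable lborel T (\<lambda>x. LINT s:S|lborel. H s x)"
    using lborel_pair.integrable_snd[OF F]
    unfolding set_integrable_def set_lebesgue_integral_def
    by (simp only: integral_scaleR_right[symmetric] scaleR_left_commute)
  show "set_integrable lborel S (\<lambda>s. LINT x:T|lborel. H s x)"
    using lborel_pair.integrable_fst[OF F]
    unfolding set_integrable_def set_lebesgue_integral_def by (simp only: integral_scaleR_right)
  show "(LINT x:T|lborel. LINT s:S|lborel. H s x) = (LINT z:S \<times> T|lborel. (case z of (s, x) \<Rightarrow> H s x))"
    unfolding e2 lborel_pair.integral_snd[OF F] by (simp add: set_lebesgue_integral_def eq lborel_prod)
  show "(LINT s:S|lborel. LINT x:T|lborel. H s x) = (LINT z:S \<times> T|lborel. (case z of (s, x) \<Rightarrow> H s x))"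
    unfolding e1 lborel_pair.integral_fst[OF F] by (simp add: set_lebesgue_integral_def eq lborel_prod)
qed

text \<open>The tail is the full integral minus an integral over a compact interval, to which the
  fundamental theorem of calculus applies.\<close>

lemma tail_integral_has_vector_derivative:
  fixes \<phi> :: "real \<Rightarrow> complex"
  assumes cont: "continuous_on {a..} \<phi>" and int: "set_integrable lborel {a..} \<phi>" and y: "a < y"
  shows "((\<lambda>y. LINT x:{y..}|lborel. \<phi> x) has_vector_derivative - \<phi> y) (at y)"
proof -
  have eq: "(LINT x:{z..}|lborel. \<phi> x) = (LINT x:{a..}|lborel. \<phi> x) - integral {a..z} \<phi>" if "a < z" for z
  proof -
    have "(LINT x:{a..<z} \<union> {z..}|lborel. \<phi> x) = (LINT x:{a..<z}|lborel. \<phi> x) + (LINT x:{z..}|lborel. \<phi> x)"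
      using that by (intro set_integral_Un set_integrable_subset[OF int]) auto
    moreover have "{a..<z} \<union> {z..} = {a..}"
      using that by auto
    moreover have "(LINT x:{a..<z}|lborel. \<phi> x) = integral {a..<z} \<phi>"
      by (intro set_borel_integral_eq_integral set_integrable_subset[OF int]) auto
    moreover have "integral {a..<z} \<phi> = integral {a..z} \<phi>"
      by (rule integral_subset_negligible) (auto intro: negligible_subset[of "{z}"])
    ultimately show ?thesis by simp
  qed
  have "((\<lambda>z. integral {a..z} \<phi>) has_vector_derivative \<phi> y) (at y within {a..y + 1})"
    using y by (intro integral_has_vector_derivative continuous_on_subset[OF cont]) auto
  hence "((\<lambda>z. integral {a..z} \<phi>) has_vector_derivative \<phi> y) (at y)"
    using y by (simp add: at_within_Icc_at)
  hence "((\<lambda>z. (LINT x:{a..}|lborel. \<phi> x) - integral {a..z} \<phi>) has_vector_derivative 0 - \<phi> y) (at y)"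
    by (intro has_vector_derivative_diff has_vector_derivative_const)
  hence d: "((\<lambda>z. (LINT x:{a..}|lborel. \<phi> x) - integral {a..z} \<phi>) has_vector_derivative - \<phi> y) (at y)"
    by simp
  show ?thesis
    by (rule has_vector_derivative_transform_within_open[OF d, of "{a<..}"]) (use y eq in auto)
qed

text \<open>Integrals over the lines \<open>s = const\<close> are to be differentiated in
  \<open>s\<close>. No decay in \<open>x\<close> uniform in \<open>s\<close> is available, since
  outside the cone only integrability of all derivatives is given; the two-dimensional integrals
  must supply the majorant.\<close>

locale half_plane_integrable =
  fixes G :: "nat \<Rightarrow> real \<Rightarrow> real \<Rightarrow> complex" and s0 c :: real
  assumes deriv: "\<And>k s x. ((\<lambda>s. G k s x) has_vector_derivative G (Suc k) s x) (at s)"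
    and cont: "\<And>k. continuous_on UNIV (\<lambda>(s, x). G k s x)"
    and int: "\<And>k. set_integrable lborel ({s0..} \<times> {c..}) (\<lambda>(s, x). G k s x)"
begin

lemma cont1: "continuous_on S (\<lambda>s. G k s x)"
proof -
  have "continuous_on S (\<lambda>s. (s, x))"
    by (intro continuous_on_Pair continuous_on_const continuous_on_id)
  from continuous_on_compose2[OF cont[of k] this] show ?thesis
    by simp
qed

lemma cont2: "continuous_on S (G k s)"
proof -
  have "continuous_on S (\<lambda>x. (s, x))"
    by (intro continuous_on_Pair continuous_on_const continuous_on_id)
  from continuous_on_compose2[OF cont[of k] this] show ?thesis
    by simp
qed

definition dominator :: "nat \<Rightarrow> real \<Rightarrow> real \<Rightarrow> real \<Rightarrow> real" where
  "dominator k p r x = (1 / (r - p)) * (LINT s:{p..r}|lborel. norm (G k s x))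
                         + (LINT s:{p..r}|lborel. norm (G (Suc k) s x))"

lemma LINT_norm_eq_integral: "(LINT s:{p..r}|lborel. norm (G k s x)) = integral {p..r} (\<lambda>s. norm (G k s x))"
  by (intro set_borel_integral_eq_integral borel_integrable_atLeastAtMost' continuous_intros cont1)

text \<open>Averaging the fundamental theorem of calculus over the base point bounds a function on an
  interval by integrals of the function and of its derivative.\<close>

lemma norm_le_dominator:
  assumes p: "p < r" and y: "y \<in> {p..r}"
  shows "norm (G k y x) \<le> dominator k p r x"
proof -
  define V where "V = integral {p..r} (\<lambda>s. norm (G (Suc k) s x))"
  have ii: "(\<lambda>s. norm (G k s x)) integrable_on {a..b}" for k a b
    by (intro integrable_continuous_real continuous_intros cont1)
  have diff: "norm (G k b x - G k a x) \<le> V" if "a \<le> b" "{a..b} \<subseteq> {p..r}" for a b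
  proof -
    have "((\<lambda>s. G (Suc k) s x) has_integral (G k b x - G k a x)) {a..b}"
      by (rule fundamental_theorem_of_calculus[OF that(1) has_vector_derivative_at_within[OF deriv]])
    hence "G k b x - G k a x = integral {a..b} (\<lambda>s. G (Suc k) s x)"
      by (simp add: integral_unique)
    also have "norm \<dots> \<le> integral {a..b} (\<lambda>s. norm (G (Suc k) s x))"
      by (intro integral_norm_bound_integral integrable_continuous_real cont1 ii order_refl)
    also have "\<dots> \<le> V"
      unfolding V_def by (intro integral_subset_le that ii) auto
    finally show ?thesis .
  qed
  have le: "norm (G k y x) \<le> norm (G k s x) + V" if "s \<in> {p..r}" for s
  proof -
    have "norm (G k y x - G k s x) \<le> V"
    proof (cases "s \<le> y")
      case True
      thus ?thesis using that y by (intro diff) auto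
    next
      case False
      hence "norm (G k s x - G k y x) \<le> V" using that y by (intro diff) auto
      thus ?thesis by (simp add: norm_minus_commute)
    qed
    thus ?thesis
      using norm_triangle_ineq2[of "G k y x" "G k s x"] by linarith
  qed
  have "integral {p..r} (\<lambda>s. norm (G k y x)) \<le> integral {p..r} (\<lambda>s. norm (G k s x) + V)"
    by (intro integral_le integrable_add ii integrable_const_ivl le)
  hence "(r - p) * norm (G k y x) \<le> integral {p..r} (\<lambda>s. norm (G k s x)) + (r - p) * V"
    using p by (simp add: Henstock_Kurzweil_Integration.integral_add[OF ii integrable_const_ivl])
  thus ?thesis
    unfolding dominator_def LINT_norm_eq_integral V_def[symmetric] using p by (simp add: field_simps)
qed

lemma dominator_integrable:
  assumes "s0 \<le> p"
  shows "set_integrable lborel {c..} (dominator k p r)"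
proof -
  have "set_integrable lborel {c..} (\<lambda>x. LINT s:{p..r}|lborel. norm (G k s x))" for k
  proof (rule set_integrable_Times_iterated(1))
    have "set_integrable lborel ({p..r} \<times> {c..}) (\<lambda>(s, x). G k s x)"
      using assms by (intro set_integrable_subset[OF int]) (auto intro!: borel_closed closed_Times)
    from set_integrable_norm[OF this]
    show "set_integrable lborel ({p..r} \<times> {c..}) (\<lambda>(s, x). norm (G k s x))"
      by (simp add: case_prod_unfold)
  qed
  thus ?thesis
    unfolding dominator_def[abs_def] by (intro set_integral_add(1) set_integrable_mult_right)
qed

lemma section_integrable:
  assumes "s0 < s"
  shows "set_integrable lborel {c..} (G k s)"
proof (rule set_integrable_bound)
  show "set_integrable lborel {c..} (dominator k s (s + 1))"
    using assms by (intro dominator_integrable) auto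
  show "set_borel_measurable lborel {c..} (G k s)"
    unfolding set_borel_measurable_def
    using borel_measurable_continuous_on_indicator[OF _ cont2[of "{c..}"]] by simp
  show "AE x in lborel. x \<in> {c..} \<longrightarrow> norm (G k s x) \<le> norm (dominator k s (s + 1) x)"
    using order_trans[OF norm_le_dominator[of s "s + 1" s] abs_ge_self] by auto
qed

text \<open>A single majorant \<open>dominator k p r\<close> serves all \<open>s\<close> in the
  compact interval, so dominated convergence applies.\<close>

lemma continuous_on_section_integral:
  assumes "s0 < p"
  shows "continuous_on {p..r} (\<lambda>s. LINT x:{c..}|lborel. G k s x)"
proof (cases "p < r")
  case True
  show ?thesis
    unfolding continuous_on_sequentially o_def
  proof (intro allI ballI impI)
    fix u :: "nat \<Rightarrow> real" and s
    assume s: "s \<in> {p..r}" and u: "(\<forall>n. u n \<in> {p..r}) \<and> u \<longlonglongrightarrow> s"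
    show "(\<lambda>n. LINT x:{c..}|lborel. G k (u n) x) \<longlonglongrightarrow> (LINT x:{c..}|lborel. G k s x)"
      unfolding set_lebesgue_integral_def
    proof (rule integral_dominated_convergence)
      have m: "s \<in> {p..r} \<Longrightarrow> (\<lambda>x. indicator {c..} x *\<^sub>R G k s x) \<in> borel_measurable lborel" for s
        using section_integrable[of s k] assms unfolding set_integrable_def by auto
      show "(\<lambda>x. indicator {c..} x *\<^sub>R G k s x) \<in> borel_measurable lborel"
        using s by (rule m)
      show "(\<lambda>x. indicator {c..} x *\<^sub>R G k (u n) x) \<in> borel_measurable lborel" for n
        using u by (intro m) auto
      show "integrable lborel (\<lambda>x. indicator {c..} x *\<^sub>R dominator k p r x)"
        using dominator_integrable[of p k r] assms unfolding set_integrable_def by auto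
      show "AE x in lborel. (\<lambda>n. indicator {c..} x *\<^sub>R G k (u n) x) \<longlonglongrightarrow> indicator {c..} x *\<^sub>R G k s x"
      proof (intro AE_I2 tendsto_intros)
        fix x
        have "isCont (\<lambda>s. G k s x) s"
          using cont1[of UNIV k x] by (simp add: continuous_on_eq_continuous_at)
        from isCont_tendsto_compose[OF this, of u] u
        show "(\<lambda>n. G k (u n) x) \<longlonglongrightarrow> G k s x" by blast
      qed
      show "AE x in lborel. norm (indicator {c..} x *\<^sub>R G k (u n) x) \<le> indicator {c..} x *\<^sub>R dominator k p r x" for n
        using norm_le_dominator[OF True, of "u n"] u by (auto simp: indicator_def)
    qed
  qed
next
  case False
  hence "{p..r} = {} \<or> {p..r} = {p}" by auto
  thus ?thesis by auto
qed

text \<open>Instead of differentiating under the integral, the increment in \<open>s\<close> is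
  written as a double integral of the next derivative. Fubini turns it into the integral of a
  continuous function of \<open>s\<close>, which the fundamental theorem of calculus
  differentiates.\<close>

lemma section_integral_has_vector_derivative:
  assumes s: "s0 < s"
  shows "((\<lambda>s. LINT x:{c..}|lborel. G k s x) has_vector_derivative (LINT x:{c..}|lborel. G (Suc k) s x)) (at s)"
proof -
  define p where "p = (s0 + s) / 2"
  have p: "s0 < p" "p < s" using s by (auto simp: p_def)
  let ?\<psi> = "\<lambda>k s. LINT x:{c..}|lborel. G k s x"
  have eq: "?\<psi> k y = ?\<psi> k p + integral {p..y} (?\<psi> (Suc k))" if y: "p \<le> y" for y
  proof -
    have "?\<psi> k y - ?\<psi> k p = (LINT x:{c..}|lborel. G k y x - G k p x)"
      using p y by (intro set_integral_diff(2)[symmetric] section_integrable) auto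
    also have "\<dots> = (LINT x:{c..}|lborel. LINT s:{p..y}|lborel. G (Suc k) s x)"
      using integral_FTC_atLeastAtMost[OF y has_vector_derivative_at_within[OF deriv] cont1]
      by (simp add: set_lebesgue_integral_def)
    also have "\<dots> = (LINT s:{p..y}|lborel. ?\<psi> (Suc k) s)"
    proof -
      have "set_integrable lborel ({p..y} \<times> {c..}) (\<lambda>(s, x). G (Suc k) s x)"
        using p by (intro set_integrable_subset[OF int]) (auto intro!: borel_closed closed_Times)
      from set_integrable_Times_iterated(3,4)[OF this] show ?thesis by simp
    qed
    also have "\<dots> = integral {p..y} (?\<psi> (Suc k))"
      using p by (intro set_borel_integral_eq_integral borel_integrable_atLeastAtMost' continuous_on_section_integral)
    finally show ?thesis by (simp add: algebra_simps)
  qed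
  have "((\<lambda>y. integral {p..y} (?\<psi> (Suc k))) has_vector_derivative ?\<psi> (Suc k) s) (at s within {p..s + 1})"
    using p by (intro integral_has_vector_derivative continuous_on_section_integral) auto
  hence "((\<lambda>y. integral {p..y} (?\<psi> (Suc k))) has_vector_derivative ?\<psi> (Suc k) s) (at s)"
    using p by (simp add: at_within_Icc_at)
  hence "((\<lambda>y. ?\<psi> k p + integral {p..y} (?\<psi> (Suc k))) has_vector_derivative 0 + ?\<psi> (Suc k) s) (at s)"
    by (intro has_vector_derivative_add has_vector_derivative_const)
  hence d: "((\<lambda>y. ?\<psi> k p + integral {p..y} (?\<psi> (Suc k))) has_vector_derivative ?\<psi> (Suc k) s) (at s)"
    by simp
  show ?thesis
  proof (rule has_vector_derivative_transform_within_open[OF d, of "{p<..}"])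
    show "?\<psi> k p + integral {p..y} (?\<psi> (Suc k)) = ?\<psi> k y" if "y \<in> {p<..}" for y
      using that by (intro eq[symmetric]) auto
  qed (use p in auto)
qed

end

section \<open>The quadrant integral as a function of its corner\<close>

lemma set_integrable_Times_swap:
  fixes f :: "real \<Rightarrow> real \<Rightarrow> complex"
  assumes "set_integrable lborel (S \<times> T) (\<lambda>(y, z). f y z)"
  shows "set_integrable lborel (T \<times> S) (\<lambda>(z, y). f y z)"
proof -
  have "integrable (lborel \<Otimes>\<^sub>M lborel) (\<lambda>z. indicator (S \<times> T) z *\<^sub>R (case z of (y, z) \<Rightarrow> f y z))"
    using assms unfolding set_integrable_def lborel_prod .
  from lborel_pair.integrable_product_swap[OF this]
  have "integrable lborel (\<lambda>(z, y). indicator (S \<times> T) (y, z) *\<^sub>R f y z)"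
    by (simp add: lborel_prod)
  also have "(\<lambda>(z, y). indicator (S \<times> T) (y, z) *\<^sub>R f y z) = (\<lambda>z. indicator (T \<times> S) z *\<^sub>R (case z of (z, y) \<Rightarrow> f y z))"
    by (auto simp: indicator_def)
  finally show ?thesis unfolding set_integrable_def .
qed

text \<open>The corner of the region lies at \<open>- h\<close>, so a derivative in \<open>h\<close>
  reverses the sign. At the first derivative of a tail integral this cancels the sign of moving the
  lower limit; afterwards it accumulates to the powers of \<open>- 1\<close> in
  \<open>boundary_term\<close> and \<open>Q\<close>.\<close>

lemma has_vector_derivative_reflect:
  fixes \<Phi> :: "real \<Rightarrow> complex"
  assumes "(\<Phi> has_vector_derivative D) (at (- y))"
  shows "((\<lambda>s. \<Phi> (- (y + s))) has_vector_derivative - D) (at 0)"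
proof -
  have "((\<lambda>s. - (y + s)) has_vector_derivative - 1) (at 0)"
    by (auto intro!: derivative_eq_intros)
  from vector_diff_chain_at[OF this, of \<Phi> D] assms show ?thesis
    by (simp add: o_def)
qed

locale quadrant_function =
  fixes g :: "nat \<Rightarrow> nat \<Rightarrow> real \<Rightarrow> real \<Rightarrow> complex" and H1 H2 :: real
  assumes deriv1: "((\<lambda>y. g a b y z) has_vector_derivative g (Suc a) b y z) (at y)"
    and deriv2: "(g 0 b y has_vector_derivative g 0 (Suc b) y z) (at z)"
    and cont: "continuous_on UNIV (\<lambda>(y, z). g a b y z)"
    and int: "set_integrable lborel ({- H1..} \<times> {- H2..}) (\<lambda>(y, z). g a b y z)"
begin

lemma sections1:
  assumes "h2 \<le> H2"
  shows "half_plane_integrable (\<lambda>k. g k 0) (- H1) (- h2)"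
proof
  show "set_integrable lborel ({- H1..} \<times> {- h2..}) (\<lambda>(s, x). g k 0 s x)" for k
    using assms by (intro set_integrable_subset[OF int]) (auto intro!: borel_closed closed_Times)
qed (rule deriv1 cont)+

lemma sections2:
  assumes "h1 \<le> H1"
  shows "half_plane_integrable (\<lambda>k z y. g 0 k y z) (- H2) (- h1)"
proof
  show "set_integrable lborel ({- H2..} \<times> {- h1..}) (\<lambda>(s, x). g 0 k x s)" for k
  proof (rule set_integrable_Times_swap)
    show "set_integrable lborel ({- h1..} \<times> {- H2..}) (\<lambda>(y, z). g 0 k y z)"
      using assms by (intro set_integrable_subset[OF int]) (auto intro!: borel_closed closed_Times)
  qed
  show "continuous_on UNIV (\<lambda>(s, x). g 0 k x s)" for k
  proof -
    have "continuous_on UNIV (\<lambda>p::real \<times> real. (snd p, fst p))"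
      by (intro continuous_on_Pair continuous_on_snd continuous_on_fst continuous_on_id)
    from continuous_on_compose2[OF cont[of 0 k] this] show ?thesis
      by (simp add: case_prod_unfold)
  qed
qed (rule deriv2)

text \<open>\<open>Q a b\<close> is the mixed derivative of order \<open>(a, b)\<close> of \<open>Q 0 0\<close>. Only \<open>b\<close> derivatives in the second variable
  followed by \<open>a\<close> in the first occur, so mixed partial derivatives need not commute.\<close>

definition Q :: "nat \<Rightarrow> nat \<Rightarrow> real ^ 2 \<Rightarrow> complex" where
  "Q a b h = (case a of
      0 \<Rightarrow> (case b of
          0 \<Rightarrow> (LINT p:{- h $ 1..} \<times> {- h $ 2..}|lborel. (case p of (y, z) \<Rightarrow> g 0 0 y z))
        | Suc k \<Rightarrow> (- 1) ^ k * (LINT y:{- h $ 1..}|lborel. g 0 k y (- h $ 2)))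
    | Suc j \<Rightarrow> (case b of
          0 \<Rightarrow> (- 1) ^ j * (LINT z:{- h $ 2..}|lborel. g j 0 (- h $ 1) z)
        | Suc k \<Rightarrow> (- 1) ^ (j + k) * g j k (- h $ 1) (- h $ 2)))"

text \<open>Strict inequalities keep the corner \<open>- h\<close> off the edge of the region of
  integrability, so that it can move in every direction.\<close>

definition U :: "(real ^ 2) set" where
  "U = {h. h $ 1 < H1 \<and> h $ 2 < H2}"

lemma Q00:
  assumes "h1 \<le> H1" "h2 \<le> H2"
  shows "(LINT p:{- h1..} \<times> {- h2..}|lborel. (case p of (y, z) \<Rightarrow> g 0 0 y z))
           = (LINT y:{- h1..}|lborel. LINT z:{- h2..}|lborel. g 0 0 y z)"
    and "(LINT p:{- h1..} \<times> {- h2..}|lborel. (case p of (y, z) \<Rightarrow> g 0 0 y z))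
           = (LINT z:{- h2..}|lborel. LINT y:{- h1..}|lborel. g 0 0 y z)"
    and "set_integrable lborel {- h1..} (\<lambda>y. LINT z:{- h2..}|lborel. g 0 0 y z)"
    and "set_integrable lborel {- h2..} (\<lambda>z. LINT y:{- h1..}|lborel. g 0 0 y z)"
proof -
  have "set_integrable lborel ({- h1..} \<times> {- h2..}) (\<lambda>(y, z). g 0 0 y z)"
    using assms by (intro set_integrable_subset[OF int]) (auto intro!: borel_closed closed_Times)
  from set_integrable_Times_iterated[OF this] show
    "(LINT p:{- h1..} \<times> {- h2..}|lborel. (case p of (y, z) \<Rightarrow> g 0 0 y z))
           = (LINT y:{- h1..}|lborel. LINT z:{- h2..}|lborel. g 0 0 y z)"
    "(LINT p:{- h1..} \<times> {- h2..}|lborel. (case p of (y, z) \<Rightarrow> g 0 0 y z))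
           = (LINT z:{- h2..}|lborel. LINT y:{- h1..}|lborel. g 0 0 y z)"
    "set_integrable lborel {- h1..} (\<lambda>y. LINT z:{- h2..}|lborel. g 0 0 y z)"
    "set_integrable lborel {- h2..} (\<lambda>z. LINT y:{- h1..}|lborel. g 0 0 y z)"
    by simp_all
qed

lemma Q_deriv2:
  assumes h: "h \<in> U"
  shows "((\<lambda>s. Q 0 b (h + s *\<^sub>R axis 2 1)) has_vector_derivative Q 0 (Suc b) h) (at 0)"
proof -
  have h12: "h $ 1 < H1" "h $ 2 < H2" using h by (auto simp: U_def)
  interpret half_plane_integrable "\<lambda>k z y. g 0 k y z" "- H2" "- h $ 1"
    using h12 by (intro sections2) auto
  note psi = section_integral_has_vector_derivative
  have comp: "(h + s *\<^sub>R axis 2 1) $ 1 = h $ 1" "(h + s *\<^sub>R axis 2 1) $ 2 = h $ 2 + s" for s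
    by (simp_all add: axis_def)
  show ?thesis
  proof (cases b)
    case 0
    define \<psi> where "\<psi> z = (LINT y:{- h $ 1..}|lborel. g 0 0 y z)" for z
    \<comment> \<open>Continuity of \<open>\<psi>\<close> is known only strictly to the right of
      \<open>- H2\<close>, so the tail integrals are compared on a half-line starting midway between
      \<open>- H2\<close> and the corner.\<close>
    define a where "a = (- H2 - h $ 2) / 2"
    have a: "- H2 < a" "a < - h $ 2"
      using h12 by (auto simp: a_def field_simps)
    have "((\<lambda>x. LINT z:{x..}|lborel. \<psi> z) has_vector_derivative - \<psi> (- h $ 2)) (at (- h $ 2))"
    proof (rule tail_integral_has_vector_derivative)
      show "continuous_on {a..} \<psi>"
        unfolding \<psi>_def[abs_def]
        by (rule continuous_at_imp_continuous_on) (use a in \<open>auto intro!: has_vector_derivative_continuous psi\<close>)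
      show "set_integrable lborel {a..} \<psi>"
        unfolding \<psi>_def[abs_def] using Q00(4)[of "h $ 1" "- a"] a h12 by simp
    qed (use a in auto)
    from has_vector_derivative_reflect[OF this]
    have d: "((\<lambda>s. LINT z:{- (h $ 2 + s)..}|lborel. \<psi> z) has_vector_derivative \<psi> (- h $ 2)) (at 0)"
      by simp
    have "((\<lambda>s. LINT p:{- h $ 1..} \<times> {- (h $ 2 + s)..}|lborel. (case p of (y, z) \<Rightarrow> g 0 0 y z))
        has_vector_derivative \<psi> (- h $ 2)) (at 0)"
    proof (rule has_vector_derivative_transform_within_open[OF d, of "{..<H2 - h $ 2}"])
      show "(LINT z:{- (h $ 2 + s)..}|lborel. \<psi> z)
          = (LINT p:{- h $ 1..} \<times> {- (h $ 2 + s)..}|lborel. (case p of (y, z) \<Rightarrow> g 0 0 y z))"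
        if "s \<in> {..<H2 - h $ 2}" for s
        unfolding \<psi>_def using that h12 by (intro Q00(2)[symmetric]) auto
    qed (use h12 in auto)
    thus ?thesis
      unfolding 0 Q_def comp by (simp add: \<psi>_def)
  next
    case (Suc k)
    have "((\<lambda>z. LINT y:{- h $ 1..}|lborel. g 0 k y z) has_vector_derivative
        (LINT y:{- h $ 1..}|lborel. g 0 (Suc k) y (- h $ 2))) (at (- h $ 2))"
      using h12 by (intro psi) auto
    from has_vector_derivative_mult_right[OF has_vector_derivative_reflect[OF this], of "(- 1) ^ k"]
    show ?thesis
      unfolding Suc Q_def comp by simp
  qed
qed

lemma Q_deriv1:
  assumes h: "h \<in> U"
  shows "((\<lambda>s. Q a b (h + s *\<^sub>R axis 1 1)) has_vector_derivative Q (Suc a) b h) (at 0)"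
proof -
  have h12: "h $ 1 < H1" "h $ 2 < H2" using h by (auto simp: U_def)
  interpret S1: half_plane_integrable "\<lambda>k. g k 0" "- H1" "- h $ 2"
    using h12 by (intro sections1) auto
  \<comment> \<open>Taken over all of \<open>{- H1..}\<close> and not from the corner onwards: once
    the second coordinate has been differentiated, the lower limit in the first must be free to move
    to both sides of \<open>- h $ 1\<close>.\<close>
  interpret S2: half_plane_integrable "\<lambda>k z y. g 0 k y z" "- H2" "- H1"
    by (intro sections2) auto
  note psi = S1.section_integral_has_vector_derivative
  have comp: "(h + s *\<^sub>R axis 1 1) $ 2 = h $ 2" "(h + s *\<^sub>R axis 1 1) $ 1 = h $ 1 + s" for s
    by (simp_all add: axis_def)
  show ?thesis
  proof (cases a)
    case 0
    show ?thesis
    proof (cases b)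
      case b: 0
      define \<psi> where "\<psi> y = (LINT z:{- h $ 2..}|lborel. g 0 0 y z)" for y
      define a' where "a' = (- H1 - h $ 1) / 2"
      have a': "- H1 < a'" "a' < - h $ 1"
        using h12 by (auto simp: a'_def field_simps)
      have "((\<lambda>x. LINT y:{x..}|lborel. \<psi> y) has_vector_derivative - \<psi> (- h $ 1)) (at (- h $ 1))"
      proof (rule tail_integral_has_vector_derivative)
        show "continuous_on {a'..} \<psi>"
          unfolding \<psi>_def[abs_def]
          by (rule continuous_at_imp_continuous_on) (use a' in \<open>auto intro!: has_vector_derivative_continuous psi\<close>)
        show "set_integrable lborel {a'..} \<psi>"
          unfolding \<psi>_def[abs_def] using Q00(3)[of "- a'" "h $ 2"] a' h12 by simp
      qed (use a' in auto)
      from has_vector_derivative_reflect[OF this]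
      have d: "((\<lambda>s. LINT y:{- (h $ 1 + s)..}|lborel. \<psi> y) has_vector_derivative \<psi> (- h $ 1)) (at 0)"
        by simp
      have "((\<lambda>s. LINT p:{- (h $ 1 + s)..} \<times> {- h $ 2..}|lborel. (case p of (y, z) \<Rightarrow> g 0 0 y z))
          has_vector_derivative \<psi> (- h $ 1)) (at 0)"
      proof (rule has_vector_derivative_transform_within_open[OF d, of "{..<H1 - h $ 1}"])
        show "(LINT y:{- (h $ 1 + s)..}|lborel. \<psi> y)
            = (LINT p:{- (h $ 1 + s)..} \<times> {- h $ 2..}|lborel. (case p of (y, z) \<Rightarrow> g 0 0 y z))"
          if "s \<in> {..<H1 - h $ 1}" for s
          unfolding \<psi>_def using that h12 by (intro Q00(1)[symmetric]) auto
      qed (use h12 in auto)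
      thus ?thesis
        unfolding 0 b Q_def comp by (simp add: \<psi>_def)
    next
      case (Suc k)
      have "((\<lambda>x. LINT y:{x..}|lborel. g 0 k y (- h $ 2)) has_vector_derivative - g 0 k (- h $ 1) (- h $ 2)) (at (- h $ 1))"
        by (rule tail_integral_has_vector_derivative[of "- H1"]) (use h12 S2.cont1[of _ k] S2.section_integrable[of "- h $ 2" k] S2.cont2[of _ k] in auto)
      from has_vector_derivative_mult_right[OF has_vector_derivative_reflect[OF this], of "(- 1) ^ k"]
      show ?thesis
        unfolding 0 Suc Q_def comp by simp
    qed
  next
    case (Suc j)
    show ?thesis
    proof (cases b)
      case 0
      have "((\<lambda>y. LINT z:{- h $ 2..}|lborel. g j 0 y z) has_vector_derivative
          (LINT z:{- h $ 2..}|lborel. g (Suc j) 0 (- h $ 1) z)) (at (- h $ 1))"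
        using h12 by (intro psi) auto
      from has_vector_derivative_mult_right[OF has_vector_derivative_reflect[OF this], of "(- 1) ^ j"]
      show ?thesis
        unfolding Suc 0 Q_def comp by simp
    next
      case b: (Suc k)
      from has_vector_derivative_mult_right[OF has_vector_derivative_reflect[OF deriv1[of j k "- h $ 2" "- h $ 1"]], of "(- 1) ^ (j + k)"]
      show ?thesis
        unfolding Suc b Q_def comp by simp
    qed
  qed
qed

text \<open>Each derivative in \<open>h\<close> brings out one factor \<open>t\<close>. As
  \<open>U\<close> is open, a formula for \<open>F\<close> valid where \<open>t *\<^sub>R h\<close>
  lies in \<open>U\<close> passes to the derivative on the same set, which permits
  iteration.\<close>

lemma partial_scaled:
  assumes F: "\<And>h. t *\<^sub>R h \<in> U \<Longrightarrow> F h = \<kappa> * Q' (t *\<^sub>R h)"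
    and d: "\<And>h. h \<in> U \<Longrightarrow> ((\<lambda>s. Q' (h + s *\<^sub>R axis i 1)) has_vector_derivative Q'' h) (at 0)"
    and h: "t *\<^sub>R h \<in> U"
  shows "partial i F h = \<kappa> * of_real t * Q'' (t *\<^sub>R h)"
proof -
  have "((\<lambda>s. t * s) has_vector_derivative t) (at 0)"
    by (auto intro!: derivative_eq_intros)
  moreover have "((\<lambda>s. Q' (t *\<^sub>R h + s *\<^sub>R axis i 1)) has_vector_derivative Q'' (t *\<^sub>R h)) (at (t * 0))"
    using d[OF h] by simp
  ultimately have "((\<lambda>s. Q' (t *\<^sub>R h + (t * s) *\<^sub>R axis i 1)) has_vector_derivative t *\<^sub>R Q'' (t *\<^sub>R h)) (at 0)"
    using vector_diff_chain_at[of "\<lambda>s. t * s" t 0 "\<lambda>s. Q' (t *\<^sub>R h + s *\<^sub>R axis i 1)"] by (simp add: o_def)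
  moreover have "t *\<^sub>R h + (t * s) *\<^sub>R axis i 1 = t *\<^sub>R (h + s *\<^sub>R axis i 1)" for s
    by (simp add: scaleR_add_right)
  ultimately have "((\<lambda>s. Q' (t *\<^sub>R (h + s *\<^sub>R axis i 1))) has_vector_derivative t *\<^sub>R Q'' (t *\<^sub>R h)) (at 0)"
    by simp
  from has_vector_derivative_mult_right[OF this, of \<kappa>]
  have *: "((\<lambda>s. \<kappa> * Q' (t *\<^sub>R (h + s *\<^sub>R axis i 1))) has_vector_derivative \<kappa> * of_real t * Q'' (t *\<^sub>R h)) (at 0)"
    unfolding scaleR_conv_of_real[where 'a = complex] mult.assoc .
  have "open U"
    unfolding U_def by (intro open_Collect_conj open_Collect_less continuous_intros)
  hence op: "open ((\<lambda>s. t *\<^sub>R (h + s *\<^sub>R axis i 1)) -` U)"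
    by (intro open_vimage continuous_intros)
  have "((\<lambda>s. F (h + s *\<^sub>R axis i 1)) has_vector_derivative \<kappa> * of_real t * Q'' (t *\<^sub>R h)) (at 0)"
    by (rule has_vector_derivative_transform_within_open[OF * op]) (use h F in auto)
  thus ?thesis
    unfolding partial_def by (rule vector_derivative_at)
qed

lemma iterated_partials:
  assumes F: "\<And>h. t *\<^sub>R h \<in> U \<Longrightarrow> F h = \<kappa> * Q 0 0 (t *\<^sub>R h)" and h: "t *\<^sub>R h \<in> U"
  shows "(partial 1 ^^ a) ((partial 2 ^^ b) F) h = \<kappa> * of_real t ^ (a + b) * Q a b (t *\<^sub>R h)"
proof -
  have 2: "(partial 2 ^^ b) F h = \<kappa> * of_real t ^ b * Q 0 b (t *\<^sub>R h)" if "t *\<^sub>R h \<in> U" for b h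
    using that
  proof (induction b arbitrary: h)
    case (Suc b)
    show ?case
      using partial_scaled[of t "(partial 2 ^^ b) F" "\<kappa> * of_real t ^ b" "Q 0 b" 2 "Q 0 (Suc b)" h]
        Suc Q_deriv2 by (simp add: mult_ac)
  qed (simp add: F)
  show ?thesis
    using h
  proof (induction a arbitrary: h)
    case (Suc a)
    show ?case
      using partial_scaled[of t "(partial 1 ^^ a) ((partial 2 ^^ b) F)" "\<kappa> * of_real t ^ (a + b)" "Q a b" 1 "Q (Suc a) b" h]
        Suc Q_deriv1 by (simp add: mult_ac)
  qed (simp add: 2)
qed

text \<open>Here the derivatives in \<open>h\<close> of the theorem meet the boundary terms of the
  Euler-Maclaurin formula: at \<open>h = 0\<close> the corner is the origin of the quadrant.\<close>

lemma Q_at_0: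
  assumes "0 < H1" "0 < H2"
  shows "Q a b 0 = boundary_term (boundary_fun g b) a"
proof (cases a)
  case 0
  show ?thesis
    using Q00(1)[of 0 0] assms unfolding 0
    by (cases b) (simp_all add: Q_def boundary_fun_def[abs_def] boundary_term_def)
next
  case (Suc j)
  show ?thesis
    unfolding Suc by (cases b) (simp_all add: Q_def boundary_fun_def boundary_term_def power_add)
qed

lemma lattice_sum_expansion:
  fixes l1 l2 :: complex and A :: "nat \<Rightarrow> nat \<Rightarrow> real"
  assumes H: "0 < H1" "0 < H2" and l: "norm l1 = 1" "norm l2 = 1" and M: "0 < M"
    and bnd: "\<And>a b y z. 0 \<le> y \<Longrightarrow> 0 \<le> z \<Longrightarrow> norm (g a b y z) \<le> A a b / ((1 + y) ^ 2 * (1 + z) ^ 2)"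
  shows "\<exists>C. \<forall>t. 0 < t \<longrightarrow> t \<le> 1 \<longrightarrow>
    norm (of_real t ^ 2 * (\<Sum>m. \<Sum>n. half_weight m * half_weight n * l1 ^ m * l2 ^ n * g 0 0 (t * real m) (t * real n))
      - (\<Sum>a\<le>M. \<Sum>b\<le>M. fps_nth (half_Todd l1) a * fps_nth (half_Todd l2) b * of_real t ^ (a + b)
            * Q a b 0)) \<le> C * t ^ M"
proof -
  \<comment> \<open>Because \<open>- H1 < 0\<close>, even the endpoint \<open>y = 0\<close> lies
    inside the range where section integrals have two-sided derivatives.\<close>
  interpret S1: half_plane_integrable "\<lambda>k. g k 0" "- H1" "- 0"
    using H by (intro sections1) auto
  show ?thesis
    unfolding Q_at_0[OF H]
  proof (rule Euler_Maclaurin_quadrant[where g = g and A = A, OF l M deriv1 deriv2 _ _ bnd])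
    show "((\<lambda>y. set_lebesgue_integral lborel {0..} (g a 0 y)) has_vector_derivative
          set_lebesgue_integral lborel {0..} (g (Suc a) 0 y)) (at y)" if "0 \<le> y" for a y
      using S1.section_integral_has_vector_derivative[of y a] that H by simp
    show "set_integrable lborel {0..} (g a 0 y)" if "0 \<le> y" for a y
      using S1.section_integrable[of y a] that H by simp
  qed
qed

end

section \<open>Linear change of variables in the plane\<close>

text \<open>Carries the problem over to \<open>real \<times> real\<close>, where iterated integrals
  are at hand; Lebesgue measure is determined by its values on boxes.\<close>

lemma lborel_vec2: "(lborel :: (real ^ 2) measure) = distr lborel borel (\<lambda>(a, b). a *\<^sub>R axis 1 1 + b *\<^sub>R axis 2 1)"
proof (rule lborel_eqI)
  let ?V = "\<lambda>(a, b). a *\<^sub>R axis 1 1 + b *\<^sub>R axis 2 1 :: real ^ 2"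
  have V: "?V \<in> borel_measurable borel"
    unfolding case_prod_unfold by (intro borel_measurable_continuous_onI continuous_intros)
  fix l u :: "real ^ 2"
  assume "\<And>b. b \<in> Basis \<Longrightarrow> l \<bullet> b \<le> u \<bullet> b"
  from this[of "axis i 1" for i] have le: "l $ i \<le> u $ i" for i
    by (simp add: axis_in_Basis_iff inner_axis)
  have "?V -` box l u = box (l $ 1, l $ 2) (u $ 1, u $ 2)"
    by (auto simp: mem_box_cart box_prod axis_def forall_2)
  hence "emeasure (distr lborel borel ?V) (box l u) = emeasure lborel (box (l $ 1, l $ 2) (u $ 1, u $ 2))"
    using V by (simp add: emeasure_distr)
  also have "\<dots> = ennreal ((u $ 1 - l $ 1) * (u $ 2 - l $ 2))"
    using le by (subst emeasure_lborel_box) (auto simp: Basis_prod_def prod.union_disjoint)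
  also have "\<dots> = (\<Prod>b\<in>Basis. (u - l) \<bullet> b)"
    by (simp add: Basis_vec_def prod.UNION_disjoint inner_axis UNIV_2 axis_eq_axis mult.commute)
  finally show "emeasure (distr lborel borel ?V) (box l u) = ennreal (\<Prod>b\<in>Basis. (u - l) \<bullet> b)" .
qed simp

text \<open>For \<open>a \<noteq> 0\<close> put \<open>s = x * a + y * b\<close>. The second
  coordinate is then \<open>s * c / a + k * y\<close> with \<open>k = (a * e - b * c) / a\<close>,
  so two affine substitutions in one variable suffice, with factors \<open>\<bar>k\<bar>\<close> and
  \<open>\<bar>a\<bar>\<close>.\<close>

lemma nn_integral_linear_pair_aux:
  fixes a b c e :: real and F :: "real \<times> real \<Rightarrow> ennreal"
  assumes [measurable]: "F \<in> borel_measurable borel" and a: "a \<noteq> 0" and d: "a * e - b * c \<noteq> 0"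
  shows "(\<integral>\<^sup>+z. F z \<partial>lborel) = ennreal \<bar>a * e - b * c\<bar> *
            (\<integral>\<^sup>+y. \<integral>\<^sup>+x. F (x * a + y * b, x * c + y * e) \<partial>lborel \<partial>lborel)"
proof -
  define k where "k = (a * e - b * c) / a"
  have k: "k \<noteq> 0" using a d by (simp add: k_def)
  have [measurable]: "F \<in> borel_measurable (lborel \<Otimes>\<^sub>M lborel)"
    by (simp add: lborel_prod)
  have [measurable]: "F \<in> borel_measurable (borel \<Otimes>\<^sub>M borel)"
    by (simp add: borel_prod)
  have inner: "(\<integral>\<^sup>+s. F (s, s * c / a + k * y) \<partial>lborel) = ennreal \<bar>a\<bar> * (\<integral>\<^sup>+x. F (x * a + y * b, x * c + y * e) \<partial>lborel)" for y
  proof -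
    have "(\<integral>\<^sup>+s. F (s, s * c / a + k * y) \<partial>lborel)
        = ennreal \<bar>a\<bar> * (\<integral>\<^sup>+x. F (y * b + a * x, (y * b + a * x) * c / a + k * y) \<partial>lborel)"
      by (intro nn_integral_real_affine a) measurable
    also have "(\<lambda>x. F (y * b + a * x, (y * b + a * x) * c / a + k * y)) = (\<lambda>x. F (x * a + y * b, x * c + y * e))"
      using a by (intro ext arg_cong[where f = F]) (simp add: k_def field_simps)
    finally show ?thesis .
  qed
  have "(\<integral>\<^sup>+z. F z \<partial>lborel) = (\<integral>\<^sup>+s. \<integral>\<^sup>+x. F (s, x) \<partial>lborel \<partial>lborel)"
    unfolding lborel_prod[symmetric] by (subst lborel.nn_integral_fst) auto
  also have "\<dots> = (\<integral>\<^sup>+s. ennreal \<bar>k\<bar> * (\<integral>\<^sup>+y. F (s, s * c / a + k * y) \<partial>lborel) \<partial>lborel)"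
    by (intro nn_integral_cong nn_integral_real_affine k) measurable
  also have "\<dots> = ennreal \<bar>k\<bar> * (\<integral>\<^sup>+s. \<integral>\<^sup>+y. F (s, s * c / a + k * y) \<partial>lborel \<partial>lborel)"
    by (intro nn_integral_cmult) measurable
  also have "(\<integral>\<^sup>+s. \<integral>\<^sup>+y. F (s, s * c / a + k * y) \<partial>lborel \<partial>lborel)
      = (\<integral>\<^sup>+y. \<integral>\<^sup>+s. F (s, s * c / a + k * y) \<partial>lborel \<partial>lborel)"
    by (rule lborel_pair.Fubini') measurable
  also have "\<dots> = ennreal \<bar>a\<bar> * (\<integral>\<^sup>+y. \<integral>\<^sup>+x. F (x * a + y * b, x * c + y * e) \<partial>lborel \<partial>lborel)"
    unfolding inner by (intro nn_integral_cmult) measurable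
  also have "ennreal \<bar>k\<bar> * (ennreal \<bar>a\<bar> * (\<integral>\<^sup>+y. \<integral>\<^sup>+x. F (x * a + y * b, x * c + y * e) \<partial>lborel \<partial>lborel))
     = ennreal (\<bar>k\<bar> * \<bar>a\<bar>) * (\<integral>\<^sup>+y. \<integral>\<^sup>+x. F (x * a + y * b, x * c + y * e) \<partial>lborel \<partial>lborel)"
    by (simp add: ennreal_mult mult.assoc)
  also have "\<bar>k\<bar> * \<bar>a\<bar> = \<bar>a * e - b * c\<bar>"
    using a by (simp add: k_def abs_divide)
  finally show ?thesis .
qed

lemma nn_integral_linear_pair:
  fixes a b c e :: real and F :: "real \<times> real \<Rightarrow> ennreal"
  assumes F: "F \<in> borel_measurable borel" and d: "a * e - b * c \<noteq> 0"
  shows "(\<integral>\<^sup>+z. F z \<partial>lborel) = ennreal \<bar>a * e - b * c\<bar> *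
            (\<integral>\<^sup>+(x, y). F (x * a + y * b, x * c + y * e) \<partial>lborel)"
proof -
  note [measurable] = F
  have [measurable]: "F \<in> borel_measurable (borel \<Otimes>\<^sub>M borel)"
    by (simp add: borel_prod)
  have m: "(\<lambda>(x, y). F (x * a + y * b, x * c + y * e)) \<in> borel_measurable (lborel \<Otimes>\<^sub>M lborel)"
    by measurable
  have i1: "(\<integral>\<^sup>+(x, y). F (x * a + y * b, x * c + y * e) \<partial>lborel)
      = (\<integral>\<^sup>+x. \<integral>\<^sup>+y. F (x * a + y * b, x * c + y * e) \<partial>lborel \<partial>lborel)"
    unfolding lborel_prod[symmetric] using lborel.nn_integral_fst[OF m] by simp
  have i2: "(\<integral>\<^sup>+x. \<integral>\<^sup>+y. F (x * a + y * b, x * c + y * e) \<partial>lborel \<partial>lborel)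
      = (\<integral>\<^sup>+y. \<integral>\<^sup>+x. F (x * a + y * b, x * c + y * e) \<partial>lborel \<partial>lborel)"
    by (rule lborel_pair.Fubini') measurable
  show ?thesis
  proof (cases "a = 0")
    case False
    show ?thesis
      unfolding i1 i2 by (rule nn_integral_linear_pair_aux[OF F False d])
  next
    case True
    \<comment> \<open>Exchanging the roles of \<open>x\<close> and \<open>y\<close> makes
      \<open>b\<close> the pivot.\<close>
    with d have b: "b \<noteq> 0" and d': "b * c - a * e \<noteq> 0" by auto
    show ?thesis
      unfolding i1 using nn_integral_linear_pair_aux[OF F b d']
      by (simp add: add.commute abs_minus_commute)
  qed
qed

lemma lborel_linear_pair:
  fixes a1 a2 :: "real ^ 2"
  defines "d \<equiv> a1 $ 1 * a2 $ 2 - a2 $ 1 * a1 $ 2"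
  assumes d: "d \<noteq> 0"
  shows "(lborel :: (real ^ 2) measure) =
    density (distr lborel borel (\<lambda>(x, y). x *\<^sub>R a1 + y *\<^sub>R a2)) (\<lambda>_. ennreal \<bar>d\<bar>)"
proof (rule measure_eqI)
  fix A :: "(real ^ 2) set"
  assume "A \<in> sets lborel"
  hence [measurable]: "A \<in> sets borel" by simp
  let ?V = "\<lambda>(a, b). a *\<^sub>R axis 1 1 + b *\<^sub>R axis 2 1 :: real ^ 2"
  let ?T = "\<lambda>(x, y). x *\<^sub>R a1 + y *\<^sub>R a2"
  have V [measurable]: "?V \<in> borel_measurable borel" and T [measurable]: "?T \<in> borel_measurable borel"
    unfolding case_prod_unfold by (intro borel_measurable_continuous_onI continuous_intros)+
  have VT: "?V (x * a1 $ 1 + y * a2 $ 1, x * a1 $ 2 + y * a2 $ 2) = ?T (x, y)" for x y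
    by (simp add: vec_eq_iff forall_2 axis_def)
  have "emeasure lborel A = (\<integral>\<^sup>+z. indicator A (?V z) \<partial>lborel)"
    by (subst lborel_vec2) (simp add: nn_integral_distr flip: nn_integral_indicator)
  also have "\<dots> = ennreal \<bar>d\<bar> * (\<integral>\<^sup>+(x, y). indicator A (?T (x, y)) \<partial>lborel)"
    using nn_integral_linear_pair[of "\<lambda>z. indicator A (?V z)" "a1 $ 1" "a2 $ 2" "a2 $ 1" "a1 $ 2"] d
    unfolding VT d_def by simp
  also have "\<dots> = emeasure (density (distr lborel borel ?T) (\<lambda>_. ennreal \<bar>d\<bar>)) A"
  proof -
    have "emeasure (density (distr lborel borel ?T) (\<lambda>_. ennreal \<bar>d\<bar>)) A = ennreal \<bar>d\<bar> * emeasure (distr lborel borel ?T) A"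
      by (simp add: emeasure_density nn_integral_cmult)
    also have "emeasure (distr lborel borel ?T) A = (\<integral>\<^sup>+z. indicator A z \<partial>distr lborel borel ?T)"
      by simp
    also have "\<dots> = (\<integral>\<^sup>+z. indicator A (?T z) \<partial>lborel)"
      by (rule nn_integral_distr) auto
    finally show ?thesis by (simp add: case_prod_unfold)
  qed
  finally show "emeasure lborel A = emeasure (density (distr lborel borel ?T) (\<lambda>_. ennreal \<bar>d\<bar>)) A" .
qed simp

lemma linear_pair_change_of_variables:
  fixes a1 a2 :: "real ^ 2" and f :: "real ^ 2 \<Rightarrow> complex"
  defines "d \<equiv> a1 $ 1 * a2 $ 2 - a2 $ 1 * a1 $ 2" and "T \<equiv> (\<lambda>(x, y). x *\<^sub>R a1 + y *\<^sub>R a2)"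
  assumes d: "d \<noteq> 0" and f [measurable]: "f \<in> borel_measurable borel"
    and S [measurable]: "S \<in> sets borel"
  shows "set_integrable lborel S f \<longleftrightarrow> set_integrable lborel (T -` S) (\<lambda>y. f (T y))"
    and "(LINT x:S|lborel. f x) = of_real \<bar>d\<bar> * (LINT y:T -` S|lborel. f (T y))"
proof -
  have T [measurable]: "T \<in> borel_measurable borel"
    unfolding T_def case_prod_unfold by (intro borel_measurable_continuous_onI continuous_intros)
  have ind: "indicator (T -` S) y = (indicator S (T y) :: real)" for y
    by (simp add: indicator_def)
  show "set_integrable lborel S f \<longleftrightarrow> set_integrable lborel (T -` S) (\<lambda>y. f (T y))"
  proof -
    have iff: "integrable M (\<lambda>x. k *\<^sub>R h x) \<longleftrightarrow> integrable M h" if "k \<noteq> 0"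
      for k and h :: "real \<times> real \<Rightarrow> complex" and M
      using integrable_scaleR_right[of "1 / k" M "\<lambda>x. k *\<^sub>R h x"] integrable_scaleR_right[of k M h] that
      by auto
    show ?thesis
      unfolding set_integrable_def ind
      by (subst lborel_linear_pair[of a1 a2])
         (use d in \<open>simp_all add: d_def[symmetric] T_def[symmetric] integrable_density integrable_distr_eq iff
            del: scaleR_scaleR\<close>)
  qed
  show "(LINT x:S|lborel. f x) = of_real \<bar>d\<bar> * (LINT y:T -` S|lborel. f (T y))"
  proof -
    have "(\<integral>x. indicator S x *\<^sub>R f x \<partial>lborel) = \<bar>d\<bar> *\<^sub>R (\<integral>y. indicator S (T y) *\<^sub>R f (T y) \<partial>lborel)"
      by (subst lborel_linear_pair[of a1 a2])
         (use d in \<open>simp_all add: d_def[symmetric] T_def[symmetric] integral_density integral_distr del: scaleR_scaleR\<close>)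
    thus ?thesis
      unfolding set_lebesgue_integral_def ind by (simp only: scaleR_conv_of_real[of "\<bar>d\<bar>"])
  qed
qed

section \<open>The group \<open>\<Gamma>\<close> and its characters\<close>

definition det2 :: "int ^ 2 \<Rightarrow> int ^ 2 \<Rightarrow> int" where
  "det2 u v = u $ 1 * v $ 2 - u $ 2 * v $ 1"

lemma rvec_nth [simp]: "rvec v $ i = real_of_int (v $ i)"
  by (simp add: rvec_def)

lemma rvec_inner: "rvec u \<bullet> x = of_int (u $ 1) * x $ 1 + of_int (u $ 2) * x $ 2"
  by (simp add: inner_vec_def sum_2)

lemma rvec_eq_iff [simp]: "rvec u = rvec v \<longleftrightarrow> u = v"
  by (simp add: vec_eq_iff)

lemma lattice_cone_det2:
  assumes "lattice_cone u1 u2"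
  shows "det2 u1 u2 \<noteq> 0"
proof
  assume d: "det2 u1 u2 = 0"
  have u1: "u1 $ 1 \<noteq> 0 \<or> u1 $ 2 \<noteq> 0"
    using assms by (auto simp: lattice_cone_def primitive_def)
  have d': "real_of_int (u1 $ 1) * u2 $ 2 = u1 $ 2 * u2 $ 1"
    using d unfolding det2_def by (metis eq_iff_diff_eq_0 of_int_mult)
  have "\<exists>k. rvec u2 = k *\<^sub>R rvec u1"
  proof (cases "u1 $ 1 = 0")
    case False
    thus ?thesis
      using d' by (intro exI[of _ "u2 $ 1 / u1 $ 1"]) (simp add: vec_eq_iff forall_2 field_simps)
  next
    case True
    thus ?thesis
      using d' u1 by (intro exI[of _ "u2 $ 2 / u1 $ 2"]) (simp add: vec_eq_iff forall_2 field_simps)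
  qed
  hence "rvec u2 \<in> span {rvec u1}"
    by (auto simp: span_base span_scale)
  moreover have "{rvec u1, rvec u2} - {rvec u2} = {rvec u1}"
    using assms by (auto simp: lattice_cone_def)
  ultimately show False
    using assms unfolding lattice_cone_def dependent_def by auto
qed

lemma dual_vec_nth:
  assumes "det2 u1 u2 \<noteq> 0"
  shows "dual_vec1 u1 u2 $ 1 = u2 $ 2 / det2 u1 u2" "dual_vec1 u1 u2 $ 2 = - (u2 $ 1) / det2 u1 u2"
    and "dual_vec2 u1 u2 $ 1 = - (u1 $ 2) / det2 u1 u2" "dual_vec2 u1 u2 $ 2 = u1 $ 1 / det2 u1 u2"
proof -
  let ?d = "real_of_int (det2 u1 u2)"
  have d: "?d \<noteq> 0" using assms by simp
  have d_eq: "?d = u1 $ 1 * u2 $ 2 - u1 $ 2 * u2 $ 1" by (simp add: det2_def)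
  have unique: "a $ 1 = (p * u2 $ 2 - q * u1 $ 2) / ?d \<and> a $ 2 = (q * u1 $ 1 - p * u2 $ 1) / ?d"
    if "a \<bullet> rvec u1 = p" "a \<bullet> rvec u2 = q" for a :: "real ^ 2" and p q
  proof -
    have "u1 $ 1 * a $ 1 + u1 $ 2 * a $ 2 = p" "u2 $ 1 * a $ 1 + u2 $ 2 * a $ 2 = q"
      using that by (simp_all add: inner_commute[of a] rvec_inner)
    thus ?thesis
      using d by (auto simp: d_eq divide_simps) (auto simp: algebra_simps)
  qed
  define V :: "real \<Rightarrow> real \<Rightarrow> real ^ 2" where
    "V p q = (\<chi> i. if i = 1 then (p * u2 $ 2 - q * u1 $ 2) / ?d else (q * u1 $ 1 - p * u2 $ 1) / ?d)" for p q
  have V: "V p q \<bullet> rvec u1 = p" "V p q \<bullet> rvec u2 = q" for p q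
    using d by (simp_all add: V_def inner_commute[of _ "rvec _"] rvec_inner divide_simps) (simp_all add: d_eq algebra_simps)
  have vec: "a = V p q" if "a \<bullet> rvec u1 = p \<and> a \<bullet> rvec u2 = q" for a p q
    using unique[of a p q] that by (simp add: vec_eq_iff forall_2 V_def)
  have 1: "dual_vec1 u1 u2 = V 1 0"
    unfolding dual_vec1_def by (rule the_equality, simp add: V, rule vec)
  have 2: "dual_vec2 u1 u2 = V 0 1"
    unfolding dual_vec2_def by (rule the_equality, simp add: V, rule vec)
  show "dual_vec1 u1 u2 $ 1 = u2 $ 2 / det2 u1 u2" "dual_vec1 u1 u2 $ 2 = - (u2 $ 1) / det2 u1 u2"
    by (simp_all add: 1 V_def)
  show "dual_vec2 u1 u2 $ 1 = - (u1 $ 2) / det2 u1 u2" "dual_vec2 u1 u2 $ 2 = u1 $ 1 / det2 u1 u2"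
    by (simp_all add: 2 V_def)
qed

lemma dual_pairing:
  assumes d: "det2 u1 u2 \<noteq> 0"
  shows "rvec u1 \<bullet> dual_vec1 u1 u2 = 1" "rvec u2 \<bullet> dual_vec1 u1 u2 = 0"
    "rvec u1 \<bullet> dual_vec2 u1 u2 = 0" "rvec u2 \<bullet> dual_vec2 u1 u2 = 1"
  using d by (simp_all add: rvec_inner dual_vec_nth[OF d] divide_simps) (simp_all add: det2_def algebra_simps)

lemma dual_basis_expansion:
  assumes d: "det2 u1 u2 \<noteq> 0"
  shows "x = (x \<bullet> dual_vec1 u1 u2) *\<^sub>R rvec u1 + (x \<bullet> dual_vec2 u1 u2) *\<^sub>R rvec u2"
    and "x = (x \<bullet> rvec u1) *\<^sub>R dual_vec1 u1 u2 + (x \<bullet> rvec u2) *\<^sub>R dual_vec2 u1 u2"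
  using d by (simp_all add: vec_eq_iff forall_2 inner_vec_def sum_2 dual_vec_nth[OF d] divide_simps)
    (simp_all add: det2_def algebra_simps)

lemma primitive_complement:
  assumes "primitive u"
  obtains w where "det2 u w = 1"
proof -
  obtain x y where "x * u $ 1 + y * u $ 2 = 1"
    using assms bezout_int[of "u $ 1" "u $ 2"] by (auto simp: primitive_def)
  hence "det2 u (\<chi> i. if i = 1 then - y else x) = 1"
    by (simp add: det2_def algebra_simps)
  thus thesis by (rule that)
qed

text \<open>Since \<open>u1\<close> and \<open>w\<close> form a basis of the integer lattice,
  \<open>\<Gamma>\<close> is cyclic and generated by the class of \<open>w\<close>; the map
  \<open>det2 u1\<close> reads off the coordinate along \<open>w\<close>. This reduces sums over
  \<open>\<Gamma>\<close> to sums over \<open>j < q\<close>.\<close>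

locale complemented_pair =
  fixes u1 u2 w :: "int ^ 2"
  assumes w: "det2 u1 w = 1" and d: "det2 u1 u2 \<noteq> 0"
begin

definition q :: nat where "q = nat \<bar>det2 u1 u2\<bar>"

lemma q_pos: "0 < q"
  using d by (simp add: q_def)

lemma unimodular_expansion: "x = det2 x w *s u1 + det2 u1 x *s w"
proof -
  have "x $ 1 = det2 x w * u1 $ 1 + det2 u1 x * w $ 1" "x $ 2 = det2 x w * u1 $ 2 + det2 u1 x * w $ 2"
    using w unfolding det2_def by algebra+
  thus ?thesis by (simp add: vec_eq_iff forall_2)
qed

text \<open>\<open>det2 u1\<close> annihilates \<open>u1\<close> and sends \<open>w\<close> to 1 and
  \<open>u2\<close> to \<open>det2 u1 u2\<close>, hence identifies \<open>\<Gamma>\<close> with the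
  integers modulo \<open>det2 u1 u2\<close>.\<close>

lemma Gamma_rel_iff: "(x, y) \<in> Gamma_rel u1 u2 \<longleftrightarrow> det2 u1 u2 dvd det2 u1 x - det2 u1 y"
proof
  assume "(x, y) \<in> Gamma_rel u1 u2"
  then obtain m n where "x - y = m *s u1 + n *s u2" by (auto simp: Gamma_rel_def)
  hence "x $ 1 - y $ 1 = m * u1 $ 1 + n * u2 $ 1" "x $ 2 - y $ 2 = m * u1 $ 2 + n * u2 $ 2"
    by (auto simp: vec_eq_iff)
  hence "det2 u1 x - det2 u1 y = det2 u1 u2 * n"
    unfolding det2_def by algebra
  thus "det2 u1 u2 dvd det2 u1 x - det2 u1 y" by simp
next
  assume "det2 u1 u2 dvd det2 u1 x - det2 u1 y"
  then obtain n where n: "det2 u1 x - det2 u1 y = det2 u1 u2 * n" by auto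
  \<comment> \<open>Expand \<open>x\<close>, \<open>y\<close> and \<open>u2\<close> in the basis
    \<open>u1\<close>, \<open>w\<close>. The choice of \<open>n\<close> makes the \<open>w\<close>
    components agree, and the coefficient of \<open>u1\<close> takes up the rest.\<close>
  have "x $ i - y $ i = (det2 x w - det2 y w - n * det2 u2 w) * u1 $ i + n * u2 $ i" for i
  proof -
    have *: "z $ i = det2 z w * u1 $ i + det2 u1 z * w $ i" for z
      using arg_cong[OF unimodular_expansion[of z], of "\<lambda>v. v $ i"] by simp
    show ?thesis
      using *[of x] *[of y] *[of u2] n by algebra
  qed
  hence "x - y = (det2 x w - det2 y w - n * det2 u2 w) *s u1 + n *s u2"
    unfolding vec_eq_iff by (intro allI) (simp only: vector_minus_component vector_add_component vector_smult_component)
  thus "(x, y) \<in> Gamma_rel u1 u2" unfolding Gamma_rel_def by blast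
qed

lemma det2_u1_scale_w [simp]: "det2 u1 (k *s w) = k"
proof -
  have "det2 u1 (k *s w) = k * det2 u1 w" by (simp add: det2_def algebra_simps)
  thus ?thesis using w by simp
qed

lemma bij_betw_Gamma: "bij_betw (\<lambda>j. Gamma_rel u1 u2 `` {int j *s w}) {..<q} (Gamma u1 u2)"
proof -
  have eq: "Gamma_rel u1 u2 `` {x} = {y. det2 u1 u2 dvd det2 u1 x - det2 u1 y}" for x
    by (auto simp: Gamma_rel_iff)
  have "inj_on (\<lambda>j. Gamma_rel u1 u2 `` {int j *s w}) {..<q}"
  proof (rule inj_onI)
    fix i j assume ij: "i \<in> {..<q}" "j \<in> {..<q}"
      and "Gamma_rel u1 u2 `` {int i *s w} = Gamma_rel u1 u2 `` {int j *s w}"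
    hence "det2 u1 u2 dvd int i - int j"
      unfolding eq by (metis (mono_tags, lifting) det2_u1_scale_w diff_self dvd_0_right mem_Collect_eq)
    moreover have "\<bar>int i - int j\<bar> < \<bar>det2 u1 u2\<bar>"
      using ij by (auto simp: q_def)
    ultimately show "i = j"
      using dvd_imp_le_int[of "int i - int j" "det2 u1 u2"] by (cases "i = j") auto
  qed
  moreover have "(\<lambda>j. Gamma_rel u1 u2 `` {int j *s w}) ` {..<q} = Gamma u1 u2"
  proof (intro equalityI subsetI)
    fix \<gamma> assume "\<gamma> \<in> Gamma u1 u2"
    then obtain x where x: "\<gamma> = Gamma_rel u1 u2 `` {x}"
      by (auto simp: Gamma_def quotient_def)
    define j where "j = nat (det2 u1 x mod \<bar>det2 u1 u2\<bar>)"
    have j: "int j = det2 u1 x mod \<bar>det2 u1 u2\<bar>"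
      using d by (simp add: j_def)
    have "j < q"
      using d by (simp add: j_def q_def nat_less_eq_zless)
    moreover have "det2 u1 u2 dvd det2 u1 x - int j"
      unfolding j by (metis abs_dvd_iff dvd_minus_mod)
    hence "Gamma_rel u1 u2 `` {int j *s w} = \<gamma>"
      unfolding x eq by (auto simp: dvd_diff_commute)
         (metis (no_types, lifting) diff_add_cancel dvd_add_right_iff add_diff_eq dvd_diff_commute)+
    ultimately show "\<gamma> \<in> (\<lambda>j. Gamma_rel u1 u2 `` {int j *s w}) ` {..<q}" by blast
  qed (auto simp: Gamma_def quotient_def)
  ultimately show ?thesis by (simp add: bij_betw_def)
qed

lemma card_Gamma: "card (Gamma u1 u2) = q"
  using bij_betw_same_card[OF bij_betw_Gamma] by simp

section \<open>The characters of \<open>\<Gamma>\<close> as powers of two roots of unity\<close>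

definition \<zeta>1 :: complex where "\<zeta>1 = exp (2 * of_real pi * \<i> * of_real (rvec w \<bullet> dual_vec1 u1 u2))"
definition \<zeta>2 :: complex where "\<zeta>2 = exp (2 * of_real pi * \<i> * of_real (rvec w \<bullet> dual_vec2 u1 u2))"

lemma w_dual: "rvec w \<bullet> dual_vec1 u1 u2 = det2 w u2 / det2 u1 u2" "rvec w \<bullet> dual_vec2 u1 u2 = 1 / det2 u1 u2"
proof -
  show "rvec w \<bullet> dual_vec1 u1 u2 = det2 w u2 / det2 u1 u2"
    by (simp add: rvec_inner dual_vec_nth[OF d] det2_def[of w] diff_divide_distrib)
  have "rvec w \<bullet> dual_vec2 u1 u2 = det2 u1 w / det2 u1 u2"
    by (simp add: rvec_inner dual_vec_nth[OF d] det2_def[of u1 w] diff_divide_distrib mult.commute)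
  thus "rvec w \<bullet> dual_vec2 u1 u2 = 1 / det2 u1 u2" using w by simp
qed

lemma exp_int_period: "exp (2 * of_real pi * \<i> * of_real (r + of_int k)) = exp (2 * of_real pi * \<i> * of_real r)"
proof -
  have "2 * of_real pi * \<i> * of_real (r + of_int k) = 2 * of_real pi * \<i> * of_real r + \<i> * (of_int k * (of_real pi * 2))"
    by (simp add: algebra_simps)
  thus ?thesis
    by (simp only: exp_plus_2pin)
qed

lemma exp_2pi_of_int: "exp (2 * of_real pi * \<i> * of_real (of_int k)) = 1"
  using exp_int_period[of 0 k] by simp

lemma lam_class:
  assumes "rvec u1 \<bullet> a \<in> \<int>" "rvec u2 \<bullet> a \<in> \<int>"
  shows "lam (Gamma_rel u1 u2 `` {int j *s w}) a = exp (2 * of_real pi * \<i> * of_real (rvec w \<bullet> a)) ^ j"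
proof -
  let ?\<gamma> = "Gamma_rel u1 u2 `` {int j *s w}"
  have "int j *s w \<in> ?\<gamma>" by (simp add: Gamma_rel_iff)
  hence "(SOME g. g \<in> ?\<gamma>) \<in> ?\<gamma>" by (rule someI)
  then obtain m n where "int j *s w - (SOME g. g \<in> ?\<gamma>) = m *s u1 + n *s u2"
    unfolding Gamma_rel_def by blast
  then obtain g where g: "(SOME g. g \<in> ?\<gamma>) = g" "int j *s w - g = m *s u1 + n *s u2" by blast
  obtain k1 k2 where k: "rvec u1 \<bullet> a = of_int k1" "rvec u2 \<bullet> a = of_int k2"
    using assms by (auto elim!: Ints_cases)
  have "g $ i = int j * w $ i - m * u1 $ i - n * u2 $ i" for i
    using arg_cong[OF g(2), of "\<lambda>v. v $ i"] by simp
  hence "rvec g = real j *\<^sub>R rvec w - of_int m *\<^sub>R rvec u1 - of_int n *\<^sub>R rvec u2"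
    by (simp add: vec_eq_iff)
  hence "rvec g \<bullet> a = real j * (rvec w \<bullet> a) + of_int (- m * k1 - n * k2)"
    by (simp add: inner_diff_left k)
  hence "lam ?\<gamma> a = exp (2 * of_real pi * \<i> * of_real (real j * (rvec w \<bullet> a)))"
    unfolding lam_def g(1) by (simp only: exp_int_period)
  also have "\<dots> = exp (of_nat j * (2 * of_real pi * \<i> * of_real (rvec w \<bullet> a)))"
    by (simp add: mult_ac)
  finally show ?thesis by (simp add: exp_of_nat_mult)
qed

lemma sum_Gamma:
  "(\<Sum>\<gamma>\<in>Gamma u1 u2. F (lam \<gamma> (dual_vec1 u1 u2)) (lam \<gamma> (dual_vec2 u1 u2))) = (\<Sum>j<q. F (\<zeta>1 ^ j) (\<zeta>2 ^ j))"
  unfolding sum.reindex_bij_betw[OF bij_betw_Gamma, symmetric]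
  by (simp add: lam_class dual_pairing[OF d] \<zeta>1_def \<zeta>2_def)

lemma zeta_power: "\<zeta>1 ^ m * \<zeta>2 ^ n = exp (2 * of_real pi * \<i> * of_real ((real m * det2 w u2 + real n) / det2 u1 u2))"
proof -
  have "\<zeta>1 ^ m * \<zeta>2 ^ n = exp (of_nat m * (2 * of_real pi * \<i> * of_real (rvec w \<bullet> dual_vec1 u1 u2))
          + of_nat n * (2 * of_real pi * \<i> * of_real (rvec w \<bullet> dual_vec2 u1 u2)))"
    unfolding \<zeta>1_def \<zeta>2_def by (simp add: exp_add exp_of_nat_mult)
  thus ?thesis
    by (simp add: w_dual add_divide_distrib algebra_simps)
qed

lemma zeta_power_q: "(\<zeta>1 ^ m * \<zeta>2 ^ n) ^ q = 1"
proof -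
  have "real q / det2 u1 u2 = of_int (sgn (det2 u1 u2))"
    using d by (auto simp: q_def sgn_if)
  hence *: "real q * ((real m * det2 w u2 + real n) / det2 u1 u2)
     = of_int (sgn (det2 u1 u2) * (int m * det2 w u2 + int n))"
    by (simp add: divide_simps)
  have "(\<zeta>1 ^ m * \<zeta>2 ^ n) ^ q
      = exp (2 * of_real pi * \<i> * of_real (real q * ((real m * det2 w u2 + real n) / det2 u1 u2)))"
    unfolding zeta_power exp_of_nat_mult[symmetric] by (simp add: mult_ac)
  also have "\<dots> = 1"
    unfolding * by (rule exp_2pi_of_int)
  finally show ?thesis .
qed

lemma zeta_q: "\<zeta>1 ^ q = 1" "\<zeta>2 ^ q = 1" and norm_zeta: "norm \<zeta>1 = 1" "norm \<zeta>2 = 1"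
  using zeta_power_q[of 1 0] zeta_power_q[of 0 1] by (simp_all add: \<zeta>1_def \<zeta>2_def)

text \<open>The left side says that \<open>det2 u1 u2\<close> divides
  \<open>m * det2 w u2 + n\<close>. If \<open>x\<close> pairs to \<open>m\<close> with
  \<open>u1\<close> and to \<open>n\<close> with \<open>u2\<close>, then expanding \<open>u2\<close>
  in the basis \<open>u1\<close>, \<open>w\<close> shows that the quotient is the pairing of
  \<open>x\<close> with \<open>w\<close>.\<close>

lemma zeta_power_eq_1_iff:
  "\<zeta>1 ^ m * \<zeta>2 ^ n = 1 \<longleftrightarrow> (\<exists>x. rvec x \<bullet> rvec u1 = real m \<and> rvec x \<bullet> rvec u2 = real n)"
proof
  assume "\<zeta>1 ^ m * \<zeta>2 ^ n = 1"
  then obtain k :: int where "2 * pi * ((real m * det2 w u2 + real n) / det2 u1 u2) = of_int (2 * k) * pi"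
    unfolding zeta_power exp_eq_1 by auto
  hence "2 * pi * ((real m * det2 w u2 + real n) / det2 u1 u2) = 2 * pi * of_int k"
    by simp
  hence "(real m * det2 w u2 + real n) / det2 u1 u2 = of_int k"
    by (subst (asm) mult_left_cancel) auto
  hence "real m * det2 w u2 + real n = of_int k * det2 u1 u2"
    using d by (simp add: divide_simps)
  hence "real_of_int (int m * det2 w u2 + int n) = of_int (k * det2 u1 u2)" by simp
  hence k: "int m * det2 w u2 + int n = k * det2 u1 u2"
    by (simp only: of_int_eq_iff)
  \<comment> \<open>The integer vector pairing to \<open>m\<close> with \<open>u1\<close> and to
    \<open>k\<close> with \<open>w\<close>; it is integral because
    \<open>det2 u1 w = 1\<close>.\<close>
  define x :: "int ^ 2" where "x = (\<chi> i. if i = 1 then int m * w $ 2 - k * u1 $ 2 else k * u1 $ 1 - int m * w $ 1)"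
  have x: "x $ 1 = int m * w $ 2 - k * u1 $ 2" "x $ 2 = k * u1 $ 1 - int m * w $ 1"
    by (simp_all add: x_def)
  have "x $ 1 * u1 $ 1 + x $ 2 * u1 $ 2 = int m"
    using w unfolding x det2_def by algebra
  moreover have "x $ 1 * u2 $ 1 + x $ 2 * u2 $ 2 = int n"
    using k unfolding x det2_def by algebra
  ultimately have "real_of_int (x $ 1 * u1 $ 1 + x $ 2 * u1 $ 2) = real m" "real_of_int (x $ 1 * u2 $ 1 + x $ 2 * u2 $ 2) = real n"
    by simp_all
  thus "\<exists>x. rvec x \<bullet> rvec u1 = real m \<and> rvec x \<bullet> rvec u2 = real n"
    by (intro exI[of _ x]) (simp add: rvec_inner)
next
  assume "\<exists>x. rvec x \<bullet> rvec u1 = real m \<and> rvec x \<bullet> rvec u2 = real n"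
  then obtain x :: "int ^ 2" where "real_of_int (x $ 1 * u1 $ 1 + x $ 2 * u1 $ 2) = of_int (int m)"
    "real_of_int (x $ 1 * u2 $ 1 + x $ 2 * u2 $ 2) = of_int (int n)"
    by (auto simp: rvec_inner)
  hence x: "x $ 1 * u1 $ 1 + x $ 2 * u1 $ 2 = int m" "x $ 1 * u2 $ 1 + x $ 2 * u2 $ 2 = int n"
    by (simp_all only: of_int_eq_iff)
  have "int m * det2 w u2 + int n = det2 u1 u2 * (x $ 1 * w $ 1 + x $ 2 * w $ 2)"
    using w unfolding x[symmetric] det2_def by algebra
  hence "real_of_int (int m * det2 w u2 + int n) = of_int (det2 u1 u2 * (x $ 1 * w $ 1 + x $ 2 * w $ 2))"
    by simp
  hence "(real m * det2 w u2 + real n) / det2 u1 u2 = of_int (x $ 1 * w $ 1 + x $ 2 * w $ 2)"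
    using d by (simp add: divide_simps)
  thus "\<zeta>1 ^ m * \<zeta>2 ^ n = 1"
    unfolding zeta_power by (simp only: exp_2pi_of_int)
qed

text \<open>A geometric sum over the powers of \<open>\<zeta>1 ^ m * \<zeta>2 ^ n\<close>, whose
  \<open>q\<close>-th power is 1: it vanishes unless this number is itself 1.\<close>

lemma character_sum:
  "(\<Sum>j<q. (\<zeta>1 ^ j) ^ m * (\<zeta>2 ^ j) ^ n)
     = (if \<exists>x. rvec x \<bullet> rvec u1 = real m \<and> rvec x \<bullet> rvec u2 = real n then of_nat q else 0)"
proof -
  have "(\<Sum>j<q. (\<zeta>1 ^ j) ^ m * (\<zeta>2 ^ j) ^ n) = (\<Sum>j<q. (\<zeta>1 ^ m * \<zeta>2 ^ n) ^ j)"
    by (simp add: power_mult_distrib mult.commute flip: power_mult)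
  also have "\<dots> = (if \<zeta>1 ^ m * \<zeta>2 ^ n = 1 then of_nat q else 0)"
    using zeta_power_q[of m n] by (simp add: sum_gp_strict)
  finally show ?thesis unfolding zeta_power_eq_1_iff .
qed

text \<open>The substitution of \<open>- \<gamma>\<close> for \<open>\<gamma>\<close>, that is
  \<open>j\<close> by \<open>q - j\<close>. The index 0 is its own inverse and has to be treated
  apart, \<open>q\<close> lying outside the range.\<close>

lemma sum_reflect:
  fixes F :: "complex \<Rightarrow> complex \<Rightarrow> complex"
  shows "(\<Sum>j<q. F (inverse (\<zeta>1 ^ j)) (inverse (\<zeta>2 ^ j))) = (\<Sum>j<q. F (\<zeta>1 ^ j) (\<zeta>2 ^ j))"
proof -
  let ?r = "\<lambda>j. if j = 0 then 0 else q - j"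
  have inv: "inverse (z ^ j) = z ^ ?r j" if "j < q" "z ^ q = 1" for z :: complex and j
  proof (cases "j = 0")
    case False
    have "z ^ j * z ^ (q - j) = 1"
      using that by (simp flip: power_add)
    thus ?thesis using False by (simp add: inverse_unique)
  qed simp
  show ?thesis
    by (rule sum.reindex_bij_witness[of _ ?r ?r]) (auto simp: inv zeta_q q_pos)
qed

text \<open>Inserting \<open>Todd = half_Todd + X / 2\<close> in both factors gives four parts.
  Reflection makes \<open>P\<close> even, and makes the single sums \<open>Q1\<close> and
  \<open>Q2\<close> even in their own variable; multiplied by the other variable they have odd total
  degree, and the even part discards them. The fourth part is \<open>q / 4\<close> at
  \<open>a = b = 1\<close>, and subtracting \<open>q / 2\<close> leaves
  \<open>- q / 4\<close>.\<close>

lemma EM_symbol_eq: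
  "EM_symbol u1 u2 a b = (\<Sum>j<q. fps_nth (half_Todd (\<zeta>1 ^ j)) a * fps_nth (half_Todd (\<zeta>2 ^ j)) b)
       - (if a = 1 \<and> b = 1 then of_nat q / 4 else 0)"
proof -
  have nz: "\<zeta>1 \<noteq> 0" "\<zeta>2 \<noteq> 0" by (simp_all add: \<zeta>1_def \<zeta>2_def)
  let ?e1 = "\<lambda>j. fps_nth (half_Todd (\<zeta>1 ^ j)) a" and ?e2 = "\<lambda>j. fps_nth (half_Todd (\<zeta>2 ^ j)) b"
  define P where "P = (\<Sum>j<q. ?e1 j * ?e2 j)"
  define Q1 where "Q1 = (\<Sum>j<q. ?e1 j)"
  define Q2 where "Q2 = (\<Sum>j<q. ?e2 j)"
  have P: "(- 1) ^ (a + b) * P = P"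
    using sum_reflect[of "\<lambda>x y. fps_nth (half_Todd x) a * fps_nth (half_Todd y) b"]
    by (simp add: half_Todd_inverse nz P_def sum_distrib_left power_add mult_ac)
  have Q1: "(- 1) ^ a * Q1 = Q1"
    using sum_reflect[of "\<lambda>x y. fps_nth (half_Todd x) a"]
    by (simp add: half_Todd_inverse nz Q1_def sum_distrib_left)
  have Q2: "(- 1) ^ b * Q2 = Q2"
    using sum_reflect[of "\<lambda>x y. fps_nth (half_Todd y) b"]
    by (simp add: half_Todd_inverse nz Q2_def sum_distrib_left)
  have T: "fps_nth (Todd l) k = fps_nth (half_Todd l) k + (if k = 1 then 1 / 2 else 0)" for l k
    by (simp add: half_Todd_nth)
  have cone: "Todd_cone u1 u2 a b = P + (if b = 1 then Q1 / 2 else 0) + (if a = 1 then Q2 / 2 else 0)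
       + (if a = 1 \<and> b = 1 then of_nat q / 4 else 0)"
  proof -
    have "Todd_cone u1 u2 a b = (\<Sum>j<q. fps_nth (Todd (\<zeta>1 ^ j)) a * fps_nth (Todd (\<zeta>2 ^ j)) b)"
      unfolding Todd_cone_def by (rule sum_Gamma)
    also have "\<dots> = (\<Sum>j<q. ?e1 j * ?e2 j + (if b = 1 then ?e1 j / 2 else 0) + (if a = 1 then ?e2 j / 2 else 0)
       + (if a = 1 \<and> b = 1 then 1 / 4 else 0))"
      by (intro sum.cong refl) (simp add: T algebra_simps)
    also have "\<dots> = P + (\<Sum>j<q. if b = 1 then ?e1 j / 2 else 0) + (\<Sum>j<q. if a = 1 then ?e2 j / 2 else 0)
       + (\<Sum>j<q. if a = 1 \<and> b = 1 then 1 / 4 else 0)"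
      by (simp only: sum.distrib P_def)
    finally show ?thesis
      by (auto simp: Q1_def Q2_def sum_divide_distrib)
  qed
  have Q1': "Q1 = 0" if "odd a" using Q1 that by simp
  have Q2': "Q2 = 0" if "odd b" using Q2 that by simp
  have P': "P = 0" if "odd (a + b)" using P that by simp
  have "EM_symbol u1 u2 a b = P - (if a = 1 \<and> b = 1 then of_nat q / 4 else 0)"
  proof (cases "even (a + b)")
    case True
    hence "EM_symbol u1 u2 a b = Todd_cone u1 u2 a b - (if a = 1 \<and> b = 1 then of_nat q / 2 else 0)"
      by (simp add: EM_symbol_def Todd_even_def fps2_reflect_def card_Gamma)
    thus ?thesis
      using True Q1' Q2' unfolding cone by auto
  next
    case False
    thus ?thesis
      using P' by (auto simp: EM_symbol_def Todd_even_def fps2_reflect_def)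
  qed
  thus ?thesis by (simp add: P_def)
qed

end

section \<open>Directional derivatives\<close>

definition dir_deriv :: "real ^ 2 \<Rightarrow> (real ^ 2 \<Rightarrow> complex) \<Rightarrow> real ^ 2 \<Rightarrow> complex" where
  "dir_deriv v F x = v $ 1 *\<^sub>R partial 1 F x + v $ 2 *\<^sub>R partial 2 F x"

lemma has_derivative_imp_has_vector_derivative_line:
  fixes F :: "real ^ 2 \<Rightarrow> complex"
  assumes "(F has_derivative F') (at (x + s *\<^sub>R v))"
  shows "((\<lambda>s. F (x + s *\<^sub>R v)) has_vector_derivative F' v) (at s)"
proof -
  have "((\<lambda>s. x + s *\<^sub>R v) has_derivative (\<lambda>h. h *\<^sub>R v)) (at s)"
    by (auto intro!: derivative_eq_intros)
  from diff_chain_at[OF this assms]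
  have "((\<lambda>s. F (x + s *\<^sub>R v)) has_derivative (\<lambda>h. F' (h *\<^sub>R v))) (at s)"
    by (simp add: o_def)
  moreover have "F' (h *\<^sub>R v) = h *\<^sub>R F' v" for h
    by (rule linear_cmul[OF has_derivative_linear[OF assms]])
  ultimately show ?thesis
    by (simp add: has_vector_derivative_def)
qed

lemma partial_eq:
  assumes "(F has_derivative F') (at x)"
  shows "partial i F x = F' (axis i 1)"
  unfolding partial_def
  by (rule vector_derivative_at, rule has_derivative_imp_has_vector_derivative_line) (use assms in simp)

lemma dir_deriv_has_vector_derivative:
  assumes "F differentiable (at (x + s *\<^sub>R v))"
  shows "((\<lambda>s. F (x + s *\<^sub>R v)) has_vector_derivative dir_deriv v F (x + s *\<^sub>R v)) (at s)"
proof -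
  obtain F' where F': "(F has_derivative F') (at (x + s *\<^sub>R v))"
    using assms by (auto simp: differentiable_def)
  have lin: "linear F'" by (rule has_derivative_linear[OF F'])
  have "v = v $ 1 *\<^sub>R axis 1 1 + v $ 2 *\<^sub>R axis 2 1"
    by (simp add: vec_eq_iff forall_2 axis_def)
  hence "F' v = F' (v $ 1 *\<^sub>R axis 1 1 + v $ 2 *\<^sub>R axis 2 1)" by simp
  also have "\<dots> = dir_deriv v F (x + s *\<^sub>R v)"
    by (simp add: dir_deriv_def partial_eq[OF F'] linear_add[OF lin] linear_cmul[OF lin])
  finally show ?thesis
    using has_derivative_imp_has_vector_derivative_line[OF F'] by simp
qed

lemma partial_lincomb:
  assumes "G1 differentiable (at x)" "G2 differentiable (at x)"
  shows "partial i (\<lambda>x. c1 *\<^sub>R G1 x + c2 *\<^sub>R G2 x) x = c1 *\<^sub>R partial i G1 x + c2 *\<^sub>R partial i G2 x"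
proof -
  obtain D1 D2 where D: "(G1 has_derivative D1) (at x)" "(G2 has_derivative D2) (at x)"
    using assms by (auto simp: differentiable_def)
  have "((\<lambda>x. c1 *\<^sub>R G1 x + c2 *\<^sub>R G2 x) has_derivative (\<lambda>h. c1 *\<^sub>R D1 h + c2 *\<^sub>R D2 h)) (at x)"
    by (intro has_derivative_add has_derivative_scaleR_right D)
  from partial_eq[OF this] show ?thesis
    by (simp add: partial_eq[OF D(1)] partial_eq[OF D(2)])
qed

lemma foldr_partial_lincomb:
  assumes "smooth G1" "smooth G2"
  shows "foldr partial is (\<lambda>x. c1 *\<^sub>R G1 x + c2 *\<^sub>R G2 x)
       = (\<lambda>x. c1 *\<^sub>R foldr partial is G1 x + c2 *\<^sub>R foldr partial is G2 x)"
proof (induction "is")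
  case (Cons i "is")
  show ?case
    using assms by (auto simp: Cons.IH smooth_def intro!: partial_lincomb)
qed simp

lemma smooth_partial: "smooth F \<Longrightarrow> smooth (partial i F)"
  unfolding smooth_def
proof (intro allI)
  fix "is" x assume "\<forall>is x. foldr partial is F differentiable at x"
  hence "foldr partial (is @ [i]) F differentiable at x" by blast
  thus "foldr partial is (partial i F) differentiable at x" by simp
qed

text \<open>\<open>foldr\<close> applies the last entry of the list first, so the derivative inside
  \<open>dir_deriv\<close> is appended at the end. Smoothness, integrability and decay, all stated
  for lists of coordinates, are inherited through this formula.\<close>

lemma foldr_partial_dir_deriv:
  assumes "smooth F"
  shows "foldr partial is (dir_deriv v F)
       = (\<lambda>x. v $ 1 *\<^sub>R foldr partial (is @ [1]) F x + v $ 2 *\<^sub>R foldr partial (is @ [2]) F x)"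
  using foldr_partial_lincomb[OF smooth_partial smooth_partial, OF assms assms, of "is" "v $ 1" 1 "v $ 2" 2]
  by (simp add: dir_deriv_def[abs_def])

lemma smooth_dir_deriv: "smooth F \<Longrightarrow> smooth (dir_deriv v F)"
  unfolding smooth_def[of "dir_deriv v F"]
  by (auto simp: foldr_partial_dir_deriv smooth_def simp del: foldr_append)

lemma smooth_integrable_on_dir_deriv:
  assumes "smooth F" "smooth_integrable_on F S"
  shows "smooth_integrable_on (dir_deriv v F) S"
  unfolding smooth_integrable_on_def foldr_partial_dir_deriv[OF assms(1)]
proof
  fix "is" :: "2 list"
  have "set_integrable lborel S (foldr partial (is @ [i]) F)" for i
    using assms(2) unfolding smooth_integrable_on_def by blast
  thus "set_integrable lborel S (\<lambda>x. v $ 1 *\<^sub>R foldr partial (is @ [1]) F x + v $ 2 *\<^sub>R foldr partial (is @ [2]) F x)"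
    by (intro set_integral_add(1) set_integrable_scaleR_right)
qed

lemma rapidly_decaying_on_dir_deriv:
  assumes "smooth F" "rapidly_decaying_on F S"
  shows "rapidly_decaying_on (dir_deriv v F) S"
  unfolding rapidly_decaying_on_def foldr_partial_dir_deriv[OF assms(1)]
proof (intro allI)
  fix "is" :: "2 list" and n
  have *: "((\<lambda>x. norm x ^ n *\<^sub>R foldr partial (is @ [i]) F x) \<longlongrightarrow> 0) (inf at_infinity (principal S))" for i
    using assms(2) unfolding rapidly_decaying_on_def by blast
  have "((\<lambda>x. v $ 1 *\<^sub>R (norm x ^ n *\<^sub>R foldr partial (is @ [1]) F x) + v $ 2 *\<^sub>R (norm x ^ n *\<^sub>R foldr partial (is @ [2]) F x))
      \<longlongrightarrow> v $ 1 *\<^sub>R 0 + v $ 2 *\<^sub>R 0) (inf at_infinity (principal S))"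
    by (intro tendsto_intros *)
  thus "((\<lambda>x. norm x ^ n *\<^sub>R (v $ 1 *\<^sub>R foldr partial (is @ [1]) F x + v $ 2 *\<^sub>R foldr partial (is @ [2]) F x))
      \<longlongrightarrow> 0) (inf at_infinity (principal S))"
    by (simp add: scaleR_add_right mult.commute del: foldr_append)
qed

lemma smooth_imp_differentiable: "smooth F \<Longrightarrow> F differentiable (at x)"
  unfolding smooth_def by (metis foldr_Nil id_apply)

lemma smooth_imp_continuous_on: "smooth F \<Longrightarrow> continuous_on UNIV F"
  by (intro continuous_at_imp_continuous_on) (auto intro: differentiable_imp_continuous_within smooth_imp_differentiable)

text \<open>The exponent 4 is what \<open>quadrant_bound\<close> spends: two powers for each
  coordinate.\<close>

lemma rapidly_decaying_bound:
  assumes "smooth F" "rapidly_decaying_on F S"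
  shows "\<exists>A. \<forall>x\<in>S. norm (F x) * (1 + norm x) ^ 4 \<le> A"
proof -
  have "((\<lambda>x. norm x ^ 4 *\<^sub>R foldr partial [] F x) \<longlongrightarrow> 0) (inf at_infinity (principal S))"
    using assms(2) unfolding rapidly_decaying_on_def by blast
  hence "\<forall>\<^sub>F x in inf at_infinity (principal S). dist (norm x ^ 4 *\<^sub>R F x) 0 < 1"
    by (auto dest: tendstoD[where e = 1])
  then obtain b where b: "\<And>x. b \<le> norm x \<Longrightarrow> x \<in> S \<Longrightarrow> norm (norm x ^ 4 *\<^sub>R F x) < 1"
    unfolding eventually_inf_principal eventually_at_infinity by auto
  define r where "r = max b 1"
  have "compact (F ` cball 0 r)"
    by (intro compact_continuous_image continuous_on_subset[OF smooth_imp_continuous_on[OF assms(1)]]) auto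
  hence "bounded (F ` cball 0 r)"
    by (rule compact_imp_bounded)
  then obtain B where "\<forall>y\<in>F ` cball 0 r. norm y \<le> B"
    unfolding bounded_iff by (elim exE)
  hence B: "norm (F x) \<le> B" if "x \<in> cball 0 r" for x
    using that by (rule bspec[OF _ imageI])
  have "0 \<in> cball (0 :: real ^ 2) r"
    by (simp add: r_def)
  hence B0: "0 \<le> B"
    by (rule order_trans[OF norm_ge_zero B])
  show ?thesis
  \<comment> \<open>Inside the ball of radius \<open>r\<close> compactness gives the bound. Outside,
    \<open>norm x \<ge> 1\<close> yields \<open>1 + norm x \<le> 2 * norm x\<close>, and 16 is the
    fourth power of 2.\<close>
  proof (intro exI[of _ "max 16 (B * (1 + r) ^ 4)"] ballI)
    fix x assume x: "x \<in> S"
    show "norm (F x) * (1 + norm x) ^ 4 \<le> max 16 (B * (1 + r) ^ 4)"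
    proof (cases "norm x \<le> r")
      case True
      hence "norm (F x) * (1 + norm x) ^ 4 \<le> B * (1 + r) ^ 4"
        using B0 by (intro mult_mono B power_mono) auto
      thus ?thesis by simp
    next
      case False
      hence n: "b \<le> norm x" "1 \<le> norm x" by (auto simp: r_def)
      have "norm (F x) * (1 + norm x) ^ 4 \<le> norm (F x) * (2 * norm x) ^ 4"
        using n by (intro mult_left_mono power_mono) auto
      also have "\<dots> = 16 * norm (norm x ^ 4 *\<^sub>R F x)"
      proof -
        have "(2 * norm x) ^ 4 = 16 * norm x ^ 4"
          by (subst power_mult_distrib) simp
        moreover have "norm (norm x ^ 4 *\<^sub>R F x) = norm x ^ 4 * norm (F x)"
          by simp
        ultimately show ?thesis
          by (simp only: mult_ac)
      qed
      also have "\<dots> \<le> 16 * 1"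
        using b[OF n(1) x] by (intro mult_left_mono) auto
      finally show ?thesis by simp
    qed
  qed
qed

section \<open>The lattice sum over the cone\<close>

text \<open>A biduality argument. The coordinates of \<open>x\<close> with respect to
  \<open>v1\<close>, \<open>v2\<close> are its pairings with their dual basis; those basis vectors
  lie in the dual cone, hence are nonnegative combinations of \<open>u1\<close> and
  \<open>u2\<close>, on which \<open>x\<close> is nonnegative.\<close>

lemma cone_set_eq_halfplanes:
  assumes v: "lattice_cone v1 v2" and u: "is_dual_cone v1 v2 u1 u2"
  shows "cone_set v1 v2 = {x. 0 \<le> x \<bullet> rvec u1 \<and> 0 \<le> x \<bullet> rvec u2}"
proof (intro equalityI subsetI)
  have dual: "dual_cone (cone_set v1 v2) = cone_set u1 u2 - {0}"
    using u by (simp add: is_dual_cone_def)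
  have "primitive u1" "primitive u2" using u by (auto simp: is_dual_cone_def lattice_cone_def)
  hence nz: "rvec u1 \<noteq> 0" "rvec u2 \<noteq> 0"
    by (auto simp: primitive_def vec_eq_iff forall_2)
  have "rvec u1 \<in> cone_set u1 u2" "rvec u2 \<in> cone_set u1 u2"
  proof -
    have "x1 *\<^sub>R rvec u1 + x2 *\<^sub>R rvec u2 \<in> cone_set u1 u2" if "0 \<le> x1" "0 \<le> x2" for x1 x2
      using that unfolding cone_set_def by blast
    from this[of 1 0] this[of 0 1] show "rvec u1 \<in> cone_set u1 u2" "rvec u2 \<in> cone_set u1 u2"
      by simp_all
  qed
  hence in_dual: "rvec u1 \<in> dual_cone (cone_set v1 v2)" "rvec u2 \<in> dual_cone (cone_set v1 v2)"
    using dual nz by auto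
  {
    fix x assume "x \<in> cone_set v1 v2"
    thus "x \<in> {x. 0 \<le> x \<bullet> rvec u1 \<and> 0 \<le> x \<bullet> rvec u2}"
      using in_dual by (auto simp: dual_cone_def inner_commute)
  }
  fix x assume x: "x \<in> {x. 0 \<le> x \<bullet> rvec u1 \<and> 0 \<le> x \<bullet> rvec u2}"
  have d: "det2 v1 v2 \<noteq> 0" by (rule lattice_cone_det2[OF v])
  note pair = dual_pairing[OF d]
  have "x \<bullet> w \<ge> 0" if w: "w \<bullet> rvec v1 \<ge> 0" "w \<bullet> rvec v2 \<ge> 0" "w \<noteq> 0" for w
  proof -
    have "w \<in> dual_cone (cone_set v1 v2)"
      using w unfolding dual_cone_def cone_set_def by (auto simp: inner_add_right)
    hence "w \<in> cone_set u1 u2" using dual by auto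
    thus ?thesis
      using x by (auto simp: cone_set_def inner_add_right)
  qed
  moreover have "dual_vec1 v1 v2 \<noteq> 0" "dual_vec2 v1 v2 \<noteq> 0"
    using pair by auto
  ultimately have "0 \<le> x \<bullet> dual_vec1 v1 v2" "0 \<le> x \<bullet> dual_vec2 v1 v2"
    using pair by (simp_all add: inner_commute[of "dual_vec1 v1 v2"] inner_commute[of "dual_vec2 v1 v2"])
  thus "x \<in> cone_set v1 v2"
    unfolding cone_set_def using dual_basis_expansion(1)[OF d, of x] by blast
qed

lemma wt_quadrant:
  assumes "a \<noteq> 0" "b \<noteq> 0" and x: "0 \<le> x \<bullet> a" "0 \<le> x \<bullet> b"
  shows "wt {x. 0 \<le> x \<bullet> a \<and> 0 \<le> x \<bullet> b} x = (if 0 < x \<bullet> a \<and> 0 < x \<bullet> b then 1 else if x \<noteq> 0 then 1 / 2 else 0)"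
proof -
  let ?S = "{x. 0 \<le> x \<bullet> a \<and> 0 \<le> x \<bullet> b}"
  have eq: "?S = {x. a \<bullet> x \<ge> 0} \<inter> {x. b \<bullet> x \<ge> 0}"
    by (auto simp: inner_commute)
  have int: "interior ?S = {x. 0 < x \<bullet> a \<and> 0 < x \<bullet> b}"
    unfolding eq interior_Int interior_halfspace_ge[OF assms(1)] interior_halfspace_ge[OF assms(2)]
    by (auto simp: inner_commute)
  have "closed ?S"
    unfolding eq by (intro closed_Int closed_halfspace_ge)
  hence fr: "frontier ?S = ?S - interior ?S"
    by (simp add: frontier_def)
  show ?thesis
    unfolding wt_def fr int using x by auto
qed

text \<open>Links the unordered sum over lattice points with the iterated series of the
  Euler-Maclaurin formula: a product majorant gives absolute summability.\<close>

lemma has_sum_product_bound: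
  fixes F :: "nat \<Rightarrow> nat \<Rightarrow> complex" and p :: "nat \<Rightarrow> real"
  assumes p: "summable p" "\<And>n. 0 \<le> p n" and F: "\<And>m n. norm (F m n) \<le> K * p m * p n"
  shows "((\<lambda>(m, n). F m n) has_sum (\<Sum>m. \<Sum>n. F m n)) UNIV"
proof -
  have sp: "(p has_sum suminf p) UNIV"
    using p by (intro norm_summable_imp_has_sum) (auto simp: summable_sums)
  have "(\<lambda>(m, n). K * p m * p n) summable_on (UNIV \<times> UNIV)"
  proof -
    have "(\<lambda>(m, n). p m * p n) summable_on (UNIV \<times> UNIV)"
    proof (rule summable_on_SigmaI)
      show "((\<lambda>n. case (m, n) of (m, n) \<Rightarrow> p m * p n) has_sum (p m * suminf p)) UNIV" for m
        using has_sum_cmult_right[OF sp, of "p m"] by simp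
      show "(\<lambda>m. p m * suminf p) summable_on UNIV"
        using has_sum_cmult_left[OF sp] has_sum_imp_summable by blast
    qed (use p in auto)
    from summable_on_cmult_right[OF this, of K] show ?thesis
      by (simp add: case_prod_unfold mult.assoc)
  qed
  from Infinite_Sum.abs_summable_on_comparison_test'[OF this, of "\<lambda>(m, n). F m n"] F
  have "(\<lambda>z. norm (case z of (m, n) \<Rightarrow> F m n)) summable_on (UNIV \<times> UNIV)"
    by (auto simp: case_prod_unfold)
  hence s: "(\<lambda>(m, n). F m n) summable_on (UNIV \<times> UNIV)"
    by (rule abs_summable_summable)
  have suminf: "infsum h UNIV = suminf h" if "h summable_on UNIV" for h :: "nat \<Rightarrow> complex"
    using has_sum_imp_sums[OF has_sum_infsum[OF that]] by (simp add: sums_iff)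
  have "infsum (\<lambda>(m, n). F m n) (UNIV \<times> UNIV) = (\<Sum>\<^sub>\<infinity>m. \<Sum>\<^sub>\<infinity>n. F m n)"
    by (rule infsum_Sigma'_banach[OF s, symmetric])
  also have "\<dots> = (\<Sum>\<^sub>\<infinity>m. \<Sum>n. F m n)"
    by (intro infsum_cong suminf summable_on_SigmaD1[OF s]) auto
  also have "\<dots> = (\<Sum>m. \<Sum>n. F m n)"
  proof (rule suminf)
    have "(\<lambda>m. \<Sum>\<^sub>\<infinity>n. F m n) summable_on UNIV"
      by (rule summable_on_Sigma_banach[OF s])
    moreover have "(\<Sum>\<^sub>\<infinity>n. F m n) = (\<Sum>n. F m n)" for m
      by (intro suminf summable_on_SigmaD1[OF s]) auto
    ultimately show "(\<lambda>m. \<Sum>n. F m n) summable_on UNIV" by simp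
  qed
  finally show ?thesis
    using has_sum_infsum[OF s] by simp
qed

lemma has_sum_finite_sum:
  fixes f :: "'i \<Rightarrow> 'a \<Rightarrow> complex"
  assumes "finite J" "\<And>j. j \<in> J \<Longrightarrow> (f j has_sum s j) A"
  shows "((\<lambda>x. \<Sum>j\<in>J. f j x) has_sum (\<Sum>j\<in>J. s j)) A"
  using assms by (induction J rule: finite_induct) (auto intro: has_sum_add)

context complemented_pair
begin

abbreviation "\<alpha>1 \<equiv> dual_vec1 u1 u2"
abbreviation "\<alpha>2 \<equiv> dual_vec2 u1 u2"

lemma dual_comb_inner:
  "(y *\<^sub>R \<alpha>1 + z *\<^sub>R \<alpha>2) \<bullet> rvec u1 = y" "(y *\<^sub>R \<alpha>1 + z *\<^sub>R \<alpha>2) \<bullet> rvec u2 = z"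
  using dual_pairing[OF d] by (simp_all add: inner_add_left inner_commute[of \<alpha>1] inner_commute[of \<alpha>2])

lemma rvec_u_nonzero: "rvec u1 \<noteq> 0" "rvec u2 \<noteq> 0"
  using dual_pairing[OF d] by auto

lemma lattice_points_bij:
  "bij_betw (\<lambda>(m, n). real m *\<^sub>R \<alpha>1 + real n *\<^sub>R \<alpha>2)
     {(m, n). \<exists>x. rvec x \<bullet> rvec u1 = real m \<and> rvec x \<bullet> rvec u2 = real n}
     ({x. 0 \<le> x \<bullet> rvec u1 \<and> 0 \<le> x \<bullet> rvec u2} \<inter> range rvec)"
  (is "bij_betw ?X ?B ?S")
  unfolding bij_betw_def
proof
  show "inj_on ?X ?B"
  proof (rule inj_onI, clarify)
    fix m n m' n' :: nat
    assume eq: "real m *\<^sub>R \<alpha>1 + real n *\<^sub>R \<alpha>2 = real m' *\<^sub>R \<alpha>1 + real n' *\<^sub>R \<alpha>2"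
    have "real m = real m'" "real n = real n'"
      using arg_cong[OF eq, of "\<lambda>v. v \<bullet> rvec u1"] arg_cong[OF eq, of "\<lambda>v. v \<bullet> rvec u2"]
      unfolding dual_comb_inner .
    thus "m = m' \<and> n = n'" by simp
  qed
  show "?X ` ?B = ?S"
  proof (intro equalityI subsetI)
    fix y assume "y \<in> ?X ` ?B"
    then obtain m n x where y: "y = real m *\<^sub>R \<alpha>1 + real n *\<^sub>R \<alpha>2"
      and x: "rvec x \<bullet> rvec u1 = real m" "rvec x \<bullet> rvec u2 = real n" by auto
    have "y = rvec x"
      using dual_basis_expansion(2)[OF d, of "rvec x"] unfolding y x by simp
    thus "y \<in> ?S" using x by simp
  next
    fix y assume "y \<in> ?S"
    then obtain x where y: "y = rvec x" "0 \<le> rvec x \<bullet> rvec u1" "0 \<le> rvec x \<bullet> rvec u2" by auto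
    have pairing: "rvec x \<bullet> rvec u = of_int (x $ 1 * u $ 1 + x $ 2 * u $ 2)" for u
      by (simp add: rvec_inner)
    define m where "m = nat (x $ 1 * u1 $ 1 + x $ 2 * u1 $ 2)"
    define n where "n = nat (x $ 1 * u2 $ 1 + x $ 2 * u2 $ 2)"
    have mn: "rvec x \<bullet> rvec u1 = real m" "rvec x \<bullet> rvec u2 = real n"
      using y(2,3) unfolding pairing m_def n_def of_int_0_le_iff by (simp_all only: of_nat_nat)
    have "y = ?X (m, n)"
      using dual_basis_expansion(2)[OF d, of "rvec x"] unfolding y(1) mn by simp
    moreover have "(m, n) \<in> ?B" using mn by blast
    ultimately show "y \<in> ?X ` ?B" by (rule image_eqI)
  qed
qed

lemma wt_lattice_point:
  "of_real (wt {x. 0 \<le> x \<bullet> rvec u1 \<and> 0 \<le> x \<bullet> rvec u2} (real m *\<^sub>R \<alpha>1 + real n *\<^sub>R \<alpha>2))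
     = half_weight m * half_weight n - (if m = 0 \<and> n = 0 then 1 / 4 else 0)"
proof -
  have "real m *\<^sub>R \<alpha>1 + real n *\<^sub>R \<alpha>2 = 0 \<longleftrightarrow> m = 0 \<and> n = 0"
  proof
    assume "real m *\<^sub>R \<alpha>1 + real n *\<^sub>R \<alpha>2 = 0"
    note dual_comb_inner[of "real m" "real n", unfolded this]
    thus "m = 0 \<and> n = 0" by simp
  qed simp
  thus ?thesis
    by (subst wt_quadrant[OF rvec_u_nonzero]) (auto simp: dual_comb_inner half_weight_def)
qed

lemma lattice_sum_eq:
  fixes f :: "real ^ 2 \<Rightarrow> complex" and A t :: real
  defines "g0 \<equiv> (\<lambda>y z. f (y *\<^sub>R \<alpha>1 + z *\<^sub>R \<alpha>2))" and "S \<equiv> {x. 0 \<le> x \<bullet> rvec u1 \<and> 0 \<le> x \<bullet> rvec u2}"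
  assumes bnd: "\<And>y z. 0 \<le> y \<Longrightarrow> 0 \<le> z \<Longrightarrow> norm (g0 y z) \<le> A / ((1 + y) ^ 2 * (1 + z) ^ 2)"
    and t: "0 < t" "t \<le> 1"
  shows "(\<Sum>\<^sub>\<infinity>x\<in>S \<inter> range rvec. of_real (wt S x) * f (t *\<^sub>R x)) =
     1 / of_nat q * (\<Sum>j<q. \<Sum>m. \<Sum>n. half_weight m * half_weight n * (\<zeta>1 ^ j) ^ m * (\<zeta>2 ^ j) ^ n
         * g0 (t * real m) (t * real n)) - g0 0 0 / 4"
proof -
  let ?X = "\<lambda>(m, n). real m *\<^sub>R \<alpha>1 + real n *\<^sub>R \<alpha>2"
  define B where "B = {(m, n). \<exists>x. rvec x \<bullet> rvec u1 = real m \<and> rvec x \<bullet> rvec u2 = real n}"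
  define T where "T j m n = half_weight m * half_weight n * (\<zeta>1 ^ j) ^ m * (\<zeta>2 ^ j) ^ n * g0 (t * real m) (t * real n)"
    for j m n
  \<comment> \<open>The summand extended to all pairs \<open>(m, n)\<close>. The character average
    removes pairs that come from no lattice point, and the last term lowers the product weight
    \<open>1 / 4\<close> of the origin to 0.\<close>
  define R where "R = (\<lambda>(m, n). 1 / of_nat q * (\<Sum>j<q. T j m n) + (if m = 0 \<and> n = 0 then - (g0 0 0 / 4) else 0))"
  note sum = sum_inverse_square_bound[OF t]
  have T: "((\<lambda>(m, n). T j m n) has_sum (\<Sum>m. \<Sum>n. T j m n)) UNIV" for j
  proof (rule has_sum_product_bound[OF sum(1), where K = A])
    show "norm (T j m n) \<le> A * (1 / (1 + t * real m) ^ 2) * (1 / (1 + t * real n) ^ 2)" for m n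
    proof -
      have "norm (T j m n) \<le> norm (g0 (t * real m) (t * real n))"
        by (simp add: T_def norm_mult norm_power norm_zeta half_weight_def)
      also have "\<dots> \<le> A / ((1 + t * real m) ^ 2 * (1 + t * real n) ^ 2)"
        using t by (intro bnd) auto
      finally show ?thesis by simp
    qed
  qed auto
  have "((\<lambda>p. \<Sum>j<q. case p of (m, n) \<Rightarrow> T j m n) has_sum (\<Sum>j<q. \<Sum>m. \<Sum>n. T j m n)) UNIV"
    by (intro has_sum_finite_sum T) auto
  hence "((\<lambda>p. 1 / of_nat q * (\<Sum>j<q. case p of (m, n) \<Rightarrow> T j m n))
      has_sum (1 / of_nat q * (\<Sum>j<q. \<Sum>m. \<Sum>n. T j m n))) UNIV"
    by (rule has_sum_cmult_right)
  moreover have "((\<lambda>(m, n). if m = 0 \<and> n = 0 then - (g0 0 0 / 4) else 0) has_sum - (g0 0 0 / 4)) (UNIV :: (nat \<times> nat) set)"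
    by (rule has_sum_finite_neutralI[of "{(0, 0)}"]) (auto split: if_splits)
  ultimately have "((\<lambda>p. 1 / of_nat q * (\<Sum>j<q. case p of (m, n) \<Rightarrow> T j m n)
         + (case p of (m, n) \<Rightarrow> if m = 0 \<and> n = 0 then - (g0 0 0 / 4) else 0))
       has_sum (1 / of_nat q * (\<Sum>j<q. \<Sum>m. \<Sum>n. T j m n) + - (g0 0 0 / 4))) UNIV"
    by (rule has_sum_add)
  hence R: "(R has_sum (1 / of_nat q * (\<Sum>j<q. \<Sum>m. \<Sum>n. T j m n) - g0 0 0 / 4)) UNIV"
    by (simp add: R_def case_prod_unfold)
  have sumT: "(\<Sum>j<q. T j m n) = (if (m, n) \<in> B then of_nat q else 0) * (half_weight m * half_weight n * g0 (t * real m) (t * real n))" for m n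
  proof -
    have "(\<Sum>j<q. T j m n) = (\<Sum>j<q. (\<zeta>1 ^ j) ^ m * (\<zeta>2 ^ j) ^ n) * (half_weight m * half_weight n * g0 (t * real m) (t * real n))"
      unfolding sum_distrib_right by (intro sum.cong refl) (simp add: T_def)
    thus ?thesis
      unfolding character_sum by (simp add: B_def)
  qed
  \<comment> \<open>Ensures that the correction at the origin does not spoil the vanishing of
    \<open>R\<close> outside \<open>B\<close>.\<close>
  have "(0, 0) \<in> B"
    unfolding B_def by (auto intro!: exI[of _ 0] simp: rvec_inner)
  hence outside: "R p = 0" if "p \<notin> B" for p
    using that by (cases p) (auto simp: R_def sumT)
  have inside: "of_real (wt S (?X p)) * f (t *\<^sub>R ?X p) = R p" if p: "p \<in> B" for p
  proof (cases p)
    case (Pair m n)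
    have "f (t *\<^sub>R ?X p) = g0 (t * real m) (t * real n)"
      by (simp add: Pair g0_def scaleR_add_right)
    moreover have "of_real (wt S (?X p)) = half_weight m * half_weight n - (if m = 0 \<and> n = 0 then 1 / 4 else 0 :: complex)"
      unfolding S_def Pair by (simp only: prod.case wt_lattice_point)
    moreover have "R p = half_weight m * half_weight n * g0 (t * real m) (t * real n)
        + (if m = 0 \<and> n = 0 then - (g0 0 0 / 4) else 0)"
      using p q_pos by (simp add: R_def Pair sumT)
    ultimately show ?thesis
      by (cases "m = 0 \<and> n = 0") (simp_all add: left_diff_distrib)
  qed
  have "((\<lambda>p. of_real (wt S (?X p)) * f (t *\<^sub>R ?X p)) has_sum (1 / of_nat q * (\<Sum>j<q. \<Sum>m. \<Sum>n. T j m n) - g0 0 0 / 4)) B"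
    using R by (subst has_sum_cong_neutral[where T = UNIV and g = R]) (auto simp: outside inside)
  hence "infsum (\<lambda>p. of_real (wt S (?X p)) * f (t *\<^sub>R ?X p)) B = 1 / of_nat q * (\<Sum>j<q. \<Sum>m. \<Sum>n. T j m n) - g0 0 0 / 4"
    by (rule infsumI)
  moreover have "infsum (\<lambda>p. of_real (wt S (?X p)) * f (t *\<^sub>R ?X p)) B
      = (\<Sum>\<^sub>\<infinity>x\<in>S \<inter> range rvec. of_real (wt S x) * f (t *\<^sub>R x))"
    unfolding B_def S_def by (rule infsum_reindex_bij_betw[OF lattice_points_bij])
  ultimately show ?thesis
    by (simp add: T_def)
qed

end

section \<open>Error estimates in powers of \<open>t\<close>\<close>

lemma smallo_from_scaled_bound:
  fixes L :: "real \<Rightarrow> complex" and c :: "nat \<Rightarrow> complex"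
  assumes bnd: "\<And>t. 0 < t \<Longrightarrow> t \<le> 1 \<Longrightarrow> norm (of_real t ^ 2 * L t - (\<Sum>k\<le>N. c k * of_real t ^ k)) \<le> C * t ^ Suc N"
  shows "(\<lambda>t. L t - (\<Sum>k\<le>N. c k * of_real t powi (int k - 2))) \<in> o[at_right 0](\<lambda>t. of_real t powi (int N - 2))"
proof (rule landau_o.smallI)
  fix e :: real assume e: "0 < e"
  have C: "0 \<le> C"
  proof -
    have "0 \<le> C * 1 ^ Suc N"
      by (rule order_trans[OF norm_ge_zero bnd[of 1]]) auto
    thus ?thesis by simp
  qed
  define r where "r = min 1 (e / (C + 1))"
  have r: "0 < r" using e C by (simp add: r_def)
  have pw: "of_real t powi (int k - 2) = of_real t ^ k / (of_real t ^ 2 :: complex)" if "0 < t" for t :: real and k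
    using that by (simp add: power_int_diff)
  have "norm (L t - (\<Sum>k\<le>N. c k * of_real t powi (int k - 2))) \<le> e * norm (of_real t powi (int N - 2) :: complex)"
    if t: "0 < t" "t < r" for t
  proof -
    have t1: "t \<le> 1" and tC: "C * t \<le> e"
    proof -
      show "t \<le> 1" using t by (simp add: r_def)
      have "t \<le> e / (C + 1)" using t by (simp add: r_def)
      hence "(C + 1) * t \<le> e" using C by (simp add: field_simps)
      thus "C * t \<le> e" using t by (simp add: algebra_simps)
    qed
    have "L t - (\<Sum>k\<le>N. c k * of_real t powi (int k - 2))
        = (of_real t ^ 2 * L t - (\<Sum>k\<le>N. c k * of_real t ^ k)) / of_real t ^ 2"
      using t by (simp add: pw diff_divide_distrib sum_divide_distrib)
    hence "norm (L t - (\<Sum>k\<le>N. c k * of_real t powi (int k - 2)))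
        = norm (of_real t ^ 2 * L t - (\<Sum>k\<le>N. c k * of_real t ^ k)) / t ^ 2"
      using t by (simp add: norm_divide norm_power)
    also have "\<dots> \<le> C * t ^ Suc N / t ^ 2"
      by (rule divide_right_mono[OF bnd[OF t(1) t1]]) simp
    also have "\<dots> = (C * t) * (t ^ N / t ^ 2)"
      by (simp only: power_Suc times_divide_eq_right mult.assoc)
    also have "\<dots> \<le> e * (t ^ N / t ^ 2)"
      using tC t by (intro mult_right_mono) auto
    also have "t ^ N / t ^ 2 = norm (of_real t powi (int N - 2) :: complex)"
      using t by (simp add: pw norm_divide norm_power)
    finally show ?thesis .
  qed
  thus "\<forall>\<^sub>F t in at_right 0. norm (L t - (\<Sum>k\<le>N. c k * of_real t powi (int k - 2))) \<le> e * norm (of_real t powi (int N - 2) :: complex)"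
    using r unfolding eventually_at_right_field by blast
qed

text \<open>Truncating the two symbols separately leaves all exponents \<open>a, b \<le> M\<close>,
  whereas the expansion is ordered by total degree. The surplus terms have degree above
  \<open>N\<close>, and \<open>t \<le> 1\<close> absorbs them into the error.\<close>

lemma norm_square_minus_triangle:
  fixes W :: "nat \<Rightarrow> nat \<Rightarrow> complex" and t :: real
  assumes t: "0 < t" "t \<le> 1" and M: "N \<le> M"
  shows "norm ((\<Sum>a\<le>M. \<Sum>b\<le>M. W a b * of_real t ^ (a + b)) - (\<Sum>k\<le>N. (\<Sum>a\<le>k. W a (k - a)) * of_real t ^ k))
       \<le> (\<Sum>a\<le>M. \<Sum>b\<le>M. norm (W a b)) * t ^ Suc N"
proof -
  let ?S = "{..M} \<times> {..M}" and ?D = "{(a, b). a + b \<le> N}"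
  let ?w = "\<lambda>(a, b). W a b * of_real t ^ (a + b)"
  have D: "?D \<subseteq> ?S" using M by auto
  have "(\<Sum>k\<le>N. (\<Sum>a\<le>k. W a (k - a)) * of_real t ^ k) = (\<Sum>k\<le>N. \<Sum>a\<le>k. W a (k - a) * of_real t ^ (a + (k - a)))"
    by (simp add: sum_distrib_right)
  also have "\<dots> = sum ?w ?D"
    by (rule sum.triangle_reindex_eq[symmetric])
  finally have tri: "(\<Sum>k\<le>N. (\<Sum>a\<le>k. W a (k - a)) * of_real t ^ k) = sum ?w ?D" .
  have sq: "(\<Sum>a\<le>M. \<Sum>b\<le>M. W a b * of_real t ^ (a + b)) = sum ?w ?S"
    by (rule sum.cartesian_product)
  have "sum ?w ?S - sum ?w ?D = sum ?w (?S - ?D)"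
    by (rule sum_diff[symmetric]) (use D in auto)
  also have "norm \<dots> \<le> (\<Sum>(a, b)\<in>?S - ?D. norm (W a b) * t ^ Suc N)"
  proof (rule sum_norm_le)
    fix p assume "p \<in> ?S - ?D"
    then obtain a b where p: "p = (a, b)" "Suc N \<le> a + b" by (cases p) auto
    have "t ^ (a + b) \<le> t ^ Suc N"
      using t p by (intro power_decreasing) auto
    thus "norm (?w p) \<le> (case p of (a, b) \<Rightarrow> norm (W a b) * t ^ Suc N)"
      using t by (simp add: p norm_mult norm_power mult_left_mono)
  qed
  also have "\<dots> \<le> (\<Sum>(a, b)\<in>?S. norm (W a b) * t ^ Suc N)"
    using t by (intro sum_mono2) auto
  also have "\<dots> = (\<Sum>a\<le>M. \<Sum>b\<le>M. norm (W a b)) * t ^ Suc N"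
    unfolding sum_distrib_right by (rule sum.cartesian_product[symmetric])
  finally show ?thesis
    unfolding tri sq .
qed

lemma quadrant_bound:
  fixes F :: "real ^ 2 \<Rightarrow> complex"
  assumes d: "det2 u1 u2 \<noteq> 0" and "smooth F"
    and "rapidly_decaying_on F {x. 0 \<le> x \<bullet> rvec u1 \<and> 0 \<le> x \<bullet> rvec u2}"
  shows "\<exists>A. \<forall>y z. 0 \<le> y \<longrightarrow> 0 \<le> z \<longrightarrow>
    norm (F (y *\<^sub>R dual_vec1 u1 u2 + z *\<^sub>R dual_vec2 u1 u2)) \<le> A / ((1 + y) ^ 2 * (1 + z) ^ 2)"
proof -
  obtain A where "\<forall>x\<in>{x. 0 \<le> x \<bullet> rvec u1 \<and> 0 \<le> x \<bullet> rvec u2}. norm (F x) * (1 + norm x) ^ 4 \<le> A"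
    using rapidly_decaying_bound[OF assms(2,3)] by (elim exE)
  hence A: "norm (F x) * (1 + norm x) ^ 4 \<le> A" if "0 \<le> x \<bullet> rvec u1" "0 \<le> x \<bullet> rvec u2" for x
    using that by blast
  \<comment> \<open>By Cauchy-Schwarz \<open>y\<close> and \<open>z\<close> are at most
    \<open>L * norm x\<close>. With \<open>L \<ge> 1\<close> this gives
    \<open>1 + y \<le> L * (1 + norm x)\<close>, and likewise for \<open>z\<close>.\<close>
  define L where "L = max 1 (max (norm (rvec u1)) (norm (rvec u2)))"
  have "norm (F (y *\<^sub>R dual_vec1 u1 u2 + z *\<^sub>R dual_vec2 u1 u2)) \<le> (A * L ^ 4) / ((1 + y) ^ 2 * (1 + z) ^ 2)"
    if y: "0 \<le> y" and z: "0 \<le> z" for y z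
  proof -
    define x where "x = y *\<^sub>R dual_vec1 u1 u2 + z *\<^sub>R dual_vec2 u1 u2"
    have x: "x \<bullet> rvec u1 = y" "x \<bullet> rvec u2 = z"
      using dual_pairing[OF d] unfolding x_def inner_commute[of _ "rvec u1"] inner_commute[of _ "rvec u2"]
      by (simp_all add: inner_add_right)
    have le: "1 + x \<bullet> v \<le> L * (1 + norm x)" if "norm v \<le> L" for v
    proof -
      have "x \<bullet> v \<le> norm x * norm v" by (rule norm_cauchy_schwarz)
      also have "\<dots> \<le> norm x * L" using that by (intro mult_left_mono) auto
      finally show ?thesis by (simp add: algebra_simps L_def)
    qed
    have "(1 + y) ^ 2 * (1 + z) ^ 2 \<le> (L * (1 + norm x)) ^ 2 * (L * (1 + norm x)) ^ 2"
      using le[of "rvec u1"] le[of "rvec u2"] y z unfolding x by (intro mult_mono power_mono) (auto simp: L_def)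
    also have "\<dots> = L ^ 4 * (1 + norm x) ^ 4"
      by (simp only: power_mult_distrib power2_eq_square power4_eq_xxxx mult_ac)
    finally have "norm (F x) * ((1 + y) ^ 2 * (1 + z) ^ 2) \<le> norm (F x) * (L ^ 4 * (1 + norm x) ^ 4)"
      by (intro mult_left_mono) auto
    also have "\<dots> = L ^ 4 * (norm (F x) * (1 + norm x) ^ 4)"
      by (simp only: mult_ac)
    also have "\<dots> \<le> L ^ 4 * A"
      using y z x by (intro mult_left_mono A) (auto simp: L_def)
    finally have "norm (F x) * ((1 + y) ^ 2 * (1 + z) ^ 2) \<le> A * L ^ 4"
      by (simp only: mult.commute)
    moreover have "0 < (1 + y) ^ 2 * (1 + z) ^ 2"
      using y z by (intro mult_pos_pos zero_less_power) auto
    ultimately show ?thesis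
      unfolding x_def by (simp only: pos_le_divide_eq)
  qed
  thus ?thesis by blast
qed

section \<open>The asymptotic expansion\<close>

theorem theorem4p6:
  fixes v1 v2 u1 u2 :: "int ^ 2" and f :: "real ^ 2 \<Rightarrow> complex"
  assumes "lattice_cone v1 v2"
    and "is_dual_cone v1 v2 u1 u2"
    and "smooth f"
    and "\<exists>h. 0 < h $ 1 \<and> 0 < h $ 2 \<and> smooth_integrable_on f (shifted_cone u1 u2 h)"
    and "rapidly_decaying_on f (cone_set v1 v2)"
  shows "\<exists>c :: nat \<Rightarrow> complex.
    (\<forall>k. \<forall>t>0.
       homog_op (EM_symbol u1 u2) k
         (\<lambda>h. set_lebesgue_integral lborel (shifted_cone u1 u2 h) (\<lambda>x. f (t *\<^sub>R x))) 0
       = c k * of_real t powi (int k - 2)) \<and>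
    (\<forall>N. (\<lambda>t. (\<Sum>\<^sub>\<infinity>x\<in>cone_set v1 v2 \<inter> range rvec. of_real (wt (cone_set v1 v2) x) * f (t *\<^sub>R x))
             - (\<Sum>k\<le>N. c k * of_real t powi (int k - 2)))
         \<in> o[at_right 0](\<lambda>t. of_real t powi (int N - 2)))"
proof -
  have lc: "lattice_cone u1 u2" using assms(2) by (simp add: is_dual_cone_def)
  obtain w where w: "det2 u1 w = 1"
    using primitive_complement lc unfolding lattice_cone_def by blast
  have d: "det2 u1 u2 \<noteq> 0" by (rule lattice_cone_det2[OF lc])
  interpret complemented_pair u1 u2 w
    by unfold_locales (fact w d)+
  define S where "S = {x. 0 \<le> x \<bullet> rvec u1 \<and> 0 \<le> x \<bullet> rvec u2}"
  have S: "cone_set v1 v2 = S"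
    unfolding S_def by (rule cone_set_eq_halfplanes[OF assms(1,2)])
  obtain h0 where h0: "0 < h0 $ 1" "0 < h0 $ 2" and int0: "smooth_integrable_on f (shifted_cone u1 u2 h0)"
    using assms(4) by blast
  \<comment> \<open>Moving along \<open>\<alpha>1\<close> or \<open>\<alpha>2\<close> changes just
    one of the coordinates \<open>y\<close>, \<open>z\<close>. The nesting copies that of the
    partial derivatives in \<open>homog_op\<close>.\<close>
  define D where "D a b = (dir_deriv \<alpha>1 ^^ a) ((dir_deriv \<alpha>2 ^^ b) f)" for a b
  define g where "g a b y z = D a b (y *\<^sub>R \<alpha>1 + z *\<^sub>R \<alpha>2)" for a b y z
  have D_Suc: "D (Suc a) b = dir_deriv \<alpha>1 (D a b)" "D 0 (Suc b) = dir_deriv \<alpha>2 (D 0 b)" for a b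
    by (simp_all add: D_def)
  have good: "smooth (D a b) \<and> smooth_integrable_on (D a b) (shifted_cone u1 u2 h0) \<and> rapidly_decaying_on (D a b) S" for a b
  proof (induction a)
    case 0
    show ?case
      using assms(3,5) int0
      by (induction b) (auto simp: D_Suc(2) smooth_dir_deriv smooth_integrable_on_dir_deriv
          rapidly_decaying_on_dir_deriv S, auto simp: D_def)
  next
    case (Suc a)
    thus ?case
      by (simp add: D_Suc(1) smooth_dir_deriv smooth_integrable_on_dir_deriv rapidly_decaying_on_dir_deriv)
  qed
  have cont: "continuous_on UNIV (D a b)" for a b
    using good smooth_imp_continuous_on by blast
  have meas: "D a b \<in> borel_measurable borel" for a b
    by (rule borel_measurable_continuous_onI[OF cont])
  have closed_shifted: "shifted_cone u1 u2 h \<in> sets borel" for h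
    unfolding shifted_cone_def
    by (intro borel_closed closed_Collect_conj closed_Collect_le continuous_intros)
  have det_pair: "\<alpha>1 $ 1 * \<alpha>2 $ 2 - \<alpha>2 $ 1 * \<alpha>1 $ 2 = 1 / det2 u1 u2"
    using d by (simp add: dual_vec_nth[OF d] divide_simps) (simp add: det2_def algebra_simps)
  interpret quadrant_function g "h0 $ 1" "h0 $ 2"
  proof
    fix a b y z
    show "((\<lambda>y. g a b y z) has_vector_derivative g (Suc a) b y z) (at y)"
      using dir_deriv_has_vector_derivative[of "D a b" "z *\<^sub>R \<alpha>2" y \<alpha>1] good smooth_imp_differentiable
      unfolding g_def D_Suc by (simp add: add.commute)
    show "(g 0 b y has_vector_derivative g 0 (Suc b) y z) (at z)"
      using dir_deriv_has_vector_derivative[of "D 0 b" "y *\<^sub>R \<alpha>1" z \<alpha>2] good smooth_imp_differentiable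
      unfolding g_def D_Suc by simp
    show "continuous_on UNIV (\<lambda>(y, z). g a b y z)"
      unfolding g_def case_prod_unfold
      by (rule continuous_on_compose2[OF cont]) (auto intro!: continuous_intros)
    have "set_integrable lborel (shifted_cone u1 u2 h0) (foldr partial [] (D a b))"
      using good unfolding smooth_integrable_on_def by blast
    hence "set_integrable lborel (shifted_cone u1 u2 h0) (D a b)" by simp
    hence "set_integrable lborel ((\<lambda>(y, z). y *\<^sub>R \<alpha>1 + z *\<^sub>R \<alpha>2) -` shifted_cone u1 u2 h0)
        (\<lambda>p. D a b (case p of (y, z) \<Rightarrow> y *\<^sub>R \<alpha>1 + z *\<^sub>R \<alpha>2))"
      using linear_pair_change_of_variables(1)[OF _ meas closed_shifted, of \<alpha>1 \<alpha>2 h0 a b] d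
      unfolding det_pair by simp
    moreover have "(\<lambda>(y, z). y *\<^sub>R \<alpha>1 + z *\<^sub>R \<alpha>2) -` shifted_cone u1 u2 h0 = {- h0 $ 1..} \<times> {- h0 $ 2..}"
      by (auto simp: shifted_cone_def dual_comb_inner)
    moreover have "(\<lambda>p. D a b (case p of (y, z) \<Rightarrow> y *\<^sub>R \<alpha>1 + z *\<^sub>R \<alpha>2)) = (\<lambda>(y, z). g a b y z)"
      by (auto simp: g_def)
    ultimately show "set_integrable lborel ({- h0 $ 1..} \<times> {- h0 $ 2..}) (\<lambda>(y, z). g a b y z)"
      by simp
  qed
  have "\<exists>A. \<forall>y z. 0 \<le> y \<longrightarrow> 0 \<le> z \<longrightarrow> norm (g a b y z) \<le> A / ((1 + y) ^ 2 * (1 + z) ^ 2)" for a b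
    unfolding g_def using good[of a b] unfolding S_def by (intro quadrant_bound d) auto
  hence "\<exists>A. \<forall>a b y z. 0 \<le> y \<longrightarrow> 0 \<le> z \<longrightarrow> norm (g a b y z) \<le> A a b / ((1 + y) ^ 2 * (1 + z) ^ 2)"
    by metis
  then obtain A where A: "\<And>a b y z. 0 \<le> y \<Longrightarrow> 0 \<le> z \<Longrightarrow> norm (g a b y z) \<le> A a b / ((1 + y) ^ 2 * (1 + z) ^ 2)"
    by blast
  \<comment> \<open>The \<open>1 / q\<close> stands at once for the Jacobian of the coordinates, as
    needed in \<open>hom\<close>, and for the average over the characters, as needed in
    \<open>asym\<close>.\<close>
  define W where "W a b = EM_symbol u1 u2 a b * (Q a b 0 / of_nat q)" for a b
  define c where "c k = (\<Sum>a\<le>k. W a (k - a))" for k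
  have hom: "homog_op (EM_symbol u1 u2) k
         (\<lambda>h. set_lebesgue_integral lborel (shifted_cone u1 u2 h) (\<lambda>x. f (t *\<^sub>R x))) 0
       = c k * of_real t powi (int k - 2)" if t: "0 < t" for k t
  proof -
    let ?F = "\<lambda>h. set_lebesgue_integral lborel (shifted_cone u1 u2 h) (\<lambda>x. f (t *\<^sub>R x))"
    \<comment> \<open>The absolute Jacobian of \<open>x = (y *\<^sub>R \<alpha>1 + z *\<^sub>R
      \<alpha>2) /\<^sub>R t\<close>: the pair \<open>\<alpha>1\<close>, \<open>\<alpha>2\<close>
      has determinant \<open>1 / det2 u1 u2\<close>, and the scaling contributes
      \<open>1 / t ^ 2\<close>.\<close>
    define \<kappa> :: complex where "\<kappa> = 1 / (of_nat q * of_real t ^ 2)"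
    have F: "?F h = \<kappa> * Q 0 0 (t *\<^sub>R h)" for h
    proof -
      let ?T = "\<lambda>(y, z). y *\<^sub>R ((1 / t) *\<^sub>R \<alpha>1) + z *\<^sub>R ((1 / t) *\<^sub>R \<alpha>2)"
      have det: "((1 / t) *\<^sub>R \<alpha>1) $ 1 * ((1 / t) *\<^sub>R \<alpha>2) $ 2 - ((1 / t) *\<^sub>R \<alpha>2) $ 1 * ((1 / t) *\<^sub>R \<alpha>1) $ 2
          = 1 / (t ^ 2 * det2 u1 u2)"
      proof -
        have "((1 / t) *\<^sub>R \<alpha>1) $ 1 * ((1 / t) *\<^sub>R \<alpha>2) $ 2 - ((1 / t) *\<^sub>R \<alpha>2) $ 1 * ((1 / t) *\<^sub>R \<alpha>1) $ 2
            = (1 / t ^ 2) * (\<alpha>1 $ 1 * \<alpha>2 $ 2 - \<alpha>2 $ 1 * \<alpha>1 $ 2)"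
          by (simp add: power2_eq_square diff_divide_distrib)
        thus ?thesis unfolding det_pair by simp
      qed
      have abs: "complex_of_real \<bar>1 / (t ^ 2 * det2 u1 u2)\<bar> = \<kappa>"
      proof -
        have "\<bar>1 / (t ^ 2 * det2 u1 u2)\<bar> = 1 / (real q * t ^ 2)"
          by (simp add: q_def abs_mult abs_divide)
        thus ?thesis by (simp add: \<kappa>_def)
      qed
      have m: "(\<lambda>x. f (t *\<^sub>R x)) \<in> borel_measurable borel"
      proof -
        have "continuous_on UNIV (\<lambda>x::real ^ 2. t *\<^sub>R x)"
          by (intro continuous_on_scaleR continuous_on_const continuous_on_id)
        from continuous_on_compose2[OF smooth_imp_continuous_on[OF assms(3)] this subset_UNIV]
        show ?thesis by (rule borel_measurable_continuous_onI)
      qed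
      have vim: "?T -` shifted_cone u1 u2 h = {- (t *\<^sub>R h) $ 1..} \<times> {- (t *\<^sub>R h) $ 2..}"
      proof -
        have T: "?T (y, z) = (y / t) *\<^sub>R \<alpha>1 + (z / t) *\<^sub>R \<alpha>2" for y z by simp
        have "?T (y, z) \<in> shifted_cone u1 u2 h \<longleftrightarrow> - (t * h $ 1) \<le> y \<and> - (t * h $ 2) \<le> z" for y z
          unfolding T shifted_cone_def mem_Collect_eq dual_comb_inner using t by (simp add: pos_le_divide_eq mult.commute)
        thus ?thesis by auto
      qed
      have fT: "f (t *\<^sub>R ?T p) = (case p of (y, z) \<Rightarrow> g 0 0 y z)" for p
        using t by (cases p) (simp add: g_def D_def scaleR_add_right)
      have nz: "1 / (t ^ 2 * det2 u1 u2) \<noteq> 0" using t d by simp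
      show ?thesis
        using linear_pair_change_of_variables(2)[of "(1 / t) *\<^sub>R \<alpha>1" "(1 / t) *\<^sub>R \<alpha>2", unfolded det, OF nz m closed_shifted[of h]]
        unfolding abs vim fT by (simp add: Q_def)
    qed
    have "0 \<in> U" using h0 by (simp add: U_def)
    hence it: "(partial 1 ^^ a) ((partial 2 ^^ b) ?F) 0 = \<kappa> * of_real t ^ (a + b) * Q a b 0" for a b
      using iterated_partials[of t ?F \<kappa> 0 a b, OF F] by simp
    have "homog_op (EM_symbol u1 u2) k ?F 0 = (\<Sum>a\<le>k. W a (k - a) * (of_real t ^ k / of_real t ^ 2))"
      unfolding homog_op_def it by (intro sum.cong refl) (simp add: W_def \<kappa>_def)
    also have "\<dots> = c k * (of_real t ^ k / of_real t ^ 2)"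
      unfolding c_def by (rule sum_distrib_right[symmetric])
    also have "of_real t ^ k / of_real t ^ 2 = (of_real t powi (int k - 2) :: complex)"
      using t by (simp add: power_int_diff)
    finally show ?thesis .
  qed
  define L where "L t = (\<Sum>\<^sub>\<infinity>x\<in>S \<inter> range rvec. of_real (wt S x) * f (t *\<^sub>R x))" for t
  have asym: "(\<lambda>t. L t - (\<Sum>k\<le>N. c k * of_real t powi (int k - 2)))
         \<in> o[at_right 0](\<lambda>t. of_real t powi (int N - 2))" for N
  proof -
    \<comment> \<open>One order beyond \<open>N\<close> makes the error small compared with the last
      term kept, and \<open>M \<ge> 1\<close> keeps the exponent pair \<open>(1, 1)\<close> in the
      square even for \<open>N = 0\<close>.\<close>
    define M where "M = Suc N"
    define s where "s j t = (\<Sum>m. \<Sum>n. half_weight m * half_weight n * (\<zeta>1 ^ j) ^ m * (\<zeta>2 ^ j) ^ n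
         * g 0 0 (t * real m) (t * real n))" for j t
    define e where "e j a b = fps_nth (half_Todd (\<zeta>1 ^ j)) a * fps_nth (half_Todd (\<zeta>2 ^ j)) b" for j a b
    have "\<exists>C. \<forall>t. 0 < t \<longrightarrow> t \<le> 1 \<longrightarrow>
        norm (of_real t ^ 2 * s j t - (\<Sum>a\<le>M. \<Sum>b\<le>M. e j a b * of_real t ^ (a + b) * Q a b 0)) \<le> C * t ^ M" for j
      unfolding s_def e_def
    proof (rule lattice_sum_expansion[where A = A, OF h0 _ _ _ A])
      show "norm (\<zeta>1 ^ j) = 1" "norm (\<zeta>2 ^ j) = 1" "0 < M"
        by (simp_all add: norm_power norm_zeta M_def)
    qed
    hence "\<exists>C. \<forall>j. \<forall>t. 0 < t \<longrightarrow> t \<le> 1 \<longrightarrow>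
        norm (of_real t ^ 2 * s j t - (\<Sum>a\<le>M. \<Sum>b\<le>M. e j a b * of_real t ^ (a + b) * Q a b 0)) \<le> C j * t ^ M"
      by (intro choice allI)
    then obtain C where "\<forall>j. \<forall>t. 0 < t \<longrightarrow> t \<le> 1 \<longrightarrow>
        norm (of_real t ^ 2 * s j t - (\<Sum>a\<le>M. \<Sum>b\<le>M. e j a b * of_real t ^ (a + b) * Q a b 0)) \<le> C j * t ^ M"
      by (elim exE)
    note C = this[rule_format]
    show ?thesis
    proof (rule smallo_from_scaled_bound)
      fix t :: real assume t: "0 < t" "t \<le> 1"
      let ?E = "\<lambda>j. of_real t ^ 2 * s j t - (\<Sum>a\<le>M. \<Sum>b\<le>M. e j a b * of_real t ^ (a + b) * Q a b 0)"
      have L: "L t = 1 / of_nat q * (\<Sum>j<q. s j t) - g 0 0 0 0 / 4"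
        using lattice_sum_eq[of f "A 0 0" t] A[of _ _ 0 0] t
        unfolding L_def S_def s_def g_def D_def by simp
      \<comment> \<open>The correction \<open>- q / 4\<close> in \<open>EM_symbol_eq\<close> meets
        \<open>Q 1 1 0 = g 0 0 0 0\<close>, the value of \<open>f\<close> at the origin, and so
        reproduces exactly the weight correction in \<open>L\<close>.\<close>
      have WM: "(\<Sum>a\<le>M. \<Sum>b\<le>M. W a b * of_real t ^ (a + b))
          = 1 / of_nat q * (\<Sum>j<q. \<Sum>a\<le>M. \<Sum>b\<le>M. e j a b * of_real t ^ (a + b) * Q a b 0) - of_real t ^ 2 * (g 0 0 0 0 / 4)"
      proof -
        have W: "W a b * of_real t ^ (a + b) = (\<Sum>j<q. 1 / of_nat q * (e j a b * of_real t ^ (a + b) * Q a b 0))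
            - (if a = 1 then if b = 1 then of_real t ^ 2 * (g 0 0 0 0 / 4) else 0 else 0)" for a b
        proof -
          have "W a b * of_real t ^ (a + b) = EM_symbol u1 u2 a b * (of_real t ^ (a + b) * Q a b 0 / of_nat q)"
            by (simp add: W_def)
          hence "W a b * of_real t ^ (a + b) = (\<Sum>j<q. e j a b) * (of_real t ^ (a + b) * Q a b 0 / of_nat q)
              - (if a = 1 \<and> b = 1 then of_nat q / 4 else 0) * (of_real t ^ (a + b) * Q a b 0 / of_nat q)"
            by (simp only: EM_symbol_eq e_def left_diff_distrib)
          moreover have "(\<Sum>j<q. e j a b) * (of_real t ^ (a + b) * Q a b 0 / of_nat q)
              = (\<Sum>j<q. 1 / of_nat q * (e j a b * of_real t ^ (a + b) * Q a b 0))"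
            unfolding sum_distrib_right by (intro sum.cong refl) simp
          moreover have "(if a = 1 \<and> b = 1 then of_nat q / 4 else 0) * (of_real t ^ (a + b) * Q a b 0 / of_nat q)
              = (if a = 1 then if b = 1 then of_real t ^ 2 * (g 0 0 0 0 / 4) else 0 else 0)"
            using q_pos by (simp add: Q_def power2_eq_square)
          ultimately show ?thesis by simp
        qed
        have one: "(\<Sum>a\<le>M. \<Sum>b\<le>M. if a = 1 then if b = 1 then x else 0 else 0) = x" for x :: complex
        proof -
          have "(\<Sum>a\<le>M. \<Sum>b\<le>M. if a = 1 then if b = 1 then x else 0 else 0) = (\<Sum>a\<le>M. if a = 1 then x else 0)"
            by (intro sum.cong refl) (simp add: M_def)
          thus ?thesis by (simp add: M_def)
        qed
        have "(\<Sum>a\<le>M. \<Sum>b\<le>M. \<Sum>j<q. 1 / of_nat q * (e j a b * of_real t ^ (a + b) * Q a b 0))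
            = (\<Sum>j<q. \<Sum>a\<le>M. \<Sum>b\<le>M. 1 / of_nat q * (e j a b * of_real t ^ (a + b) * Q a b 0))"
          by (simp only: sum.swap[of _ "{..<q}" "{..M}"])
        thus ?thesis
          unfolding W sum_subtractf one by (simp only: sum_distrib_left)
      qed
      have first: "norm (of_real t ^ 2 * L t - (\<Sum>a\<le>M. \<Sum>b\<le>M. W a b * of_real t ^ (a + b)))
          \<le> (1 / real q * (\<Sum>j<q. C j)) * t ^ Suc N"
      proof -
        have eq: "of_real t ^ 2 * L t - (\<Sum>a\<le>M. \<Sum>b\<le>M. W a b * of_real t ^ (a + b)) = 1 / of_nat q * (\<Sum>j<q. ?E j)"
          unfolding L WM sum_subtractf sum_distrib_left[symmetric] by (simp add: right_diff_distrib)
        have "norm (\<Sum>j<q. ?E j) \<le> (\<Sum>j<q. C j * t ^ M)"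
          by (intro sum_norm_le C t)
        also have "\<dots> = (\<Sum>j<q. C j) * t ^ Suc N"
          unfolding M_def by (rule sum_distrib_right[symmetric])
        finally have "1 / real q * norm (\<Sum>j<q. ?E j) \<le> 1 / real q * ((\<Sum>j<q. C j) * t ^ Suc N)"
          by (intro mult_left_mono) auto
        thus ?thesis
          unfolding eq norm_mult norm_divide norm_one norm_of_nat mult.assoc .
      qed
      have second: "norm ((\<Sum>a\<le>M. \<Sum>b\<le>M. W a b * of_real t ^ (a + b)) - (\<Sum>k\<le>N. c k * of_real t ^ k))
          \<le> (\<Sum>a\<le>M. \<Sum>b\<le>M. norm (W a b)) * t ^ Suc N"
        unfolding c_def by (rule norm_square_minus_triangle[OF t]) (simp add: M_def)
      show "norm (of_real t ^ 2 * L t - (\<Sum>k\<le>N. c k * of_real t ^ k))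
          \<le> (1 / real q * (\<Sum>j<q. C j) + (\<Sum>a\<le>M. \<Sum>b\<le>M. norm (W a b))) * t ^ Suc N"
        unfolding distrib_right by (rule norm_diff_triangle_le[OF first second])
    qed
  qed
  show ?thesis
    unfolding S using hom asym unfolding L_def by blast
qed

end
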